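(* Let $p>1$, let $(M,g)$ be a complete Riemannian manifold and let $\Omega\subset M$ be an open set. Let $\rho\in W^{1,p}_{loc}(\Omega)$ be a nonnegative function on $\Omega$ such that $-\Delta_p\rho\ge 0$ on $\Omega$ in weak sense. Then $\frac{|\nabla\rho|^p}{\rho^p}\in L^1_{loc}(\Omega)$, and $$\left(\frac{p-1}{p}\right)^p\int_\Omega \frac{|u|^p}{\rho^p}\,|\nabla\rho|^p\,dv_g\le\int_\Omega|\nabla u|^p\,dv_g\qquad\text{for every } u\in C_0^\infty(\Omega).$$
   Context: $dv_g$, $\nabla$ and $\mathrm{div}$ are the volume form, gradient and divergence of the metric $g$; $\Delta_p u=\mathrm{div}(|\nabla u|^{p-2}\nabla u)$. $C_0^k(\Omega)$ denotes compactly supported $C^k$ functions in $\Omega$. The inequality $-\Delta_p\rho\ge0$ on $\Omega$ in weak sense means that for every nonnegative $\varphi\in C_0^1(\Omega)$ one has $\int_\Omega|\nabla\rho|^{p-2}(\nabla\rho\cdot\nabla\varphi)\,dv_g\ge0$. *)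

theory Defs
  imports "HOL-Analysis.Analysis"
begin

section \<open>Functions of class $C^k$ between normed spaces\<close>

text \<open>On an open set of a finite-dimensional space, \<open>f\<close> is $C^{k+1}$ iff it is (Frechet)
  differentiable and all its directional derivatives are $C^k$. Only used for open \<open>S\<close>.\<close>

primrec Ck_on :: "nat \<Rightarrow> 'e::real_normed_vector set \<Rightarrow> ('e \<Rightarrow> 'f::real_normed_vector) \<Rightarrow> bool"
where
  "Ck_on 0 S f \<longleftrightarrow> continuous_on S f"
| "Ck_on (Suc k) S f \<longleftrightarrow>
     (\<forall>x\<in>S. f differentiable (at x)) \<and> (\<forall>v. Ck_on k S (\<lambda>x. frechet_derivative f (at x) v))"

definition smooth_on :: "'e::real_normed_vector set \<Rightarrow> ('e \<Rightarrow> 'f::real_normed_vector) \<Rightarrow> bool"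
  where "smooth_on S f \<longleftrightarrow> (\<forall>k. Ck_on k S f)"

definition compact_support_in :: "'x::topological_space set \<Rightarrow> ('x \<Rightarrow> real) \<Rightarrow> bool"
  where "compact_support_in S f \<longleftrightarrow>
    compact (closure {x. f x \<noteq> 0}) \<and> closure {x. f x \<noteq> 0} \<subseteq> S"


section \<open>Riemannian manifolds\<close>

text \<open>The manifold is the whole type \<open>'a\<close>, of dimension \<open>CARD('n)\<close>. A chart is its domain together
  with its coordinate map. Tensors are given by their components in every chart of the atlas: the
  metric by its matrices $(g_{ij})$, vector fields by their columns $(X^i)$, both as functions of
  the chart and of the point of the manifold; values at points outside the chart domain are
  irrelevant.\<close>

type_synonym ('a, 'n) chart = "'a set \<times> ('a \<Rightarrow> real^'n)"

record ('a, 'n::finite) riemannian =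
  charts :: "('a, 'n) chart set"
  metric :: "('a, 'n) chart \<Rightarrow> 'a \<Rightarrow> real^'n^'n"

type_synonym ('a, 'n) vfield = "('a, 'n) chart \<Rightarrow> 'a \<Rightarrow> real^'n"

abbreviation cdom :: "('a, 'n) chart \<Rightarrow> 'a set" where "cdom c \<equiv> fst c"
abbreviation cmap :: "('a, 'n) chart \<Rightarrow> 'a \<Rightarrow> real^'n" where "cmap c \<equiv> snd c"
abbreviation cinv :: "('a, 'n) chart \<Rightarrow> real^'n \<Rightarrow> 'a" where "cinv c \<equiv> inv_into (fst c) (snd c)"

definition is_chart :: "('a::topological_space, 'n::finite) chart \<Rightarrow> bool"
  where "is_chart c \<longleftrightarrow> open (cdom c) \<and> open (cmap c ` cdom c) \<and>
    homeomorphism (cdom c) (cmap c ` cdom c) (cmap c) (cinv c)"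

definition smooth_atlas :: "('a::topological_space, 'n::finite) chart set \<Rightarrow> bool"
  where "smooth_atlas A \<longleftrightarrow> (\<forall>c\<in>A. is_chart c) \<and> (\<Union>c\<in>A. cdom c) = UNIV \<and>
    (\<forall>c\<in>A. \<forall>d\<in>A. smooth_on (cmap c ` (cdom c \<inter> cdom d)) (cmap d \<circ> cinv c))"

text \<open>Jacobian matrix at \<open>x\<close> of the change of coordinates from \<open>c\<close> to \<open>d\<close>.\<close>

definition jac :: "('a, 'n::finite) chart \<Rightarrow> ('a, 'n) chart \<Rightarrow> 'a \<Rightarrow> real^'n^'n"
  where "jac c d x = matrix (frechet_derivative (cmap d \<circ> cinv c) (at (cmap c x)))"

text \<open>The topological requirements Hausdorff and second countable are imposed by the sort
  of \<open>'a\<close>.\<close>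

definition riemannian_manifold ::
  "('a::{t2_space, second_countable_topology}, 'n::finite) riemannian \<Rightarrow> bool"
  where "riemannian_manifold M \<longleftrightarrow> smooth_atlas (charts M) \<and>
    (\<forall>c\<in>charts M. smooth_on (cmap c ` cdom c) (\<lambda>y. metric M c (cinv c y)) \<and>
      (\<forall>x\<in>cdom c. transpose (metric M c x) = metric M c x \<and>
                   (\<forall>v. v \<noteq> 0 \<longrightarrow> v \<bullet> (metric M c x *v v) > 0))) \<and>
    (\<forall>c\<in>charts M. \<forall>d\<in>charts M. \<forall>x\<in>cdom c \<inter> cdom d.
      metric M c x = transpose (jac c d x) ** metric M d x ** jac c d x)"

definition vector_field_on :: "('a, 'n::finite) riemannian \<Rightarrow> 'a set \<Rightarrow> ('a, 'n) vfield \<Rightarrow> bool"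
  where "vector_field_on M S X \<longleftrightarrow>
    (\<forall>c\<in>charts M. \<forall>d\<in>charts M. \<forall>x\<in>S \<inter> cdom c \<inter> cdom d. X d x = jac c d x *v X c x)"

text \<open>Scalars such as $g(X,Y)$ do not depend on the chart in which they are computed, so any chart
  around the point will do.\<close>

definition chart_at :: "('a, 'n::finite) riemannian \<Rightarrow> 'a \<Rightarrow> ('a, 'n) chart"
  where "chart_at M x = (SOME c. c \<in> charts M \<and> x \<in> cdom c)"

definition gdot :: "('a, 'n::finite) riemannian \<Rightarrow> ('a, 'n) vfield \<Rightarrow> ('a, 'n) vfield \<Rightarrow> 'a \<Rightarrow> real"
  where "gdot M X Y x =
    (let c = chart_at M x in X c x \<bullet> (metric M c x *v Y c x))"

definition gnorm :: "('a, 'n::finite) riemannian \<Rightarrow> ('a, 'n) vfield \<Rightarrow> 'a \<Rightarrow> real"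
  where "gnorm M X x = sqrt (gdot M X X x)"


subsection \<open>Distance and completeness\<close>

definition piecewise_C1_curve ::
  "('a::topological_space, 'n::finite) riemannian \<Rightarrow> (real \<Rightarrow> 'a) \<Rightarrow> bool"
  where "piecewise_C1_curve M \<gamma> \<longleftrightarrow> continuous_on {0..1} \<gamma> \<and>
    (\<forall>c\<in>charts M. \<forall>a b. 0 \<le> a \<and> a \<le> b \<and> b \<le> 1 \<and> \<gamma> ` {a..b} \<subseteq> cdom c \<longrightarrow>
      (cmap c \<circ> \<gamma>) piecewise_C1_differentiable_on {a..b})"

definition speed :: "('a, 'n::finite) riemannian \<Rightarrow> (real \<Rightarrow> 'a) \<Rightarrow> real \<Rightarrow> real"
  where "speed M \<gamma> t =
    (let c = chart_at M (\<gamma> t); v = vector_derivative (cmap c \<circ> \<gamma>) (at t)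
     in sqrt (v \<bullet> (metric M c (\<gamma> t) *v v)))"

definition curve_length :: "('a, 'n::finite) riemannian \<Rightarrow> (real \<Rightarrow> 'a) \<Rightarrow> ennreal"
  where "curve_length M \<gamma> = (\<integral>\<^sup>+t\<in>{0..1}. ennreal (speed M \<gamma> t) \<partial>lborel)"

text \<open>Infinite for points in different connected components.\<close>

definition riem_dist :: "('a::topological_space, 'n::finite) riemannian \<Rightarrow> 'a \<Rightarrow> 'a \<Rightarrow> ennreal"
  where "riem_dist M x y =
    (INF \<gamma>\<in>{\<gamma>. piecewise_C1_curve M \<gamma> \<and> \<gamma> 0 = x \<and> \<gamma> 1 = y}. curve_length M \<gamma>)"

definition riemannian_complete :: "('a::topological_space, 'n::finite) riemannian \<Rightarrow> bool"
  where "riemannian_complete M \<longleftrightarrow>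
    (\<forall>s :: nat \<Rightarrow> 'a.
      (\<forall>e>0. \<exists>N. \<forall>m\<ge>N. \<forall>n\<ge>N. riem_dist M (s m) (s n) < e) \<longrightarrow>
      (\<exists>x. (\<lambda>n. riem_dist M (s n) x) \<longlonglongrightarrow> 0))"


subsection \<open>Volume measure\<close>

text \<open>$dv_g$ is the unique Borel measure equal to $\sqrt{\det(g_{ij})}\,dx$ in every chart.\<close>

definition is_volume ::
  "('a::topological_space, 'n::finite) riemannian \<Rightarrow> 'a measure \<Rightarrow> bool"
  where "is_volume M \<mu> \<longleftrightarrow> sets \<mu> = sets borel \<and>
    (\<forall>c\<in>charts M. \<forall>B\<in>sets borel. B \<subseteq> cdom c \<longrightarrow>
      emeasure \<mu> B = (\<integral>\<^sup>+y\<in>cmap c ` B. ennreal (sqrt (det (metric M c (cinv c y)))) \<partial>lborel))"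

definition vol :: "('a::topological_space, 'n::finite) riemannian \<Rightarrow> 'a measure"
  where "vol M = (THE \<mu>. is_volume M \<mu>)"


section \<open>Function spaces and gradients\<close>

text \<open>Compactly supported $C^k$ functions in \<open>\<Omega>\<close>, extended by zero to the manifold.\<close>

definition C0k ::
  "('a::topological_space, 'n::finite) riemannian \<Rightarrow> nat \<Rightarrow> 'a set \<Rightarrow> ('a \<Rightarrow> real) set"
  where "C0k M k \<Omega> = {u. compact_support_in \<Omega> u \<and>
    (\<forall>c\<in>charts M. Ck_on k (cmap c ` cdom c) (u \<circ> cinv c))}"

definition C0_infty ::
  "('a::topological_space, 'n::finite) riemannian \<Rightarrow> 'a set \<Rightarrow> ('a \<Rightarrow> real) set"
  where "C0_infty M \<Omega> = (\<Inter>k. C0k M k \<Omega>)"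

definition partial :: "(real^'n::finite \<Rightarrow> real) \<Rightarrow> 'n \<Rightarrow> real^'n \<Rightarrow> real"
  where "partial f i y = frechet_derivative f (at y) (axis i 1)"

text \<open>Gradient of a differentiable function: $(\nabla u)^i = g^{ij}\,\partial_j u$.\<close>

definition grad :: "('a, 'n::finite) riemannian \<Rightarrow> ('a \<Rightarrow> real) \<Rightarrow> ('a, 'n) vfield"
  where "grad M u = (\<lambda>c x.
    matrix_inv (metric M c x) *v (\<chi> j. partial (u \<circ> cinv c) j (cmap c x)))"

definition Lp_loc ::
  "('a::topological_space, 'n::finite) riemannian \<Rightarrow> real \<Rightarrow> 'a set \<Rightarrow> ('a \<Rightarrow> real) \<Rightarrow> bool"
  where "Lp_loc M p \<Omega> f \<longleftrightarrow> set_borel_measurable borel \<Omega> f \<and>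
    (\<forall>K. compact K \<and> K \<subseteq> \<Omega> \<longrightarrow> set_integrable (vol M) K (\<lambda>x. \<bar>f x\<bar> powr p))"

text \<open>$L^1_{loc}$ for \<open>[0,\<infinity>]\<close>-valued functions. It is meant for quotients such as
  $|\nabla\rho|^p/\rho^p$ formed in \<open>ennreal\<close>, where \<open>a / 0 = \<infinity>\<close> for \<open>a \<noteq> 0\<close>
  (whereas \<open>a / 0 = 0\<close> in \<open>real\<close>) and \<open>0 / 0 = 0\<close>.\<close>

definition L1_loc_nonneg ::
  "('a::topological_space, 'n::finite) riemannian \<Rightarrow> 'a set \<Rightarrow> ('a \<Rightarrow> ennreal) \<Rightarrow> bool"
  where "L1_loc_nonneg M \<Omega> f \<longleftrightarrow> f \<in> borel_measurable (restrict_space borel \<Omega>) \<and>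
    (\<forall>K. compact K \<and> K \<subseteq> \<Omega> \<longrightarrow> (\<integral>\<^sup>+x\<in>K. f x \<partial>vol M) < \<infinity>)"

text \<open>\<open>X\<close> is a weak gradient of \<open>\<rho>\<close> on \<open>\<Omega>\<close>: in every chart its covariant components $g_{ij}X^j$
  are the distributional partial derivatives of \<open>\<rho>\<close>.\<close>

definition is_weak_grad ::
  "('a::topological_space, 'n::finite) riemannian \<Rightarrow> 'a set \<Rightarrow> ('a \<Rightarrow> real) \<Rightarrow> ('a, 'n) vfield \<Rightarrow> bool"
  where "is_weak_grad M \<Omega> \<rho> X \<longleftrightarrow>
    vector_field_on M \<Omega> X \<and>
    (\<forall>c\<in>charts M. set_borel_measurable borel (\<Omega> \<inter> cdom c) (X c)) \<and>
    Lp_loc M 1 \<Omega> \<rho> \<and> Lp_loc M 1 \<Omega> (gnorm M X) \<and>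
    (\<forall>c\<in>charts M. \<forall>\<psi> i. let W = cmap c ` (\<Omega> \<inter> cdom c) in
      smooth_on UNIV \<psi> \<and> compact_support_in W \<psi> \<longrightarrow>
      (LINT y:W|lborel. \<rho> (cinv c y) * partial \<psi> i y) =
      - (LINT y:W|lborel. (metric M c (cinv c y) *v X c (cinv c y)) $ i * \<psi> y))"

text \<open>The weak gradient, determined up to null sets whenever it exists.\<close>

definition weak_grad ::
  "('a::topological_space, 'n::finite) riemannian \<Rightarrow> 'a set \<Rightarrow> ('a \<Rightarrow> real) \<Rightarrow> ('a, 'n) vfield"
  where "weak_grad M \<Omega> \<rho> = (SOME X. is_weak_grad M \<Omega> \<rho> X)"

definition W1p_loc ::
  "('a::topological_space, 'n::finite) riemannian \<Rightarrow> real \<Rightarrow> 'a set \<Rightarrow> ('a \<Rightarrow> real) set"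
  where "W1p_loc M p \<Omega> = {\<rho>. Lp_loc M p \<Omega> \<rho> \<and> (\<exists>X. is_weak_grad M \<Omega> \<rho> X) \<and>
    Lp_loc M p \<Omega> (gnorm M (weak_grad M \<Omega> \<rho>))}"

text \<open>$-\Delta_p\rho \ge 0$ on \<open>\<Omega>\<close> in weak sense. The vector $|\nabla\rho|^{p-2}\nabla\rho$ is
  understood as \<open>0\<close> where $\nabla\rho = 0$, also for \<open>p < 2\<close>.\<close>

definition weakly_p_superharmonic ::
  "('a::topological_space, 'n::finite) riemannian \<Rightarrow> real \<Rightarrow> 'a set \<Rightarrow> ('a \<Rightarrow> real) \<Rightarrow> bool"
  where "weakly_p_superharmonic M p \<Omega> \<rho> \<longleftrightarrow>
    (\<forall>\<phi>\<in>C0k M 1 \<Omega>. (\<forall>x. 0 \<le> \<phi> x) \<longrightarrow>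
      0 \<le> (LINT x:\<Omega>|vol M. gnorm M (weak_grad M \<Omega> \<rho>) x powr (p - 2) *
                            gdot M (weak_grad M \<Omega> \<rho>) (grad M \<phi>) x))"

end

theory Submission
  imports Defs
begin

text \<open>Why the theorem is true. Let $\nabla\rho$ be the weak gradient and test $-\Delta_p\rho \ge 0$ with
  $\varphi = |u|^p (\rho+\varepsilon)^{1-p}$. With $A = |u|\,|\nabla\rho|/(\rho+\varepsilon)$ this gives
  $$(p-1) \int_\Omega A^p \, dv_g \le p \int_\Omega A^{p-1}\, |\nabla u| \, dv_g.$$
  Young's inequality with the weight $s = (p-1)/p$ absorbs the right-hand side and leaves
  $s^p \int A^p \le \int |\nabla u|^p$ (\<open>regularized_Hardy_inequality\<close>). Fatou's lemma for
  $\varepsilon \to 0$ yields the inequality of the theorem for all compactly supported $C^1$ functions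
  (\<open>Hardy_inequality\<close>), with the quotient taken in $[0,\infty]$. Applied to functions that are 1 on a
  neighbourhood of a given point it also shows that $|\nabla\rho|^p/\rho^p$ is locally integrable
  (\<open>quotient_L1_loc\<close>).

  The work lies in justifying this $\varphi$: the weak inequality is about $C^1$ test functions, whereas
  $\rho$ is only a Sobolev function. The tested expression is additive in the weight $|u|^p$, so the
  weight can be decomposed into pieces supported in single charts (\<open>test_inequality\<close>). In a chart, $\rho$
  is replaced by its mollifications, and one passes to the limit (\<open>weak_inequality_test\<close>). This needs that
  mollifications converge in $L^p$ (\<open>mollify_Lp\<close>), which is derived from the continuity of translations
  in $L^1$ (\<open>shift_error_tendsto_0\<close>) applied to $p$-th powers.

  The integrals over the manifold have to be evaluated in charts, which requires that the volume
  measure exists: the chart measures agree on overlaps by the change of variables formula and are glued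
  along a countable Borel partition (\<open>vol_is_volume\<close>).\<close>

section \<open>Calculus of $C^k$ functions\<close>

lemma Ck_on_cong:
  assumes "open S" "\<And>x. x \<in> S \<Longrightarrow> f x = g x" "Ck_on k S f"
  shows "Ck_on k S g"
  using assms
proof (induction k arbitrary: f g)
  case 0
  then show ?case by (simp cong: continuous_on_cong)
next
  case (Suc k)
  have d: "(g has_derivative frechet_derivative f (at x)) (at x)" if "x \<in> S" for x
    by (rule has_derivative_transform_within_open[where f=f, OF _ Suc.prems(1) that])
      (use Suc.prems that in \<open>auto simp: frechet_derivative_works\<close>)
  then have fd: "frechet_derivative f (at x) = frechet_derivative g (at x)" if "x \<in> S" for x
    using frechet_derivative_at that by blast
  show ?case
  proof (simp, intro conjI allI ballI)
    show "g differentiable at x" if "x \<in> S" for x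
      using d that by (auto simp: differentiable_def)
    show "Ck_on k S (\<lambda>x. frechet_derivative g (at x) v)" for v
      by (rule Suc.IH[OF Suc.prems(1), of "\<lambda>x. frechet_derivative f (at x) v"])
        (use Suc.prems fd in auto)
  qed
qed

text \<open>A derivative is usually given by a formula; a rule that takes any such formula avoids
  evaluating \<open>frechet_derivative\<close>.\<close>

lemma Ck_on_SucI:
  assumes "open S" "\<And>x. x \<in> S \<Longrightarrow> (f has_derivative f' x) (at x)"
    and "\<And>v. Ck_on k S (\<lambda>x. f' x v)"
  shows "Ck_on (Suc k) S f"
proof (simp, intro conjI allI ballI)
  show "f differentiable at x" if "x \<in> S" for x
    using assms(2) that by (auto simp: differentiable_def)
  show "Ck_on k S (\<lambda>x. frechet_derivative f (at x) v)" for v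
    by (rule Ck_on_cong[OF assms(1) _ assms(3)[of v]])
      (use assms(2) frechet_derivative_at in metis)
qed

lemma Ck_on_SucD: "open S \<Longrightarrow> Ck_on (Suc k) S f \<Longrightarrow> Ck_on k S f"
proof (induction k arbitrary: f)
  case 0
  then show ?case
    by (auto intro!: continuous_at_imp_continuous_on differentiable_imp_continuous_within)
qed auto

lemma Ck_on_le: "open S \<Longrightarrow> Ck_on k S f \<Longrightarrow> m \<le> k \<Longrightarrow> Ck_on m S f"
  by (induction k) (auto simp: le_Suc_eq simp del: Ck_on.simps dest: Ck_on_SucD)

lemma Ck_on_continuous: "open S \<Longrightarrow> Ck_on k S f \<Longrightarrow> continuous_on S f"
  using Ck_on_le[of S k f 0] by simp

lemma Ck_on_Un:
  "open S \<Longrightarrow> open T \<Longrightarrow> Ck_on k S f \<Longrightarrow> Ck_on k T f \<Longrightarrow> Ck_on k (S \<union> T) f"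
  by (induction k arbitrary: f) (auto intro: continuous_on_open_Un)

lemma Ck_on_const: "open S \<Longrightarrow> Ck_on k S (\<lambda>x. c)"
proof (induction k arbitrary: c)
  case (Suc k)
  show ?case
    by (rule Ck_on_SucI[OF Suc.prems, where f'="\<lambda>x v. 0"]) (auto intro: Suc)
qed auto

lemma Ck_on_affine:
  fixes b :: "'e::real_inner"
  assumes "open S"
  shows "Ck_on k S (\<lambda>x. a + x \<bullet> b)"
proof (cases k)
  case 0
  then show ?thesis by (auto intro!: continuous_intros)
next
  case (Suc k)
  show ?thesis unfolding Suc
    by (rule Ck_on_SucI[OF assms, where f'="\<lambda>x v. v \<bullet> b"])
      (auto intro!: derivative_eq_intros Ck_on_const assms)
qed

lemma Ck_on_add:
  assumes "open S" "Ck_on k S f" "Ck_on k S g"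
  shows "Ck_on k S (\<lambda>x. f x + g x)"
  using assms
proof (induction k arbitrary: f g)
  case 0
  then show ?case by (auto intro!: continuous_intros)
next
  case (Suc k)
  show ?case
    by (rule Ck_on_SucI[OF assms(1), where f'="\<lambda>x v. frechet_derivative f (at x) v + frechet_derivative g (at x) v"])
      (use Suc in \<open>auto intro!: has_derivative_add simp: frechet_derivative_works\<close>)
qed

lemma Ck_on_mult:
  fixes f g :: "'e::real_normed_vector \<Rightarrow> real"
  assumes "open S" "Ck_on k S f" "Ck_on k S g"
  shows "Ck_on k S (\<lambda>x. f x * g x)"
  using assms
proof (induction k arbitrary: f g)
  case 0
  then show ?case by (auto intro!: continuous_intros)
next
  case (Suc k)
  note c = Ck_on_SucD[OF assms(1) Suc.prems(2)] Ck_on_SucD[OF assms(1) Suc.prems(3)]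
  show ?case
    by (rule Ck_on_SucI[OF assms(1), where
          f'="\<lambda>x v. f x * frechet_derivative g (at x) v + frechet_derivative f (at x) v * g x"])
      (use Suc c in \<open>auto intro!: has_derivative_mult Ck_on_add simp: frechet_derivative_works\<close>)
qed

lemma Ck_on_cmult:
  fixes f :: "'e::real_normed_vector \<Rightarrow> real"
  shows "open S \<Longrightarrow> Ck_on k S f \<Longrightarrow> Ck_on k S (\<lambda>x. c * f x)"
  by (intro Ck_on_mult Ck_on_const)

lemma Ck_on_diff:
  fixes f :: "'e::real_normed_vector \<Rightarrow> real"
  shows "open S \<Longrightarrow> Ck_on k S f \<Longrightarrow> Ck_on k S g \<Longrightarrow> Ck_on k S (\<lambda>x. f x - g x)"
  using Ck_on_add[of S k f "\<lambda>x. (-1) * g x"] Ck_on_cmult[of S k g "-1"] by simp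

lemma C1_D:
  assumes "Ck_on 1 S f"
  shows "x \<in> S \<Longrightarrow> (f has_derivative frechet_derivative f (at x)) (at x)"
    and "continuous_on S (\<lambda>x. frechet_derivative f (at x) v)"
  using assms by (auto simp: frechet_derivative_works)

lemma C1_I:
  assumes "open S" "\<And>x. x \<in> S \<Longrightarrow> (f has_derivative f' x) (at x)"
    and "\<And>v. continuous_on S (\<lambda>x. f' x v)"
  shows "Ck_on 1 S f"
  unfolding One_nat_def by (rule Ck_on_SucI[OF assms(1,2)]) (use assms in auto)

text \<open>Since \<open>Ck_on\<close> speaks about one fixed direction at a time, the derivative of the
  outer function, taken in the moving direction \<open>g'(x) v\<close>, is expanded in the
  standard basis.\<close>

lemma C1_compose:
  fixes g :: "'e::real_normed_vector \<Rightarrow> 'f::euclidean_space" and f :: "'f \<Rightarrow> 'g::real_normed_vector"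
  assumes "open S" "open T" and g: "Ck_on 1 S g" and f: "Ck_on 1 T f" and sub: "g ` S \<subseteq> T"
  shows "Ck_on 1 S (\<lambda>x. f (g x))"
proof (rule C1_I[OF assms(1), where f'="\<lambda>x v. frechet_derivative f (at (g x)) (frechet_derivative g (at x) v)"])
  fix x assume x: "x \<in> S"
  show "((\<lambda>x. f (g x)) has_derivative (\<lambda>v. frechet_derivative f (at (g x)) (frechet_derivative g (at x) v))) (at x)"
    by (rule has_derivative_compose[OF C1_D(1)[OF g x]]) (use C1_D(1)[OF f] sub x in auto)
next
  fix v
  have cg: "continuous_on S g"
    using Ck_on_continuous[OF assms(1) g] .
  have eq: "frechet_derivative f (at (g x)) (frechet_derivative g (at x) v) =
      (\<Sum>b\<in>Basis. (frechet_derivative g (at x) v \<bullet> b) *\<^sub>R frechet_derivative f (at (g x)) b)" if "x \<in> S" for x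
  proof -
    have "linear (frechet_derivative f (at (g x)))"
      using C1_D(1)[OF f, of "g x"] sub that by (auto intro: has_derivative_linear)
    then have "frechet_derivative f (at (g x)) (\<Sum>b\<in>Basis. (frechet_derivative g (at x) v \<bullet> b) *\<^sub>R b) =
      (\<Sum>b\<in>Basis. (frechet_derivative g (at x) v \<bullet> b) *\<^sub>R frechet_derivative f (at (g x)) b)"
      by (simp add: linear_sum linear_scale)
    then show ?thesis by (simp add: euclidean_representation)
  qed
  have "continuous_on S (\<lambda>x. frechet_derivative f (at (g x)) b)" for b
    by (rule continuous_on_compose2[OF C1_D(2)[OF f] cg sub])
  then have "continuous_on S (\<lambda>x. \<Sum>b\<in>Basis. (frechet_derivative g (at x) v \<bullet> b) *\<^sub>R frechet_derivative f (at (g x)) b)"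
    by (intro continuous_intros C1_D(2)[OF g])
  then show "continuous_on S (\<lambda>x. frechet_derivative f (at (g x)) (frechet_derivative g (at x) v))"
    using eq by (simp cong: continuous_on_cong)
qed

lemma C1_real_I:
  fixes f :: "real \<Rightarrow> real"
  assumes "open S" "\<And>t. t \<in> S \<Longrightarrow> (f has_real_derivative f' t) (at t)" "continuous_on S f'"
  shows "Ck_on 1 S f"
  by (rule C1_I[OF assms(1), where f'="\<lambda>x v. f' x * v"])
    (use assms in \<open>auto intro!: continuous_intros simp: has_field_derivative_def\<close>)

section \<open>A smooth bump function\<close>

text \<open>The function $e^{-1/t}$ and its products with $t^{-m}$. The derivative of a member is a linear
  combination of two members (\<open>flat_exp_deriv\<close>), which turns smoothness into an
  induction.\<close>

definition flat_exp :: "nat \<Rightarrow> real \<Rightarrow> real"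
  where "flat_exp m t = (if t > 0 then exp (- 1 / t) / t ^ m else 0)"

text \<open>From $e^s \ge s^n/n!$ at $s = 1/t$. A quadratic bound is what makes the derivative at 0
  vanish.\<close>

lemma flat_exp_bound: "\<bar>flat_exp m t\<bar> \<le> fact (m + 2) * t\<^sup>2"
proof (cases "t > 0")
  case True
  have "(1/t) ^ (m+2) / fact (m+2) \<le> (\<Sum>i\<le>m+2. (1/t) ^ i / fact i)"
    by (rule member_le_sum) (use True in auto)
  also have "\<dots> \<le> exp (1 / t)"
  proof -
    have "(\<lambda>i. (1/t) ^ i / fact i) sums exp (1/t)"
      using exp_converges[of "1/t"] by (simp add: divide_inverse mult.commute)
    then show ?thesis
      using True by (metis (no_types, lifting) atMost_iff divide_nonneg_nonneg fact_ge_zero finite_atMost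
          less_imp_le sum_le_suminf sums_summable sums_unique zero_le_divide_1_iff zero_le_power)
  qed
  finally have *: "(1/t) ^ (m+2) / fact (m+2) \<le> exp (1/t)" .
  define c :: real where "c = fact (m+2)"
  have "c > 0" by (simp add: c_def del: fact_Suc)
  then have "1 \<le> c * exp (1/t) * t ^ (m+2)"
    using * True by (fold c_def) (simp add: field_simps del: power_Suc)
  then have "exp (-1/t) \<le> c * t ^ (m+2)"
    using True by (simp add: field_simps exp_minus)
  then have "exp (-1/t) / t ^ m \<le> c * t\<^sup>2"
    using True by (simp add: field_simps power_add power2_eq_square)
  then show ?thesis using True by (fold c_def) (simp add: flat_exp_def)
qed (auto simp: flat_exp_def)

lemma has_real_derivative_of_square_bound:
  fixes f :: "real \<Rightarrow> real"
  assumes "\<And>t. \<bar>f t\<bar> \<le> C * t\<^sup>2"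
  shows "(f has_real_derivative 0) (at 0)"
proof -
  have f0: "f 0 = 0" using assms[of 0] by simp
  have "((\<lambda>h. f h / h) \<longlongrightarrow> 0) (at 0)"
  proof (rule Lim_null_comparison)
    have "norm (f h / h) \<le> C * \<bar>h\<bar>" if "h \<noteq> 0" for h
      using assms[of h] that
      by (simp add: divide_le_eq power2_eq_square abs_mult_self_eq mult.assoc)
    then show "\<forall>\<^sub>F h in at 0. norm (f h / h) \<le> C * \<bar>h\<bar>"
      by (auto simp: eventually_at_filter)
    show "((\<lambda>h. C * \<bar>h\<bar>) \<longlongrightarrow> 0) (at 0)"
      by (auto intro!: tendsto_eq_intros)
  qed
  then show ?thesis using f0 by (simp add: DERIV_def)
qed

lemma flat_exp_deriv:
  "(flat_exp m has_real_derivative flat_exp (m+2) t - real m * flat_exp (m+1) t) (at t)"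
proof -
  consider "t > 0" | "t < 0" | "t = 0" by linarith
  then show ?thesis
  proof cases
    case 1
    have "((\<lambda>t. exp (- 1 / t) / t ^ m) has_real_derivative
        (exp (-1/t) * (1/t\<^sup>2) * t ^ m - exp (-1/t) * (real m * t ^ (m - 1))) / (t ^ m * t ^ m)) (at t)"
      using 1 by (auto intro!: derivative_eq_intros simp: power2_eq_square)
    moreover have "(exp (-1/t) * (1/t\<^sup>2) * t ^ m - exp (-1/t) * (real m * t ^ (m - 1))) / (t ^ m * t ^ m)
       = flat_exp (m+2) t - real m * flat_exp (m+1) t"
      using 1 by (cases m) (auto simp: flat_exp_def field_simps power2_eq_square)
    ultimately have "((\<lambda>t. exp (- 1 / t) / t ^ m) has_real_derivative flat_exp (m+2) t - real m * flat_exp (m+1) t) (at t)"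
      by simp
    then show ?thesis
      by (rule DERIV_cong_ev[THEN iffD1, rotated -1])
        (use 1 in \<open>auto simp: flat_exp_def eventually_nhds intro!: exI[of _ "{0<..}"]\<close>)
  next
    case 2
    have "((\<lambda>t. 0) has_real_derivative 0) (at t)" by simp
    then have "(flat_exp m has_real_derivative 0) (at t)"
      by (rule DERIV_cong_ev[THEN iffD1, rotated -1])
        (use 2 in \<open>auto simp: flat_exp_def eventually_nhds intro!: exI[of _ "{..<0}"]\<close>)
    then show ?thesis using 2 by (simp add: flat_exp_def)
  next
    case 3
    then show ?thesis
      using has_real_derivative_of_square_bound[OF flat_exp_bound, of m] by (simp add: flat_exp_def[of _ 0])
  qed
qed

text \<open>Differentiating lowers \<open>k\<close> but raises \<open>m\<close>, so the induction on
  \<open>k\<close> is for all \<open>m\<close> at once.\<close>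

lemma Ck_on_flat_exp_compose:
  fixes g :: "'e::real_normed_vector \<Rightarrow> real"
  assumes "open S" "\<And>k. Ck_on k S g"
  shows "Ck_on k S (\<lambda>x. flat_exp m (g x))"
proof (induction k arbitrary: m)
  case 0
  have "continuous_on UNIV (flat_exp m)"
    using flat_exp_deriv by (meson DERIV_isCont continuous_at_imp_continuous_on)
  then show ?case
    using assms(2)[of 0] by (auto intro: continuous_on_compose2)
next
  case (Suc k)
  have d: "(g has_derivative frechet_derivative g (at x)) (at x)" if "x \<in> S" for x
    using assms(2)[of "Suc 0"] that by (auto simp: frechet_derivative_works)
  show ?case
  proof (rule Ck_on_SucI[OF assms(1), where f'="\<lambda>x v. (flat_exp (m+2) (g x) + (- real m) * flat_exp (m+1) (g x)) * frechet_derivative g (at x) v"])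
    fix x assume "x \<in> S"
    show "((\<lambda>x. flat_exp m (g x)) has_derivative (\<lambda>v. (flat_exp (m+2) (g x) + - real m * flat_exp (m+1) (g x)) * frechet_derivative g (at x) v)) (at x)"
      using has_derivative_compose[OF d[OF \<open>x \<in> S\<close>] flat_exp_deriv[of m "g x", unfolded has_field_derivative_def]]
      by simp
  next
    fix v
    have "Ck_on k S (\<lambda>x. frechet_derivative g (at x) v)"
      using assms(2)[of "Suc k"] by simp
    then show "Ck_on k S (\<lambda>x. (flat_exp (m+2) (g x) + (- real m) * flat_exp (m+1) (g x)) * frechet_derivative g (at x) v)"
      by (intro Ck_on_mult Ck_on_add Ck_on_cmult Suc.IH assms(1))
  qed
qed

text \<open>For \<open>d > 0\<close> this is smooth, and positive exactly on the ball of radius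
  \<open>d\<close>; the squared norm is a polynomial, so no singularity arises at the centre.\<close>

definition bump :: "real \<Rightarrow> 'e::real_inner \<Rightarrow> real"
  where "bump d z = flat_exp 0 (d\<^sup>2 - z \<bullet> z)"

lemma Ck_on_quadratic:
  fixes x :: "'e::euclidean_space"
  shows "Ck_on k UNIV (\<lambda>y. d\<^sup>2 - (x - y) \<bullet> (x - y))"
proof (cases k)
  case 0
  then show ?thesis by (auto intro!: continuous_intros)
next
  case (Suc k)
  have e: "(\<lambda>y. 2 * ((x - y) \<bullet> v)) = (\<lambda>y. 2 * (x \<bullet> v) + y \<bullet> (- 2 *\<^sub>R v))" for v
    by (auto simp: inner_diff_left algebra_simps)
  have d: "((\<lambda>y. d\<^sup>2 - (x - y) \<bullet> (x - y)) has_derivative (\<lambda>v. 0 - ((x - y) \<bullet> (0 - v) + (0 - v) \<bullet> (x - y)))) (at y)" for y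
    by (intro derivative_intros)
  have e2: "0 - ((x - y) \<bullet> (0 - v) + (0 - v) \<bullet> (x - y)) = 2 * ((x - y) \<bullet> v)" for y v
    by (simp add: inner_commute[of v])
  show ?thesis unfolding Suc
    by (rule Ck_on_SucI[OF open_UNIV d]) (simp only: e2 e Ck_on_affine[OF open_UNIV])
qed

lemma bump_smooth: "smooth_on UNIV (\<lambda>y. bump d (x - y :: 'e::euclidean_space))"
  unfolding smooth_on_def bump_def by (intro allI Ck_on_flat_exp_compose Ck_on_quadratic open_UNIV)

lemma bump_nonneg: "0 \<le> bump d z"
  by (simp add: bump_def flat_exp_def)

lemma bump_pos_iff:
  assumes "d > 0" shows "0 < bump d z \<longleftrightarrow> norm z < d"
proof -
  have "norm z < d \<longleftrightarrow> (norm z)\<^sup>2 < d\<^sup>2"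
    using assms by (meson norm_ge_zero power2_less_imp_less power_strict_mono less_imp_le pos2)
  then show ?thesis
    by (simp add: bump_def flat_exp_def power2_norm_eq_inner)
qed

section \<open>Inequalities for powers\<close>

text \<open>Young's inequality with a free weight \<open>s\<close>. It gives Jensen's inequality
  (\<open>powr_average_le\<close>), replaces Hoelder's inequality (\<open>holder_null\<close>),
  and with \<open>s = (p - 1) / p\<close> it produces the constant of the Hardy inequality.\<close>

lemma Young_powr:
  fixes a b s p :: real
  assumes "p \<ge> 1" "a \<ge> 0" "b \<ge> 0" "s > 0"
  shows "p * (a powr (p - 1) * b) \<le> (p - 1) * s * a powr p + s powr (1 - p) * b powr p"
proof (cases "a = 0 \<or> b = 0")
  case True
  then show ?thesis using assms by auto
next
  case False
  then have pos: "a > 0" "b > 0" using assms by auto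
  define A where "A = s * a powr p"
  define B where "B = s powr (1 - p) * b powr p"
  have "A powr ((p-1)/p) = s powr ((p-1)/p) * a powr (p-1)"
    using pos assms by (simp add: A_def powr_mult powr_powr)
  moreover have "B powr (1/p) = s powr ((1-p)/p) * b"
    using pos assms by (simp add: B_def powr_mult powr_powr)
  ultimately have "A powr ((p-1)/p) * B powr (1/p) =
      (s powr ((p-1)/p) * s powr ((1-p)/p)) * (a powr (p-1) * b)"
    by simp
  also have "s powr ((p-1)/p) * s powr ((1-p)/p) = 1"
    using assms by (simp add: powr_add[symmetric] diff_divide_distrib)
  finally have e: "A powr ((p-1)/p) * B powr (1/p) = a powr (p-1) * b" by simp
  have "A powr ((p-1)/p) * B powr (1/p) \<le> ((p-1)/p) * A + (1/p) * B"
    by (rule Youngs_inequality_0) (use pos assms in \<open>auto simp: A_def B_def field_simps\<close>)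
  then have "p * (a powr (p-1) * b) \<le> p * (((p-1)/p) * A + (1/p) * B)"
    unfolding e using assms by (intro mult_left_mono) auto
  also have "\<dots> = (p-1) * A + B"
    using assms by (simp add: field_simps)
  finally show ?thesis by (simp add: A_def B_def)
qed

text \<open>Superadditivity of $t \mapsto t^p$. It bounds the $p$-th power of the $L^p$ distance of two
  nonnegative functions by the $L^1$ distance of their $p$-th powers, so that $L^1$ statements
  suffice.\<close>

lemma powr_diff_le:
  fixes a b p :: real
  assumes "p \<ge> 1" "a \<ge> 0" "b \<ge> 0"
  shows "\<bar>a - b\<bar> powr p \<le> \<bar>a powr p - b powr p\<bar>"
proof -
  have *: "(x - y) powr p \<le> x powr p - y powr p" if "x \<ge> y" "y \<ge> 0" for x y :: real
  proof -
    have e: "t powr p = t * t powr (p - 1)" if "t \<ge> 0" for t :: real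
      using that by (cases "t = 0") (auto simp: powr_diff)
    have "(x - y) powr p + y powr p \<le> (x - y) * x powr (p-1) + y * x powr (p-1)"
      unfolding e[OF \<open>y \<ge> 0\<close>] using that assms(1)
      by (subst e) (auto intro!: add_mono mult_left_mono powr_mono2)
    also have "\<dots> = x powr p"
      using that by (subst e) (auto simp: algebra_simps)
    finally show ?thesis by simp
  qed
  show ?thesis
    using *[of b a] *[of a b] assms by (cases "a \<ge> b") auto
qed

lemma powr_add_le:
  fixes a b p :: real
  assumes "p \<ge> 0" "a \<ge> 0" "b \<ge> 0"
  shows "(a + b) powr p \<le> 2 powr p * (a powr p + b powr p)"
proof -
  have "(a + b) powr p \<le> (2 * max a b) powr p"
    using assms by (intro powr_mono2) auto
  also have "\<dots> = 2 powr p * (max a b) powr p"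
    using assms by (simp add: powr_mult)
  also have "\<dots> \<le> 2 powr p * (a powr p + b powr p)"
    by (intro mult_left_mono) (auto simp: max_def)
  finally show ?thesis .
qed

text \<open>Jensen's inequality. With $m$ the average of $g$, integrate $p\,m^{p-1} g \le (p-1) m^p + g^p$
  against the weight \<open>\<eta>\<close>.\<close>

lemma powr_average_le:
  assumes "p \<ge> 1" and \<eta>: "\<And>x. 0 \<le> \<eta> x" "integrable M \<eta>" "(\<integral>x. \<eta> x \<partial>M) = 1"
    and g: "\<And>x. 0 \<le> g x" "g \<in> borel_measurable M" "integrable M (\<lambda>x. \<eta> x * g x)"
  shows "ennreal ((\<integral>x. \<eta> x * g x \<partial>M) powr p) \<le> (\<integral>\<^sup>+x. ennreal (\<eta> x * g x powr p) \<partial>M)"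
proof (cases "(\<integral>\<^sup>+x. ennreal (\<eta> x * g x powr p) \<partial>M) = \<infinity>")
  case False
  have [measurable]: "\<eta> \<in> borel_measurable M" "g \<in> borel_measurable M"
    using \<eta>(2) g(2) by auto
  have int: "integrable M (\<lambda>x. \<eta> x * g x powr p)"
    by (rule integrableI_bounded)
      (use False \<eta>(1) in \<open>auto simp: abs_mult less_top\<close>)
  define m where "m = (\<integral>x. \<eta> x * g x \<partial>M)"
  have m0: "m \<ge> 0" unfolding m_def using \<eta>(1) g(1) by (intro Bochner_Integration.integral_nonneg) auto
  have "p * (m powr (p-1) * m) = (\<integral>x. p * m powr (p-1) * (\<eta> x * g x) \<partial>M)"
    by (simp add: m_def)
  also have "\<dots> \<le> (\<integral>x. (p-1) * m powr p * \<eta> x + \<eta> x * g x powr p \<partial>M)"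
  proof (rule integral_mono)
    fix x
    have "p * (m powr (p-1) * g x) \<le> (p-1) * m powr p + g x powr p"
      using Young_powr[OF assms(1) m0 g(1), of 1 x] by simp
    from mult_left_mono[OF this \<eta>(1)[of x]]
    show "p * m powr (p-1) * (\<eta> x * g x) \<le> (p-1) * m powr p * \<eta> x + \<eta> x * g x powr p"
      by (simp add: algebra_simps)
  qed (use g(3) int \<eta>(2) in auto)
  also have "\<dots> = (p-1) * m powr p + (\<integral>x. \<eta> x * g x powr p \<partial>M)"
    using int \<eta> by simp
  finally have "m powr p \<le> (\<integral>x. \<eta> x * g x powr p \<partial>M)"
    using m0 by (cases "m = 0") (auto simp: powr_diff algebra_simps intro!: integral_nonneg \<eta>(1))
  then have "ennreal (m powr p) \<le> ennreal (\<integral>x. \<eta> x * g x powr p \<partial>M)"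
    by (rule ennreal_leI)
  also have "\<dots> = (\<integral>\<^sup>+x. ennreal (\<eta> x * g x powr p) \<partial>M)"
    by (rule nn_integral_eq_integral[symmetric]) (use int \<eta>(1) in auto)
  finally show ?thesis by (simp add: m_def)
qed auto

section \<open>Continuity of translations in the mean\<close>

lemma lborel_translate:
  fixes z :: "'e::euclidean_space"
  shows "distr lborel borel (\<lambda>x. x - z) = lborel"
proof -
  have "(\<lambda>x. x - z) = (+) (- z)" by auto
  then show ?thesis using lborel_distr_plus[of "-z"] by simp
qed

lemma integrable_translate:
  fixes f :: "'e::euclidean_space \<Rightarrow> real"
  assumes "integrable lborel f"
  shows "integrable lborel (\<lambda>x. f (x - z))" "(\<integral>x. f (x - z) \<partial>lborel) = (\<integral>x. f x \<partial>lborel)"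
proof -
  have [measurable]: "f \<in> borel_measurable borel" using assms by auto
  have "integrable (distr lborel borel (\<lambda>x. x - z)) f"
    using assms by (simp add: lborel_translate)
  then show "integrable lborel (\<lambda>x. f (x - z))"
    by (subst (asm) integrable_distr_eq) auto
  show "(\<integral>x. f (x - z) \<partial>lborel) = (\<integral>x. f x \<partial>lborel)"
    by (subst (2) lborel_translate[of z, symmetric]) (simp add: integral_distr)
qed

lemma lborel_reflect:
  fixes x :: "'e::euclidean_space"
  shows "distr lborel borel (\<lambda>y. x - y) = lborel"
  using lborel_affine[of "-1" x] by (simp add: density_1)

lemma integrable_reflect:
  fixes f :: "'e::euclidean_space \<Rightarrow> real"
  assumes "integrable lborel f"
  shows "integrable lborel (\<lambda>y. f (x - y))" "(\<integral>y. f (x - y) \<partial>lborel) = (\<integral>y. f y \<partial>lborel)"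
proof -
  have [measurable]: "f \<in> borel_measurable borel" using assms by auto
  have "integrable (distr lborel borel (\<lambda>y. x - y)) f"
    using assms by (simp add: lborel_reflect)
  then show "integrable lborel (\<lambda>y. f (x - y))"
    by (subst (asm) integrable_distr_eq) auto
  show "(\<integral>y. f (x - y) \<partial>lborel) = (\<integral>y. f y \<partial>lborel)"
    by (subst (2) lborel_reflect[of x, symmetric]) (simp add: integral_distr)
qed

text \<open>The $L^1$ modulus of continuity of \<open>f\<close>.\<close>

definition shift_error :: "('e::euclidean_space \<Rightarrow> real) \<Rightarrow> 'e \<Rightarrow> real"
  where "shift_error f z = (\<integral>x. \<bar>f (x - z) - f x\<bar> \<partial>lborel)"

lemma shift_error_nonneg: "0 \<le> shift_error f z"
  by (simp add: shift_error_def)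

lemma shift_error_perturb:
  fixes f g :: "'e::euclidean_space \<Rightarrow> real"
  assumes f: "integrable lborel f" and g: "integrable lborel g"
  shows "shift_error f z \<le> shift_error g z + 2 * (\<integral>x. \<bar>f x - g x\<bar> \<partial>lborel)"
proof -
  have fg: "integrable lborel (\<lambda>x. \<bar>f x - g x\<bar>)" using f g by auto
  note fz = integrable_translate[OF f, of z] and gz = integrable_translate[OF g, of z]
    and fgz = integrable_translate[OF fg, of z]
  have "shift_error f z \<le> (\<integral>x. \<bar>g (x - z) - g x\<bar> + \<bar>f (x - z) - g (x - z)\<bar> + \<bar>f x - g x\<bar> \<partial>lborel)"
    unfolding shift_error_def
    by (rule integral_mono) (use f g fz gz fg fgz in auto)
  also have "\<dots> = shift_error g z + 2 * (\<integral>x. \<bar>f x - g x\<bar> \<partial>lborel)"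
    unfolding shift_error_def using f g fz gz fg fgz by simp
  finally show ?thesis .
qed

text \<open>By \<open>shift_error_perturb\<close>, an $L^1$ error in \<open>f\<close> costs at most twice
  that error, uniformly in the translation.\<close>

lemma shift_error_limit:
  fixes f :: "'e::euclidean_space \<Rightarrow> real"
  assumes f: "integrable lborel f"
    and approx: "\<And>e. e > 0 \<Longrightarrow> \<exists>g. integrable lborel g \<and> (\<integral>x. \<bar>f x - g x\<bar> \<partial>lborel) \<le> e \<and>
      (shift_error g \<longlongrightarrow> 0) (at 0)"
  shows "(shift_error f \<longlongrightarrow> 0) (at 0)"
proof (rule tendstoI)
  fix e :: real assume "e > 0"
  then obtain g where g: "integrable lborel g" "(\<integral>x. \<bar>f x - g x\<bar> \<partial>lborel) \<le> e / 4"
    "(shift_error g \<longlongrightarrow> 0) (at 0)"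
    using approx[of "e/4"] by auto
  have "\<forall>\<^sub>F z in at 0. dist (shift_error g z) 0 < e / 2"
    using tendstoD[OF g(3), of "e/2"] \<open>e > 0\<close> by simp
  then show "\<forall>\<^sub>F z in at 0. dist (shift_error f z) 0 < e"
  proof eventually_elim
    case (elim z)
    then show ?case
      using shift_error_perturb[OF f g(1), of z] g(2) shift_error_nonneg[of f z] by (simp add: dist_real_def)
  qed
qed

text \<open>A set and its translate have equal measure, so their symmetric difference has twice the
  measure of the part of \<open>U\<close> that leaves \<open>U\<close>. As \<open>U\<close> is
  open, every single point of it stays inside for small translations, and dominated convergence
  applies.\<close>

lemma shift_error_indicator_open:
  fixes U :: "'e::euclidean_space set"
  assumes U: "open U" "emeasure lborel U < \<infinity>"
  shows "(shift_error (indicator U) \<longlongrightarrow> 0) (at 0)"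
proof -
  let ?i = "indicator U :: 'e \<Rightarrow> real"
  have [measurable]: "U \<in> sets borel" using U by auto
  have iU: "integrable lborel ?i" using U by auto
  let ?h = "\<lambda>z x. ?i x * (1 - ?i (x - z))"
  have h: "integrable lborel (?h z)" for z
    by (rule Bochner_Integration.integrable_bound[OF iU]) (auto simp: indicator_def)
  have eq: "shift_error ?i z = 2 * (\<integral>x. ?h z x \<partial>lborel)" for z
  proof -
    note iz = integrable_translate[OF iU, of z]
    have "shift_error ?i z = (\<integral>x. 2 * ?h z x + ?i (x - z) - ?i x \<partial>lborel)"
      unfolding shift_error_def by (rule Bochner_Integration.integral_cong) (auto simp: indicator_def)
    also have "\<dots> = 2 * (\<integral>x. ?h z x \<partial>lborel)"
      using h[of z] iz iU by simp
    finally show ?thesis .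
  qed
  have "((\<lambda>z. \<integral>x. ?h z x \<partial>lborel) \<longlongrightarrow> 0) (at 0)"
    unfolding tendsto_at_iff_sequentially comp_def
  proof (intro allI impI)
    fix Z :: "nat \<Rightarrow> 'e" assume Z: "Z \<longlonglongrightarrow> 0"
    have "(\<lambda>n. \<integral>x. ?h (Z n) x \<partial>lborel) \<longlonglongrightarrow> (\<integral>x. 0 \<partial>(lborel :: 'e measure))"
    proof (rule integral_dominated_convergence[where w="?i"])
      show "AE x in lborel. (\<lambda>n. ?h (Z n) x) \<longlonglongrightarrow> 0"
      proof (rule AE_I2)
        fix x
        show "(\<lambda>n. ?h (Z n) x) \<longlonglongrightarrow> 0"
        proof (cases "x \<in> U")
          case True
          have "(\<lambda>n. x - Z n) \<longlonglongrightarrow> x - 0" by (intro tendsto_intros Z)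
          then have "\<forall>\<^sub>F n in sequentially. x - Z n \<in> U"
            using topological_tendstoD[of "\<lambda>n. x - Z n" "x - 0" sequentially U] U True by simp
          then show ?thesis
            by (intro tendsto_eventually) (auto elim!: eventually_mono simp: indicator_def)
        qed auto
      qed
    qed (use iU in \<open>auto simp: indicator_def\<close>)
    then show "(\<lambda>n. \<integral>x. ?h (Z n) x \<partial>lborel) \<longlonglongrightarrow> 0" by simp
  qed
  then have "((\<lambda>z. 2 * (\<integral>x. ?h z x \<partial>lborel)) \<longlongrightarrow> 0) (at 0)"
    by (auto intro!: tendsto_eq_intros)
  then show ?thesis by (simp add: eq[abs_def])
qed

text \<open>Outer regularity reduces indicators of sets of finite measure to open sets; sums and $L^1$
  limits do the rest.\<close>

theorem shift_error_tendsto_0: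
  fixes f :: "'e::euclidean_space \<Rightarrow> real"
  assumes "integrable lborel f"
  shows "(shift_error f \<longlongrightarrow> 0) (at 0)"
  using assms
proof (induction rule: integrable_induct)
  case (base A c)
  have A[measurable]: "A \<in> sets borel" and fin: "emeasure lborel A < \<infinity>" using base by auto
  have iA: "integrable lborel (indicator A :: 'e \<Rightarrow> real)" using base by auto
  have lim: "(shift_error (indicator A) \<longlongrightarrow> 0) (at 0)"
  proof (rule shift_error_limit[OF iA])
    fix e :: real assume "e > 0"
    obtain U where U: "open U" "A \<subseteq> U" "emeasure lborel (U - A) < ennreal e"
      using outer_regular_lborel[OF A \<open>e > 0\<close>] .
    have [measurable]: "U \<in> sets borel" using U by auto
    have "emeasure lborel U = emeasure lborel A + emeasure lborel (U - A)"
      using U by (subst plus_emeasure) (auto intro!: arg_cong[where f="emeasure lborel"])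
    also have "\<dots> < \<infinity>" using fin U(3) less_trans[OF U(3) ennreal_less_top] by simp
    finally have finU: "emeasure lborel U < \<infinity>" .
    have "(\<integral>x. \<bar>indicator A x - indicator U x :: real\<bar> \<partial>lborel) = (\<integral>x. indicator (U - A) x \<partial>lborel)"
      by (rule Bochner_Integration.integral_cong) (use U in \<open>auto simp: indicator_def\<close>)
    also have "\<dots> = measure lborel (U - A)" by simp
    also have "\<dots> \<le> e" using U(3) \<open>e > 0\<close>
      by (simp add: measure_def) (metis enn2real_leI less_imp_le)
    finally show "\<exists>g. integrable lborel g \<and> (\<integral>x. \<bar>indicator A x - g x\<bar> \<partial>lborel) \<le> e \<and> (shift_error g \<longlongrightarrow> 0) (at 0)"
      using finU U shift_error_indicator_open[OF U(1) finU]
      by (intro exI[of _ "indicator U"]) auto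
  qed
  have "shift_error (\<lambda>x. indicator A x *\<^sub>R c) = (\<lambda>z. \<bar>c\<bar> * shift_error (indicator A) z)"
  proof
    fix z
    have "(\<bar>indicator A (x - z) *\<^sub>R c - indicator A x *\<^sub>R c\<bar>) = \<bar>c\<bar> * \<bar>indicator A (x - z) - indicator A x\<bar>" for x
      by (auto simp: indicator_def)
    then show "shift_error (\<lambda>x. indicator A x *\<^sub>R c) z = \<bar>c\<bar> * shift_error (indicator A) z"
      by (simp add: shift_error_def)
  qed
  then show ?case using tendsto_mult_right_zero[OF lim, of "\<bar>c\<bar>"] by simp
next
  case (add f g)
  show ?case
  proof (rule Lim_null_comparison)
    show "\<forall>\<^sub>F z in at 0. norm (shift_error (\<lambda>x. f x + g x) z) \<le> shift_error f z + shift_error g z"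
    proof (rule always_eventually, rule allI)
      fix z
      note fz = integrable_translate[OF add.hyps(1), of z] and gz = integrable_translate[OF add.hyps(2), of z]
      have "shift_error (\<lambda>x. f x + g x) z \<le> (\<integral>x. \<bar>f (x - z) - f x\<bar> + \<bar>g (x - z) - g x\<bar> \<partial>lborel)"
        unfolding shift_error_def by (rule integral_mono) (use fz gz add.hyps in auto)
      also have "\<dots> = shift_error f z + shift_error g z"
        unfolding shift_error_def using fz gz add.hyps by simp
      finally show "norm (shift_error (\<lambda>x. f x + g x) z) \<le> shift_error f z + shift_error g z"
        using shift_error_nonneg[of "\<lambda>x. f x + g x" z] by simp
    qed
    show "((\<lambda>z. shift_error f z + shift_error g z) \<longlongrightarrow> 0) (at 0)"
      using tendsto_add[OF add.IH] by simp
  qed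
next
  case (lim f s)
  have lim0: "(\<lambda>i. \<integral>x. \<bar>f x - s i x\<bar> \<partial>lborel) \<longlonglongrightarrow> (\<integral>x. 0 \<partial>(lborel :: 'e measure))"
  proof (rule integral_dominated_convergence[where w="\<lambda>x. 3 * \<bar>f x\<bar>"])
    show "AE x in lborel. (\<lambda>i. \<bar>f x - s i x\<bar>) \<longlonglongrightarrow> 0"
    proof (rule AE_I2)
      fix x
      have "(\<lambda>i. \<bar>f x - s i x\<bar>) \<longlonglongrightarrow> \<bar>f x - f x\<bar>"
        using lim(2)[of x] by (intro tendsto_intros) auto
      then show "(\<lambda>i. \<bar>f x - s i x\<bar>) \<longlonglongrightarrow> 0" by simp
    qed
    fix i
    show "AE x in lborel. norm \<bar>f x - s i x\<bar> \<le> 3 * \<bar>f x\<bar>"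
    proof (rule AE_I2)
      fix x
      show "norm \<bar>f x - s i x\<bar> \<le> 3 * \<bar>f x\<bar>"
        using lim(3)[of x i] by simp
    qed
    show "(\<lambda>x. \<bar>f x - s i x\<bar>) \<in> borel_measurable lborel"
      using lim(1)[of i] lim(4) by auto
  qed (use lim in auto)
  show ?case
  proof (rule shift_error_limit[OF lim(4)])
    fix e :: real assume "e > 0"
    have ev: "\<forall>\<^sub>F i in sequentially. (\<integral>x. \<bar>f x - s i x\<bar> \<partial>lborel) < e"
      using order_tendstoD(2)[OF lim0, of e] \<open>e > 0\<close> by simp
    then obtain i where "(\<integral>x. \<bar>f x - s i x\<bar> \<partial>lborel) < e"
      using eventually_happens[OF ev] by auto
    then show "\<exists>g. integrable lborel g \<and> (\<integral>x. \<bar>f x - g x\<bar> \<partial>lborel) \<le> e \<and> (shift_error g \<longlongrightarrow> 0) (at 0)"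
      using lim by (intro exI[of _ "s i"]) auto
  qed
qed

section \<open>Mollification\<close>

lemma uniformly_continuous_compact_support:
  fixes h :: "'e::euclidean_space \<Rightarrow> real"
  assumes cont: "continuous_on UNIV h" and zero: "\<forall>z. norm z > d \<longrightarrow> h z = 0"
  shows "uniformly_continuous_on UNIV h" and "\<exists>B. \<forall>z. \<bar>h z\<bar> \<le> B"
proof -
  have "compact (h ` cball 0 d)"
    by (rule compact_continuous_image) (use cont continuous_on_subset in auto)
  then obtain B where B: "\<forall>y\<in>h ` cball 0 d. norm y \<le> B"
    using compact_imp_bounded bounded_iff by metis
  have "\<bar>h z\<bar> \<le> max B 0" for z
  proof (cases "z \<in> cball 0 d")
    case True
    then have "norm (h z) \<le> B" using B by blast
    then show ?thesis by simp
  next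
    case False
    then show ?thesis using zero by simp
  qed
  then show "\<exists>B. \<forall>z. \<bar>h z\<bar> \<le> B" by blast
  have uc: "uniformly_continuous_on (cball 0 (d + 1)) h"
    by (rule compact_uniformly_continuous) (use cont continuous_on_subset in auto)
  show "uniformly_continuous_on UNIV h"
    unfolding uniformly_continuous_on_def
  proof (intro allI impI)
    fix e :: real assume "e > 0"
    obtain k where k: "k > 0"
      "\<And>x x'. x \<in> cball 0 (d + 1) \<Longrightarrow> x' \<in> cball 0 (d + 1) \<Longrightarrow> dist x' x < k \<Longrightarrow> dist (h x') (h x) < e"
      using uniformly_continuous_onE[OF uc \<open>e > 0\<close>] by metis
    show "\<exists>k>0. \<forall>x\<in>UNIV. \<forall>x'\<in>UNIV. dist x' x < k \<longrightarrow> dist (h x') (h x) < e"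
    proof (intro exI[of _ "min k 1"] conjI ballI impI)
      fix x x' :: 'e assume *: "dist x' x < min k 1"
      have n: "norm x \<le> norm x' + dist x' x" "norm x' \<le> norm x + dist x' x"
        by (metis dist_norm norm_minus_commute norm_triangle_sub add.commute)+
      show "dist (h x') (h x) < e"
      proof (cases "norm x \<le> d \<or> norm x' \<le> d")
        case True
        then show ?thesis using n * by (intro k(2)) auto
      next
        case False
        then show ?thesis using zero \<open>e > 0\<close> by auto
      qed
    qed (use k in auto)
  qed
qed

definition conv :: "('e::euclidean_space \<Rightarrow> real) \<Rightarrow> ('e \<Rightarrow> real) \<Rightarrow> 'e \<Rightarrow> real"
  where "conv g f x = (\<integral>y. g (x - y) * f y \<partial>lborel)"

lemma integrable_bounded_mult:
  fixes f h :: "'e::euclidean_space \<Rightarrow> real"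
  assumes "integrable lborel f" "h \<in> borel_measurable borel" "\<And>z. \<bar>h z\<bar> \<le> B"
  shows "integrable lborel (\<lambda>y. h y * f y)"
proof (rule Bochner_Integration.integrable_bound[of _ "\<lambda>y. B * f y"])
  have "0 \<le> B" using assms(3)[of 0] by linarith
  then show "AE x in lborel. norm (h x * f x) \<le> norm (B * f x)"
    using assms(3) by (auto simp: abs_mult intro!: mult_right_mono)
qed (use assms in auto)

lemma integrable_conv:
  fixes f h :: "'e::euclidean_space \<Rightarrow> real"
  assumes f: "integrable lborel f" and h: "h \<in> borel_measurable borel" "\<And>z. \<bar>h z\<bar> \<le> B"
  shows "integrable lborel (\<lambda>y. h (x - y) * f y)"
proof (rule integrable_bounded_mult[OF f])
  show "(\<lambda>y. h (x - y)) \<in> borel_measurable borel"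
    using h(1) by measurable
qed (use h in auto)

lemma conv_close:
  fixes f :: "'e::euclidean_space \<Rightarrow> real"
  assumes f: "integrable lborel f" and h: "integrable lborel (\<lambda>y. h y * f y)" and e: "\<And>y. \<bar>h y\<bar> \<le> e"
  shows "\<bar>\<integral>y. h y * f y \<partial>lborel\<bar> \<le> e * (\<integral>y. \<bar>f y\<bar> \<partial>lborel)"
proof -
  have "\<bar>\<integral>y. h y * f y \<partial>lborel\<bar> \<le> (\<integral>y. \<bar>h y * f y\<bar> \<partial>lborel)" by simp
  also have "\<dots> \<le> (\<integral>y. e * \<bar>f y\<bar> \<partial>lborel)"
  proof (rule integral_mono)
    show "integrable lborel (\<lambda>y. \<bar>h y * f y\<bar>)" using h by (rule integrable_abs)
    show "\<bar>h y * f y\<bar> \<le> e * \<bar>f y\<bar>" for y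
      unfolding abs_mult using e by (intro mult_right_mono) auto
  qed (use f in simp)
  finally show ?thesis using f by simp
qed

lemma conv_continuous:
  fixes f h :: "'e::euclidean_space \<Rightarrow> real"
  assumes f: "integrable lborel f" and cont: "continuous_on UNIV h" and zero: "\<forall>z. norm z > d \<longrightarrow> h z = 0"
  shows "continuous_on UNIV (conv h f)"
  unfolding continuous_on_iff
proof (intro ballI allI impI)
  fix x :: 'e and e :: real assume "e > 0"
  note uc = uniformly_continuous_compact_support[OF cont zero]
  obtain B where B: "\<And>z. \<bar>h z\<bar> \<le> B" using uc(2) by auto
  have m: "h \<in> borel_measurable borel" using cont by (rule borel_measurable_continuous_onI)
  define N where "N = (\<integral>y. \<bar>f y\<bar> \<partial>lborel)"
  have N: "N \<ge> 0" by (simp add: N_def)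
  have "e / (N + 1) > 0" using \<open>e > 0\<close> N by simp
  then obtain k where k: "k > 0" "\<And>z z'. dist z' z < k \<Longrightarrow> dist (h z') (h z) < e / (N + 1)"
    using uniformly_continuous_onE[OF uc(1), of "e / (N + 1)"] by (metis UNIV_I)
  show "\<exists>k>0. \<forall>x'\<in>UNIV. dist x' x < k \<longrightarrow> dist (conv h f x') (conv h f x) < e"
  proof (intro exI[of _ k] conjI ballI impI)
    fix x' assume x': "dist x' x < k"
    note i = integrable_conv[OF f m B]
    have "conv h f x' - conv h f x = (\<integral>y. (h (x' - y) - h (x - y)) * f y \<partial>lborel)"
      unfolding conv_def using i by (simp add: left_diff_distrib)
    also have "\<bar>\<dots>\<bar> \<le> e / (N + 1) * N"
      unfolding N_def
    proof (rule conv_close[OF f])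
      show "integrable lborel (\<lambda>y. (h (x' - y) - h (x - y)) * f y)"
        using i by (simp add: left_diff_distrib)
      fix y
      have "dist (x' - y) (x - y) < k" using x' by (simp add: dist_norm)
      then show "\<bar>h (x' - y) - h (x - y)\<bar> \<le> e / ((\<integral>y. \<bar>f y\<bar> \<partial>lborel) + 1)"
        using k(2)[of "x' - y" "x - y"] by (simp add: N_def dist_real_def)
    qed
    also have "\<dots> < e" using \<open>e > 0\<close> N by (simp add: field_simps)
    finally show "dist (conv h f x') (conv h f x) < e" by (simp add: dist_real_def)
  qed (use k in auto)
qed

text \<open>Differentiation under the integral sign. The derivative of the kernel is uniformly continuous,
  so the linearization error of \<open>g (x - y)\<close> is $o(|h|)$ uniformly in
  \<open>y\<close> and is integrated against \<open>f\<close>.\<close>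

lemma conv_C1:
  fixes f g :: "'e::euclidean_space \<Rightarrow> real"
  assumes f: "integrable lborel f" and g: "Ck_on 1 UNIV g" and zero: "\<forall>z. norm z \<ge> d \<longrightarrow> g z = 0"
  shows "(conv g f has_derivative (\<lambda>v. conv (\<lambda>z. frechet_derivative g (at z) v) f x)) (at x)"
    and "Ck_on 1 UNIV (conv g f)"
proof -
  define G where "G z = frechet_derivative g (at z)" for z
  have dg: "(g has_derivative G z) (at z)" for z
    using C1_D(1)[OF g, of z] by (simp add: G_def)
  have linG: "linear (G z)" for z using dg by (rule has_derivative_linear)
  have G0: "G z v = 0" if "norm z > d" for z v
  proof -
    have "((\<lambda>_. 0) has_derivative (\<lambda>_. 0)) (at z)" by simp
    then have "(g has_derivative (\<lambda>_. 0)) (at z)"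
      by (rule has_derivative_transform_within_open[of _ _ z UNIV "- cball 0 d"])
        (use that zero in \<open>auto simp: open_Compl\<close>)
    then show ?thesis using has_derivative_unique[OF dg] by metis
  qed
  have contG: "continuous_on UNIV (\<lambda>z. G z v)" for v
    using C1_D(2)[OF g] by (simp add: G_def)
  have G0': "\<forall>z. norm z > d \<longrightarrow> G z v = 0" for v using G0 by blast
  note ucG = uniformly_continuous_compact_support[OF contG G0']
  have contg: "continuous_on UNIV g" using Ck_on_continuous[OF open_UNIV g] .
  obtain Bg where Bg: "\<And>z. \<bar>g z\<bar> \<le> Bg"
    using uniformly_continuous_compact_support(2)[OF contg, of d] zero by (metis less_imp_le)
  have mg: "g \<in> borel_measurable borel" using contg by (rule borel_measurable_continuous_onI)
  have mG: "(\<lambda>z. G z v) \<in> borel_measurable borel" for v using contG by (rule borel_measurable_continuous_onI)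
  have ig: "integrable lborel (\<lambda>y. g (x - y) * f y)" for x
    by (rule integrable_conv[OF f mg Bg])
  have iG: "integrable lborel (\<lambda>y. G (x - y) v * f y)" for x v
    using ucG(2)[of v] integrable_conv[OF f mG] by metis
  have unif: "\<exists>k>0. \<forall>z z' v. dist z' z < k \<longrightarrow> \<bar>G z' v - G z v\<bar> \<le> e * norm v" if "e > 0" for e
  proof -
    define e' where "e' = e / real DIM('e)"
    have e': "e' > 0" using that by (simp add: e'_def)
    have "\<forall>b. \<exists>k>0. \<forall>z z'. dist z' z < k \<longrightarrow> dist (G z' b) (G z b) < e'"
      using uniformly_continuous_onE[OF ucG(1) e'] by (metis UNIV_I)
    then obtain K where K: "\<And>b. K b > 0" "\<And>b z z'. dist z' z < K b \<Longrightarrow> dist (G z' b) (G z b) < e'"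
      by metis
    define k where "k = Min (K ` (Basis :: 'e set))"
    have kle: "k \<le> K b" if "b \<in> Basis" for b using that by (simp add: k_def)
    have "k > 0" using K(1) by (simp add: k_def)
    moreover have "\<bar>G z' v - G z v\<bar> \<le> e * norm v" if "dist z' z < k" for z z' v
    proof -
      have rep: "G z v = (\<Sum>b\<in>Basis. (v \<bullet> b) * G z b)" for z
      proof -
        have "G z (\<Sum>b\<in>Basis. (v \<bullet> b) *\<^sub>R b) = (\<Sum>b\<in>Basis. (v \<bullet> b) * G z b)"
          using linG[of z] by (simp add: linear_sum linear_scale)
        then show ?thesis by (simp add: euclidean_representation)
      qed
      have "G z' v - G z v = (\<Sum>b\<in>Basis. (v \<bullet> b) * (G z' b - G z b))"
        unfolding rep[of z'] rep[of z] by (simp add: sum_subtractf right_diff_distrib)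
      also have "\<bar>\<dots>\<bar> \<le> (\<Sum>b\<in>(Basis::'e set). norm v * e')"
      proof (rule order_trans[OF sum_abs], rule sum_mono)
        fix b :: 'e assume b: "b \<in> Basis"
        have "\<bar>G z' b - G z b\<bar> \<le> e'"
          using K(2)[of z' z b] kle[OF b] that by (simp add: dist_real_def)
        then show "\<bar>(v \<bullet> b) * (G z' b - G z b)\<bar> \<le> norm v * e'"
          unfolding abs_mult using b by (intro mult_mono) (auto simp: Basis_le_norm)
      qed
      also have "\<dots> = e * norm v" by (simp add: e'_def)
      finally show ?thesis .
    qed
    ultimately show ?thesis by blast
  qed
  have der: "(conv g f has_derivative (\<lambda>v. conv (\<lambda>z. G z v) f x)) (at x)" for x
    unfolding has_derivative_at_alt
  proof (intro conjI allI impI)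
    have "linear (\<lambda>v. conv (\<lambda>z. G z v) f x)"
    proof (rule linearI)
      fix v w
      have "G z (v + w) = G z v + G z w" for z using linG by (rule linear_add)
      then show "conv (\<lambda>z. G z (v + w)) f x = conv (\<lambda>z. G z v) f x + conv (\<lambda>z. G z w) f x"
        unfolding conv_def using iG by (simp add: distrib_right)
    next
      fix c v
      have "G z (c *\<^sub>R v) = c * G z v" for z using linear_scale[OF linG] by simp
      then show "conv (\<lambda>z. G z (c *\<^sub>R v)) f x = c *\<^sub>R conv (\<lambda>z. G z v) f x"
        unfolding conv_def by (simp add: mult.assoc)
    qed
    then show "bounded_linear (\<lambda>v. conv (\<lambda>z. G z v) f x)"
      by (simp add: linear_conv_bounded_linear)
  next
    fix e :: real assume "e > 0"
    define N where "N = (\<integral>y. \<bar>f y\<bar> \<partial>lborel)"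
    have N: "N \<ge> 0" by (simp add: N_def)
    have pos: "e / (N + 1) > 0" using \<open>e > 0\<close> N by simp
    obtain k where k: "k > 0" "\<And>z z' v. dist z' z < k \<Longrightarrow> \<bar>G z' v - G z v\<bar> \<le> e / (N+1) * norm v"
      using unif[OF pos] by blast
    have lin: "\<bar>g z' - g z - G z (z' - z)\<bar> \<le> norm (z' - z) * (e / (N+1))" if "dist z' z < k" for z z'
    proof -
      have "norm (g z' - g z - G z (z' - z)) \<le> norm (z' - z) * (e / (N+1))"
      proof (rule differentiable_bound_linearization[where S="ball z k"])
        fix t :: real assume t: "t \<in> {0..1}"
        have "dist z (z + t *\<^sub>R (z' - z)) = t * dist z' z"
          using t by (simp add: dist_norm)
        also have "\<dots> \<le> dist z' z" using t by (simp add: mult_left_le_one_le)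
        finally show "z + t *\<^sub>R (z' - z) \<in> ball z k" using that by simp
      next
        fix w assume w: "w \<in> ball z k"
        show "(g has_derivative G w) (at w within ball z k)"
          using dg has_derivative_at_withinI by blast
        show "onorm (G w - G z) \<le> e / (N+1)"
        proof (rule onorm_bound)
          fix v show "norm ((G w - G z) v) \<le> e / (N+1) * norm v"
            using k(2)[of w z v] w by (simp add: dist_commute)
        qed (use pos in auto)
      qed (use k in auto)
      then show ?thesis by simp
    qed
    show "\<exists>k>0. \<forall>y. norm (y - x) < k \<longrightarrow>
        norm (conv g f y - conv g f x - conv (\<lambda>z. G z (y - x)) f x) \<le> e * norm (y - x)"
    proof (intro exI[of _ k] conjI allI impI)
      fix x' assume x': "norm (x' - x) < k"
      have "conv g f x' - conv g f x - conv (\<lambda>z. G z (x' - x)) f x =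
          (\<integral>y. (g (x' - y) - g (x - y) - G (x - y) (x' - x)) * f y \<partial>lborel)"
        unfolding conv_def using ig iG by (simp add: left_diff_distrib)
      also have "\<bar>\<dots>\<bar> \<le> (norm (x' - x) * (e / (N + 1))) * N"
        unfolding N_def
      proof (rule conv_close[OF f])
        show "integrable lborel (\<lambda>y. (g (x' - y) - g (x - y) - G (x - y) (x' - x)) * f y)"
          using ig iG by (simp add: left_diff_distrib)
        fix y
        show "\<bar>g (x' - y) - g (x - y) - G (x - y) (x' - x)\<bar> \<le> norm (x' - x) * (e / ((\<integral>y. \<bar>f y\<bar> \<partial>lborel) + 1))"
          using lin[of "x' - y" "x - y"] x' by (simp add: dist_norm N_def)
      qed
      also have "\<dots> = norm (x' - x) * (e * (N / (N + 1)))" by simp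
      also have "\<dots> \<le> norm (x' - x) * e"
        using \<open>e > 0\<close> N by (intro mult_left_mono) (auto simp: field_simps)
      finally show "norm (conv g f x' - conv g f x - conv (\<lambda>z. G z (x' - x)) f x) \<le> e * norm (x' - x)"
        by (simp add: mult.commute)
    qed (use k in auto)
  qed
  show "(conv g f has_derivative (\<lambda>v. conv (\<lambda>z. frechet_derivative g (at z) v) f x)) (at x)"
    using der by (simp add: G_def)
  show "Ck_on 1 UNIV (conv g f)"
    by (rule C1_I[OF open_UNIV der]) (rule conv_continuous[OF f contG G0'])
qed

definition moll :: "real \<Rightarrow> 'e::euclidean_space \<Rightarrow> real"
  where "moll d z = bump d z / (\<integral>z. bump d z \<partial>(lborel :: 'e measure))"

lemma bump_continuous: "continuous_on UNIV (bump d :: 'e::euclidean_space \<Rightarrow> real)"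
proof -
  have "continuous_on UNIV (\<lambda>y::'e. bump d (0 - y))"
    using bump_smooth[of d 0] Ck_on_continuous[OF open_UNIV] unfolding smooth_on_def by blast
  then show ?thesis by (simp add: bump_def)
qed

lemma bump_integrable:
  assumes "d > 0" shows "integrable lborel (bump d :: 'e::euclidean_space \<Rightarrow> real)"
proof (rule Bochner_Integration.integrable_bound[of _ "indicator (ball 0 d)"])
  show "integrable lborel (indicator (ball (0::'e) d) :: 'e \<Rightarrow> real)"
    using emeasure_bounded_finite[of "ball (0::'e) d"] by simp
  show "AE x in lborel. norm (bump d x) \<le> norm (indicator (ball (0::'e) d) x :: real)"
  proof (rule AE_I2)
    fix x :: 'e
    have "bump d x \<le> 1" by (simp add: bump_def flat_exp_def)
    then show "norm (bump d x) \<le> norm (indicator (ball (0::'e) d) x :: real)"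
      using bump_pos_iff[OF assms, of x] bump_nonneg[of d x] by (auto simp: indicator_def)
  qed
qed (use bump_continuous in \<open>auto intro: borel_measurable_continuous_onI\<close>)

lemma bump_integral_pos:
  assumes "d > 0" shows "0 < (\<integral>z. bump d z \<partial>(lborel :: 'e::euclidean_space measure))"
proof (rule ccontr)
  assume "\<not> ?thesis"
  moreover have "0 \<le> (\<integral>z. bump d z \<partial>(lborel :: 'e measure))"
    by (rule Bochner_Integration.integral_nonneg) (rule bump_nonneg)
  ultimately have "(\<integral>z. bump d z \<partial>(lborel :: 'e measure)) = 0" by linarith
  then have "AE z in (lborel :: 'e measure). bump d z = 0"
    using integral_nonneg_eq_0_iff_AE[OF bump_integrable[OF assms]] bump_nonneg by auto
  then have "AE z in (lborel :: 'e measure). z \<notin> ball 0 d"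
    by eventually_elim (use bump_pos_iff[OF assms] in force)
  then have "emeasure lborel (ball (0::'e) d) = 0"
    using AE_iff_measurable[of "ball (0::'e) d" lborel "\<lambda>z. z \<notin> ball 0 d"] by (auto simp: set_eq_iff)
  then have "negligible (ball (0::'e) d)"
    by (simp add: negligible_iff_null_sets null_sets_def null_setsI)
  then show False
    using open_not_negligible[of "ball (0::'e) d"] assms by auto
qed

lemma moll_kernel:
  fixes z :: "'e::euclidean_space"
  assumes "d > 0"
  shows "0 \<le> moll d z" "norm z \<ge> d \<Longrightarrow> moll d z = 0"
    "integrable lborel (moll d :: 'e \<Rightarrow> real)" "(\<integral>z. moll d z \<partial>(lborel :: 'e measure)) = 1"
    "smooth_on UNIV (\<lambda>y. moll d (x - y :: 'e))"
    "Ck_on 1 UNIV (moll d :: 'e \<Rightarrow> real)"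
proof -
  let ?c = "\<integral>z. bump d z \<partial>(lborel :: 'e measure)"
  have c: "?c > 0" by (rule bump_integral_pos[OF assms])
  show "0 \<le> moll d z" using c bump_nonneg[of d z] by (simp add: moll_def)
  show "norm z \<ge> d \<Longrightarrow> moll d z = 0"
    using bump_pos_iff[OF assms, of z] bump_nonneg[of d z] by (simp add: moll_def)
  show "integrable lborel (moll d :: 'e \<Rightarrow> real)"
    unfolding moll_def[abs_def] using bump_integrable[OF assms] by auto
  show "(\<integral>z. moll d z \<partial>(lborel :: 'e measure)) = 1"
    unfolding moll_def using c by simp
  have e: "moll d z = (1 / ?c) * bump d z" for z :: 'e by (simp only: moll_def times_divide_eq_left mult_1)
  show s: "smooth_on UNIV (\<lambda>y. moll d (x - y :: 'e))" for x
    using bump_smooth[of d x] unfolding smooth_on_def e by (intro allI Ck_on_cmult open_UNIV) simp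
  have "(\<lambda>y. moll d (0 - y :: 'e)) = moll d"
    by (auto simp: moll_def bump_def)
  then show "Ck_on 1 UNIV (moll d :: 'e \<Rightarrow> real)"
    using s[of 0] unfolding smooth_on_def by metis
qed

definition mollify :: "real \<Rightarrow> ('e::euclidean_space \<Rightarrow> real) \<Rightarrow> 'e \<Rightarrow> real"
  where "mollify d f = conv (moll d) f"

lemma moll_bounded:
  assumes "d > 0" obtains B where "\<And>z::'e::euclidean_space. \<bar>moll d z\<bar> \<le> B"
proof -
  have "continuous_on UNIV (moll d :: 'e \<Rightarrow> real)"
    by (rule Ck_on_continuous[OF open_UNIV moll_kernel(6)[OF assms]])
  then show thesis
    using uniformly_continuous_compact_support(2)[of "moll d :: 'e \<Rightarrow> real" d] moll_kernel(2)[OF assms] that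
    by (meson less_imp_le)
qed

lemma moll_measurable [measurable]: "moll d \<in> borel_measurable (borel :: 'e::euclidean_space measure)"
  unfolding moll_def[abs_def] using borel_measurable_continuous_onI[OF bump_continuous, of d] by measurable

lemma mollify_integrable:
  fixes f :: "'e::euclidean_space \<Rightarrow> real"
  assumes "d > 0" "integrable lborel f"
  shows "integrable lborel (\<lambda>y. moll d (x - y) * f y)"
  by (rule moll_bounded[OF assms(1)]) (rule integrable_conv[OF assms(2) moll_measurable])

lemma mollify_alt:
  fixes f :: "'e::euclidean_space \<Rightarrow> real"
  assumes "d > 0" "integrable lborel f"
  shows "integrable lborel (\<lambda>z. moll d z * f (x - z))" "mollify d f x = (\<integral>z. moll d z * f (x - z) \<partial>lborel)"
  using integrable_reflect[OF mollify_integrable[OF assms, of x], of x]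
  by (simp_all add: mollify_def conv_def)

lemma mollify_nonneg:
  assumes "d > 0" "\<And>x. 0 \<le> f x" shows "0 \<le> mollify d f x"
  unfolding mollify_def conv_def
  by (intro Bochner_Integration.integral_nonneg mult_nonneg_nonneg moll_kernel(1)[OF assms(1)] assms(2))

lemma mollify_diff:
  assumes "d > 0" "integrable lborel f" "integrable lborel g"
  shows "mollify d (\<lambda>x. f x - g x) x = mollify d f x - mollify d g x"
  unfolding mollify_def conv_def
  using mollify_integrable[OF assms(1,2)] mollify_integrable[OF assms(1,3)] by (simp add: right_diff_distrib)

lemma mollify_C1:
  assumes "d > 0" "integrable lborel f"
  shows "Ck_on 1 UNIV (mollify d f)"
  unfolding mollify_def
  by (rule conv_C1(2)[OF assms(2) moll_kernel(6)[OF assms(1)], of d]) (use moll_kernel(2)[OF assms(1)] in blast)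

lemma mollify_measurable:
  assumes "d > 0" "integrable lborel f"
  shows "mollify d f \<in> borel_measurable borel"
  using Ck_on_continuous[OF open_UNIV mollify_C1[OF assms]] by (rule borel_measurable_continuous_onI)

text \<open>The mollification is an average of translates over the ball of radius \<open>d\<close>.
  Jensen's inequality and \<open>powr_diff_le\<close> bound the error pointwise by an average of
  $|f^p(x-z) - f^p(x)|$; integrating in \<open>x\<close> first leaves the $L^1$ modulus of
  continuity of $f^p$.\<close>

lemma mollify_error_nonneg:
  fixes f :: "'e::euclidean_space \<Rightarrow> real"
  assumes "p \<ge> 1" "d > 0" and f: "\<And>x. 0 \<le> f x" "integrable lborel f" "integrable lborel (\<lambda>x. f x powr p)"
    and e: "\<And>z. norm z < d \<Longrightarrow> shift_error (\<lambda>x. f x powr p) z \<le> e" "0 \<le> e"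
  shows "(\<integral>\<^sup>+x. ennreal (\<bar>mollify d f x - f x\<bar> powr p) \<partial>lborel) \<le> ennreal e"
proof -
  have [measurable]: "f \<in> borel_measurable borel" using f(2) by auto
  note m = moll_kernel[OF assms(2), where 'e='e]
  let ?F = "\<lambda>x. f x powr p"
  have pw: "ennreal (\<bar>mollify d f x - f x\<bar> powr p) \<le>
      (\<integral>\<^sup>+z. ennreal (moll d z * \<bar>?F (x - z) - ?F x\<bar>) \<partial>lborel)" for x
  proof -
    note i1 = mollify_alt[OF assms(2) f(2), of x]
    have i2: "integrable lborel (\<lambda>z. moll d z * (f (x - z) - f x))"
      using i1(1) m(3) by (simp add: right_diff_distrib)
    have i3: "integrable lborel (\<lambda>z. moll d z * \<bar>f (x - z) - f x\<bar>)"
      using integrable_abs[OF i2] by (simp add: abs_mult m(1))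
    have "mollify d f x - f x = (\<integral>z. moll d z * (f (x - z) - f x) \<partial>lborel)"
      using i1 m(3,4) by (simp add: right_diff_distrib)
    also have "\<bar>\<dots>\<bar> \<le> (\<integral>z. \<bar>moll d z * (f (x - z) - f x)\<bar> \<partial>lborel)" by simp
    also have "\<dots> = (\<integral>z. moll d z * \<bar>f (x - z) - f x\<bar> \<partial>lborel)"
      by (simp add: abs_mult m(1))
    finally have "\<bar>mollify d f x - f x\<bar> powr p \<le> (\<integral>z. moll d z * \<bar>f (x - z) - f x\<bar> \<partial>lborel) powr p"
      using assms(1) by (intro powr_mono2) auto
    then have "ennreal (\<bar>mollify d f x - f x\<bar> powr p) \<le> ennreal ((\<integral>z. moll d z * \<bar>f (x - z) - f x\<bar> \<partial>lborel) powr p)"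
      by (rule ennreal_leI)
    also have "\<dots> \<le> (\<integral>\<^sup>+z. ennreal (moll d z * \<bar>f (x - z) - f x\<bar> powr p) \<partial>lborel)"
      by (rule powr_average_le[OF assms(1) m(1,3,4) _ _ i3]) auto
    also have "\<dots> \<le> (\<integral>\<^sup>+z. ennreal (moll d z * \<bar>?F (x - z) - ?F x\<bar>) \<partial>lborel)"
      by (intro nn_integral_mono ennreal_leI mult_left_mono powr_diff_le assms f m)
    finally show ?thesis .
  qed
  have "(\<integral>\<^sup>+x. ennreal (\<bar>mollify d f x - f x\<bar> powr p) \<partial>lborel) \<le>
      (\<integral>\<^sup>+x. (\<integral>\<^sup>+z. ennreal (moll d z * \<bar>?F (x - z) - ?F x\<bar>) \<partial>lborel) \<partial>lborel)"
    by (rule nn_integral_mono[OF pw])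
  also have "\<dots> = (\<integral>\<^sup>+z. (\<integral>\<^sup>+x. ennreal (moll d z * \<bar>?F (x - z) - ?F x\<bar>) \<partial>lborel) \<partial>lborel)"
    by (rule lborel_pair.Fubini') measurable
  also have "\<dots> \<le> (\<integral>\<^sup>+z. ennreal (moll d z * e) \<partial>(lborel :: 'e measure))"
  proof (rule nn_integral_mono)
    fix z :: 'e
    have i: "integrable lborel (\<lambda>x. \<bar>?F (x - z) - ?F x\<bar>)"
      using integrable_translate(1)[OF f(3), of z] f(3) by auto
    have "(\<integral>\<^sup>+x. ennreal (moll d z * \<bar>?F (x - z) - ?F x\<bar>) \<partial>lborel) = ennreal (moll d z * shift_error ?F z)"
      unfolding shift_error_def
      by (subst nn_integral_eq_integral) (use i m(1) in auto)
    also have "\<dots> \<le> ennreal (moll d z * e)"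
      using e m(1,2)[of z] by (cases "norm z < d") (auto intro!: ennreal_leI mult_left_mono)
    finally show "(\<integral>\<^sup>+x. ennreal (moll d z * \<bar>?F (x - z) - ?F x\<bar>) \<partial>lborel) \<le> ennreal (moll d z * e)" .
  qed
  also have "\<dots> = ennreal (\<integral>z. moll d z * e \<partial>(lborel :: 'e measure))"
    by (rule nn_integral_eq_integral) (use m e in auto)
  also have "\<dots> = ennreal e" using m(4) by simp
  finally show ?thesis .
qed

lemma mollify_Lp_nonneg:
  fixes f :: "'e::euclidean_space \<Rightarrow> real"
  assumes "p \<ge> 1" and f: "\<And>x. 0 \<le> f x" "integrable lborel f" "integrable lborel (\<lambda>x. f x powr p)"
    and d: "\<And>n. d n > 0" "d \<longlonglongrightarrow> 0"
  shows "integrable lborel (\<lambda>x. \<bar>mollify (d n) f x - f x\<bar> powr p)"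
    and "(\<lambda>n. \<integral>x. \<bar>mollify (d n) f x - f x\<bar> powr p \<partial>lborel) \<longlonglongrightarrow> 0"
proof -
  let ?F = "\<lambda>x. f x powr p"
  have [measurable]: "f \<in> borel_measurable borel" "mollify (d n) f \<in> borel_measurable borel" for n
    using f(2) mollify_measurable[OF d(1) f(2)] by auto
  have bd: "shift_error ?F z \<le> 2 * (\<integral>x. ?F x \<partial>lborel)" for z
    using shift_error_perturb[OF f(3), of "\<lambda>_. 0" z] by (simp add: shift_error_def)
  show int: "integrable lborel (\<lambda>x. \<bar>mollify (d n) f x - f x\<bar> powr p)" for n
  proof (rule integrableI_bounded)
    have "(\<integral>\<^sup>+x. ennreal (\<bar>mollify (d n) f x - f x\<bar> powr p) \<partial>lborel) \<le> ennreal (2 * (\<integral>x. ?F x \<partial>lborel))"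
      by (rule mollify_error_nonneg[OF assms(1) d(1) f bd]) auto
    then show "(\<integral>\<^sup>+x. ennreal (norm (\<bar>mollify (d n) f x - f x\<bar> powr p)) \<partial>lborel) < \<infinity>"
      by (simp add: le_less_trans)
  qed simp
  show "(\<lambda>n. \<integral>x. \<bar>mollify (d n) f x - f x\<bar> powr p \<partial>lborel) \<longlonglongrightarrow> 0"
  proof (rule LIMSEQ_I)
    fix e :: real assume "e > 0"
    have "\<forall>\<^sub>F z in at 0. dist (shift_error ?F z) 0 < e / 2"
      using tendstoD[OF shift_error_tendsto_0[OF f(3)], of "e/2"] \<open>e > 0\<close> by simp
    then obtain \<delta> where \<delta>: "\<delta> > 0" "\<And>z. z \<noteq> 0 \<Longrightarrow> dist z 0 < \<delta> \<Longrightarrow> dist (shift_error ?F z) 0 < e / 2"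
      by (auto simp: eventually_at)
    have sm: "shift_error ?F z \<le> e / 2" if "norm z < \<delta>" for z
      using \<delta>(2)[of z] that \<open>e > 0\<close> by (cases "z = 0") (auto simp: shift_error_def)
    have "\<forall>\<^sub>F n in sequentially. d n < \<delta>"
      using order_tendstoD(2)[OF d(2) \<delta>(1)] .
    then obtain N where N: "\<And>n. n \<ge> N \<Longrightarrow> d n < \<delta>" by (auto simp: eventually_sequentially)
    have "norm ((\<integral>x. \<bar>mollify (d n) f x - f x\<bar> powr p \<partial>lborel) - 0) < e" if "n \<ge> N" for n
    proof -
      have "ennreal (\<integral>x. \<bar>mollify (d n) f x - f x\<bar> powr p \<partial>lborel) =
          (\<integral>\<^sup>+x. ennreal (\<bar>mollify (d n) f x - f x\<bar> powr p) \<partial>lborel)"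
        by (rule nn_integral_eq_integral[symmetric]) (use int in auto)
      also have "\<dots> \<le> ennreal (e/2)"
        by (rule mollify_error_nonneg[OF assms(1) d(1) f sm]) (use N[OF that] \<open>e > 0\<close> in auto)
      finally have "(\<integral>x. \<bar>mollify (d n) f x - f x\<bar> powr p \<partial>lborel) \<le> e / 2"
        using \<open>e > 0\<close> by (simp add: ennreal_le_iff)
      then show ?thesis using \<open>e > 0\<close> by simp
    qed
    then show "\<exists>no. \<forall>n\<ge>no. norm ((\<integral>x. \<bar>mollify (d n) f x - f x\<bar> powr p \<partial>lborel) - 0) < e"
      by blast
  qed
qed

text \<open>The positive and the negative part are mollified separately.\<close>

theorem mollify_Lp:
  fixes f :: "'e::euclidean_space \<Rightarrow> real"
  assumes "p \<ge> 1" and f: "integrable lborel f" "integrable lborel (\<lambda>x. \<bar>f x\<bar> powr p)"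
    and d: "\<And>n. d n > 0" "d \<longlonglongrightarrow> 0"
  shows "integrable lborel (\<lambda>x. \<bar>mollify (d n) f x - f x\<bar> powr p)"
    and "(\<lambda>n. \<integral>x. \<bar>mollify (d n) f x - f x\<bar> powr p \<partial>lborel) \<longlonglongrightarrow> 0"
proof -
  have [measurable]: "f \<in> borel_measurable borel" "mollify (d n) f \<in> borel_measurable borel" for n
    using f(1) mollify_measurable[OF d(1) f(1)] by auto
  define u where "u x = max 0 (f x)" for x
  define v where "v x = max 0 (- f x)" for x
  have fuv: "f = (\<lambda>x. u x - v x)" by (auto simp: u_def v_def max_def)
  have [measurable]: "u \<in> borel_measurable borel" "v \<in> borel_measurable borel"
    unfolding u_def[abs_def] v_def[abs_def] by measurable
  have uv: "0 \<le> u x" "0 \<le> v x" "u x \<le> \<bar>f x\<bar>" "v x \<le> \<bar>f x\<bar>" for x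
    by (auto simp: u_def v_def)
  have uvp: "u x powr p \<le> \<bar>f x\<bar> powr p" "v x powr p \<le> \<bar>f x\<bar> powr p" for x
    using uv[of x] assms(1) by (auto intro!: powr_mono2)
  have iu: "integrable lborel u"
    by (rule Bochner_Integration.integrable_bound[OF f(1)]) (use uv in auto)
  have iv: "integrable lborel v"
    by (rule Bochner_Integration.integrable_bound[OF f(1)]) (use uv in auto)
  have iup: "integrable lborel (\<lambda>x. u x powr p)"
    by (rule Bochner_Integration.integrable_bound[OF f(2)]) (use uvp in auto)
  have ivp: "integrable lborel (\<lambda>x. v x powr p)"
    by (rule Bochner_Integration.integrable_bound[OF f(2)]) (use uvp in auto)
  note u = uv(1) iu iup and v = uv(2) iv ivp
  note U = mollify_Lp_nonneg[OF assms(1) u d] and V = mollify_Lp_nonneg[OF assms(1) v d]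
  let ?b = "\<lambda>n x. 2 powr p * (\<bar>mollify (d n) u x - u x\<bar> powr p + \<bar>mollify (d n) v x - v x\<bar> powr p)"
  have bound: "\<bar>mollify (d n) f x - f x\<bar> powr p \<le> ?b n x" for n x
  proof -
    have "mollify (d n) f x = mollify (d n) u x - mollify (d n) v x"
      unfolding fuv by (rule mollify_diff[OF d(1) u(2) v(2)])
    then have "\<bar>mollify (d n) f x - f x\<bar> \<le> \<bar>mollify (d n) u x - u x\<bar> + \<bar>mollify (d n) v x - v x\<bar>"
      using fun_cong[OF fuv, of x] by linarith
    then have "\<bar>mollify (d n) f x - f x\<bar> powr p \<le> (\<bar>mollify (d n) u x - u x\<bar> + \<bar>mollify (d n) v x - v x\<bar>) powr p"
      using assms(1) by (intro powr_mono2) auto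
    also have "\<dots> \<le> ?b n x" by (rule powr_add_le) (use assms(1) in auto)
    finally show ?thesis .
  qed
  have ib: "integrable lborel (?b n)" for n using U(1)[of n] V(1)[of n] by auto
  show int: "integrable lborel (\<lambda>x. \<bar>mollify (d n) f x - f x\<bar> powr p)" for n
    by (rule Bochner_Integration.integrable_bound[OF ib[of n]]) (use bound[of n] in \<open>auto intro: order_trans\<close>)
  show "(\<lambda>n. \<integral>x. \<bar>mollify (d n) f x - f x\<bar> powr p \<partial>lborel) \<longlonglongrightarrow> 0"
  proof (rule Lim_null_comparison)
    show "\<forall>\<^sub>F n in sequentially. norm (\<integral>x. \<bar>mollify (d n) f x - f x\<bar> powr p \<partial>lborel) \<le>
        2 powr p * ((\<integral>x. \<bar>mollify (d n) u x - u x\<bar> powr p \<partial>lborel) + (\<integral>x. \<bar>mollify (d n) v x - v x\<bar> powr p \<partial>lborel))"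
    proof (rule always_eventually, rule allI)
      fix n
      have "(\<integral>x. \<bar>mollify (d n) f x - f x\<bar> powr p \<partial>lborel) \<le> (\<integral>x. ?b n x \<partial>lborel)"
        by (rule integral_mono[OF int ib bound])
      then show "norm (\<integral>x. \<bar>mollify (d n) f x - f x\<bar> powr p \<partial>lborel) \<le>
        2 powr p * ((\<integral>x. \<bar>mollify (d n) u x - u x\<bar> powr p \<partial>lborel) + (\<integral>x. \<bar>mollify (d n) v x - v x\<bar> powr p \<partial>lborel))"
        using U(1)[of n] V(1)[of n] by simp
    qed
    show "(\<lambda>n. 2 powr p * ((\<integral>x. \<bar>mollify (d n) u x - u x\<bar> powr p \<partial>lborel) + (\<integral>x. \<bar>mollify (d n) v x - v x\<bar> powr p \<partial>lborel))) \<longlonglongrightarrow> 0"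
      using tendsto_mult_right_zero[OF tendsto_add_zero[OF U(2) V(2)]] .
  qed
qed

section \<open>Non-smooth test functions in Euclidean space\<close>

definition egrad :: "(real^'n::finite \<Rightarrow> real) \<Rightarrow> real^'n \<Rightarrow> real^'n"
  where "egrad f y = (\<chi> i. partial f i y)"

lemma egrad_inner:
  assumes "(f has_derivative f') (at y)"
  shows "egrad f y \<bullet> v = f' v"
proof -
  have f': "frechet_derivative f (at y) = f'" using frechet_derivative_at[OF assms] by simp
  have lin: "linear f'" using assms by (rule has_derivative_linear)
  have "v = (\<Sum>i\<in>UNIV. (v $ i) *\<^sub>R axis i 1)"
    using basis_expansion[of v] by (simp add: scalar_mult_eq_scaleR)
  then have "f' v = f' (\<Sum>i\<in>UNIV. (v $ i) *\<^sub>R axis i 1)"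
    by (rule arg_cong)
  also have "\<dots> = (\<Sum>i\<in>UNIV. v $ i * f' (axis i 1))"
    using lin by (simp add: linear_sum linear_scale)
  finally show ?thesis
    by (simp add: egrad_def partial_def f' inner_vec_def mult.commute)
qed

lemma egrad_eqI:
  assumes "(f has_derivative f') (at y)" "\<And>v. f' v = g \<bullet> v"
  shows "egrad f y = g"
  using egrad_inner[OF assms(1)] assms(2) by (metis vector_eq_rdot)

lemma egrad_has_derivative:
  assumes "f differentiable (at y)"
  shows "(f has_derivative (\<lambda>v. egrad f y \<bullet> v)) (at y)"
proof -
  have "(f has_derivative frechet_derivative f (at y)) (at y)"
    using assms by (simp add: frechet_derivative_works)
  moreover have "frechet_derivative f (at y) = (\<lambda>v. egrad f y \<bullet> v)"
    using egrad_inner[OF calculation] by auto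
  ultimately show ?thesis by simp
qed

lemma C1_differentiable: "Ck_on 1 S f \<Longrightarrow> x \<in> S \<Longrightarrow> f differentiable (at x)"
  by simp

lemma egrad_continuous:
  assumes "Ck_on 1 S f" shows "continuous_on S (egrad f)"
  unfolding egrad_def[abs_def] partial_def
  by (intro continuous_on_vec_lambda C1_D(2)[OF assms])

lemma borel_measurable_vecI:
  fixes f :: "'a \<Rightarrow> real^'n::finite"
  assumes "\<And>i. (\<lambda>x. f x $ i) \<in> borel_measurable M"
  shows "f \<in> borel_measurable M"
  by (subst borel_measurable_euclidean_space)
    (use assms in \<open>auto simp: Basis_vec_def inner_axis\<close>)

text \<open>A substitute for Hoelder's inequality: in \<open>Young_powr\<close> the weight in front of
  $Q^p$ can be made small before \<open>n\<close> is sent to infinity.\<close>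

lemma holder_null:
  fixes F :: "nat \<Rightarrow> 'a \<Rightarrow> real"
  assumes "p > 1" and Q: "\<And>x. 0 \<le> Q x" "Q \<in> borel_measurable M" "integrable M (\<lambda>x. Q x powr p)"
    and F: "\<And>n. F n \<in> borel_measurable M" "\<And>n. integrable M (\<lambda>x. \<bar>F n x\<bar> powr p)"
      "(\<lambda>n. \<integral>x. \<bar>F n x\<bar> powr p \<partial>M) \<longlonglongrightarrow> 0"
  shows "integrable M (\<lambda>x. Q x powr (p - 1) * \<bar>F n x\<bar>)"
    and "(\<lambda>n. \<integral>x. Q x powr (p - 1) * \<bar>F n x\<bar> \<partial>M) \<longlonglongrightarrow> 0"
proof -
  have [measurable]: "Q \<in> borel_measurable M" "F n \<in> borel_measurable M" for n using Q F by auto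
  define b where "b s n x = ((p - 1) / p * s) * Q x powr p + (s powr (1 - p) / p) * \<bar>F n x\<bar> powr p" for s n x
  have ib: "integrable M (b s n)" for s n
    unfolding b_def[abs_def] using Q(3) F(2)[of n] by auto
  have le: "Q x powr (p - 1) * \<bar>F n x\<bar> \<le> b s n x" if "s > 0" for s n x
  proof -
    have "p * (Q x powr (p - 1) * \<bar>F n x\<bar>) \<le> (p - 1) * s * Q x powr p + s powr (1 - p) * \<bar>F n x\<bar> powr p"
      by (rule Young_powr) (use assms that in auto)
    also have "\<dots> = p * b s n x" using assms(1) by (simp add: b_def field_simps)
    finally show ?thesis using assms(1) by simp
  qed
  show int: "integrable M (\<lambda>x. Q x powr (p - 1) * \<bar>F n x\<bar>)" for n
    by (rule Bochner_Integration.integrable_bound[OF ib[of 1 n]]) (use le[of 1] in \<open>auto intro: order_trans[OF _ abs_ge_self]\<close>)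
  define A where "A = (\<integral>x. Q x powr p \<partial>M)"
  have A: "A \<ge> 0" by (simp add: A_def)
  have bound: "(\<integral>x. Q x powr (p - 1) * \<bar>F n x\<bar> \<partial>M) \<le> s * A + (s powr (1 - p) / p) * (\<integral>x. \<bar>F n x\<bar> powr p \<partial>M)"
    if "s > 0" for s n
  proof -
    have "(\<integral>x. Q x powr (p - 1) * \<bar>F n x\<bar> \<partial>M) \<le> (\<integral>x. b s n x \<partial>M)"
      by (rule integral_mono[OF int ib le[OF that]])
    also have "\<dots> = ((p - 1) / p * s) * A + (s powr (1 - p) / p) * (\<integral>x. \<bar>F n x\<bar> powr p \<partial>M)"
      unfolding b_def A_def using Q(3) F(2)[of n] by simp
    also have "((p - 1) / p * s) * A \<le> s * A"
      using assms(1) that A by (intro mult_right_mono) (auto simp: field_simps)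
    finally show ?thesis by simp
  qed
  show "(\<lambda>n. \<integral>x. Q x powr (p - 1) * \<bar>F n x\<bar> \<partial>M) \<longlonglongrightarrow> 0"
  proof (rule LIMSEQ_I)
    fix e :: real assume "e > 0"
    define s where "s = e / (2 * (A + 1))"
    have s: "s > 0" using \<open>e > 0\<close> A by (simp add: s_def)
    have sA: "s * A \<le> e / 2" using \<open>e > 0\<close> A by (simp add: s_def field_simps)
    have "(\<lambda>n. (s powr (1 - p) / p) * (\<integral>x. \<bar>F n x\<bar> powr p \<partial>M)) \<longlonglongrightarrow> 0"
      by (rule tendsto_mult_right_zero[OF F(3)])
    then have "\<forall>\<^sub>F n in sequentially. (s powr (1 - p) / p) * (\<integral>x. \<bar>F n x\<bar> powr p \<partial>M) < e / 2"
      by (rule order_tendstoD) (use \<open>e > 0\<close> in auto)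
    then obtain N where N: "\<And>n. n \<ge> N \<Longrightarrow> (s powr (1 - p) / p) * (\<integral>x. \<bar>F n x\<bar> powr p \<partial>M) < e / 2"
      by (auto simp: eventually_sequentially)
    have "norm ((\<integral>x. Q x powr (p - 1) * \<bar>F n x\<bar> \<partial>M) - 0) < e" if "n \<ge> N" for n
    proof -
      have "0 \<le> (\<integral>x. Q x powr (p - 1) * \<bar>F n x\<bar> \<partial>M)"
        by (rule Bochner_Integration.integral_nonneg) simp
      moreover have "(\<integral>x. Q x powr (p - 1) * \<bar>F n x\<bar> \<partial>M) < e"
        using bound[OF s, of n] N[OF that] sA by linarith
      ultimately show ?thesis by simp
    qed
    then show "\<exists>no. \<forall>n\<ge>no. norm ((\<integral>x. Q x powr (p - 1) * \<bar>F n x\<bar> \<partial>M) - 0) < e" by blast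
  qed
qed

lemma compact_support_in_mono:
  fixes f g :: "'a::t2_space \<Rightarrow> real"
  assumes "compact_support_in U f" "\<And>x. g x \<noteq> 0 \<Longrightarrow> f x \<noteq> 0"
  shows "compact_support_in U g"
proof -
  have sub: "closure {x. g x \<noteq> 0} \<subseteq> closure {x. f x \<noteq> 0}"
    using assms(2) by (intro closure_mono) auto
  have "compact (closure {x. f x \<noteq> 0} \<inter> closure {x. g x \<noteq> 0})"
    using assms(1) by (intro compact_Int_closed) (auto simp: compact_support_in_def)
  then show ?thesis using sub assms(1) by (auto simp: compact_support_in_def Int_absorb1)
qed

lemma compact_support_inI:
  fixes f :: "'a::t2_space \<Rightarrow> real"
  assumes "compact K" "K \<subseteq> U" "\<And>x. x \<notin> K \<Longrightarrow> f x = 0"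
  shows "compact_support_in U f"
proof -
  have sub: "closure {x. f x \<noteq> 0} \<subseteq> K"
    by (rule closure_minimal) (use assms compact_imp_closed in auto)
  have "compact (K \<inter> closure {x. f x \<noteq> 0})"
    using assms(1) by (intro compact_Int_closed) auto
  then show ?thesis using sub assms(2) by (auto simp: compact_support_in_def Int_absorb1)
qed

lemma egrad_zero_off_support:
  assumes "x \<notin> closure {x. w x \<noteq> 0}" shows "egrad w x = 0"
proof -
  have "((\<lambda>_. 0 :: real) has_derivative (\<lambda>_. 0)) (at x)" by simp
  then have "(w has_derivative (\<lambda>_. 0)) (at x)"
    by (rule has_derivative_transform_within_open[of _ _ x UNIV "- closure {x. w x \<noteq> 0}"])
      (use assms closure_subset[of "{x. w x \<noteq> 0}"] in auto)
  then show ?thesis by (rule egrad_eqI) simp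
qed

text \<open>The translated kernel \<open>\<lambda>y. moll d (x - y)\<close> is an admissible test function
  as soon as the ball around \<open>x\<close> lies in \<open>U\<close>, so differentiating the
  kernel is the same as mollifying the weak derivative.\<close>

lemma mollify_egrad:
  fixes r :: "real^'n::finite \<Rightarrow> real"
  assumes r: "integrable lborel r" and d: "d > 0" and ball: "cball x d \<subseteq> U"
    and weak: "\<And>\<psi>. smooth_on UNIV \<psi> \<Longrightarrow> compact_support_in U \<psi> \<Longrightarrow>
      (\<integral>y. r y * partial \<psi> i y \<partial>lborel) = - (\<integral>y. D y $ i * \<psi> y \<partial>lborel)"
  shows "egrad (mollify d r) x $ i = mollify d (\<lambda>y. D y $ i) x"
proof -
  have z: "\<forall>z::real^'n. norm z \<ge> d \<longrightarrow> moll d z = 0" using moll_kernel(2)[OF d] by blast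
  note der = conv_C1(1)[OF r moll_kernel(6)[OF d] z, of x]
  define \<psi> where "\<psi> y = moll d (x - y)" for y
  have dm: "(moll d has_derivative frechet_derivative (moll d) (at z)) (at z)" for z :: "real^'n"
    using C1_D(1)[OF moll_kernel(6)[OF d]] by auto
  have "(\<psi> has_derivative (\<lambda>v. frechet_derivative (moll d) (at (x - y)) (- v))) (at y)" for y
  proof -
    have "((\<lambda>y. x - y) has_derivative (\<lambda>v. - v)) (at y)"
      by (auto intro!: derivative_eq_intros)
    from has_derivative_compose[OF this dm] show ?thesis by (simp add: \<psi>_def[abs_def])
  qed
  then have part: "partial \<psi> i y = - frechet_derivative (moll d) (at (x - y)) (axis i 1)" for y
    unfolding partial_def
    by (metis (no_types, lifting) frechet_derivative_at linear_neg has_derivative_linear[OF dm])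
  have sm: "smooth_on UNIV \<psi>" using moll_kernel(5)[OF d, of x] by (simp add: \<psi>_def[abs_def])
  have cs: "compact_support_in U \<psi>"
    by (rule compact_support_inI[of "cball x d"])
      (use ball in \<open>auto simp: \<psi>_def dist_norm not_le intro!: moll_kernel(2)[OF d] less_imp_le\<close>)
  have "egrad (mollify d r) x $ i = egrad (mollify d r) x \<bullet> axis i 1"
    by (simp add: inner_axis)
  also have "\<dots> = conv (\<lambda>z. frechet_derivative (moll d) (at z) (axis i 1)) r x"
    using egrad_inner[OF der] by (simp add: mollify_def)
  also have "\<dots> = - (\<integral>y. r y * partial \<psi> i y \<partial>lborel)"
    unfolding conv_def part by (simp add: mult.commute)
  also have "\<dots> = mollify d (\<lambda>y. D y $ i) x"
    unfolding weak[OF sm cs] by (simp add: mollify_def conv_def \<psi>_def mult.commute)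
  finally show ?thesis .
qed

text \<open>\<open>Y\<close> stands for $|\nabla\rho|^{p-2}\nabla\rho$ and \<open>D\<close> for
  $\nabla\rho$, both controlled by one function \<open>Q\<close>. The inequality is known for
  $C^1$ test functions, and \<open>w * h r\<close> is not one because \<open>r\<close> is merely
  a Sobolev function. Replacing \<open>r\<close> by its mollifications gives admissible
  functions. In the limit, the values of the mollifications converge almost everywhere along a
  subsequence, which settles every term with a fixed integrable majorant; the gradients converge
  in $L^p$, which settles the remaining term since \<open>Y\<close> is bounded by $Q^{p-1}$.\<close>

theorem weak_inequality_test:
  fixes r :: "real^'n::finite \<Rightarrow> real" and D Y :: "real^'n \<Rightarrow> real^'n"
  assumes "p > 1"
    and U: "open U"
    and r: "integrable lborel r" "\<And>y. 0 \<le> r y"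
    and D: "D \<in> borel_measurable borel" "\<And>y. norm (D y) \<le> Q y"
    and Y: "Y \<in> borel_measurable borel" "\<And>y. norm (Y y) \<le> Q y powr (p - 1)"
    and Q: "\<And>y. 0 \<le> Q y" "integrable lborel Q" "integrable lborel (\<lambda>y. Q y powr p)"
    and weak: "\<And>\<psi> i. smooth_on UNIV \<psi> \<Longrightarrow> compact_support_in U \<psi> \<Longrightarrow>
      (\<integral>y. r y * partial \<psi> i y \<partial>lborel) = - (\<integral>y. D y $ i * \<psi> y \<partial>lborel)"
    and super: "\<And>\<phi>. Ck_on 1 UNIV \<phi> \<Longrightarrow> compact_support_in U \<phi> \<Longrightarrow> (\<And>y. 0 \<le> \<phi> y) \<Longrightarrow>
      0 \<le> (\<integral>y. Y y \<bullet> egrad \<phi> y \<partial>lborel)"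
    and h: "\<And>t. 0 \<le> t \<Longrightarrow> (h has_real_derivative h' t) (at t)" "continuous_on {0..} h'"
      "\<And>t. 0 \<le> t \<Longrightarrow> 0 \<le> h t" "\<And>t. 0 \<le> t \<Longrightarrow> h t \<le> H" "\<And>t. 0 \<le> t \<Longrightarrow> \<bar>h' t\<bar> \<le> H"
    and w: "Ck_on 1 UNIV w" "compact_support_in U w" "\<And>y. 0 \<le> w y"
  shows "integrable lborel (\<lambda>y. Y y \<bullet> (h (r y) *\<^sub>R egrad w y + (w y * h' (r y)) *\<^sub>R D y))"
    and "0 \<le> (\<integral>y. Y y \<bullet> (h (r y) *\<^sub>R egrad w y + (w y * h' (r y)) *\<^sub>R D y) \<partial>lborel)"
proof -
  define S where "S = closure {y. w y \<noteq> 0}"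
  have S: "compact S" "S \<subseteq> U" using w(2) by (auto simp: S_def compact_support_in_def)
  have wS: "w y = 0" if "y \<notin> S" for y
    using that closure_subset[of "{y. w y \<noteq> 0}"] by (auto simp: S_def)
  have gS: "egrad w y = 0" if "y \<notin> S" for y
    using egrad_zero_off_support that by (auto simp: S_def)
  have H: "0 \<le> H" using h(3,4)[of 0] by linarith
  obtain e where e: "e > 0" "(\<Union>x\<in>S. cball x e) \<subseteq> U"
    using compact_subset_open_imp_cball_epsilon_subset[OF S(1) U S(2)] .
  define d where "d n = e * inverse (real (Suc n))" for n
  have d: "\<And>n. d n > 0" "\<And>n. d n \<le> e" using e by (auto simp: d_def field_simps)
  have dlim: "d \<longlonglongrightarrow> 0"
    unfolding d_def[abs_def] by (rule tendsto_mult_right_zero[OF LIMSEQ_inverse_real_of_nat])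
  define rn where "rn n = mollify (d n) r" for n
  define Dn where "Dn n x = (\<chi> i. mollify (d n) (\<lambda>y. D y $ i) x)" for n x
  have rnC: "Ck_on 1 UNIV (rn n)" for n unfolding rn_def by (rule mollify_C1[OF d(1) r(1)])
  have rn0: "0 \<le> rn n x" for n x unfolding rn_def by (rule mollify_nonneg[OF d(1) r(2)])
  have egrn: "egrad (rn n) x = Dn n x" if "x \<in> S" for n x
  proof -
    have "cball x (d n) \<subseteq> U" using e(2) d(2)[of n] that by force
    from mollify_egrad[OF r(1) d(1) this weak] show ?thesis
      by (simp add: vec_eq_iff Dn_def rn_def)
  qed
  have cw: "continuous_on UNIV w" by (rule Ck_on_continuous[OF open_UNIV w(1)])
  have cgw: "continuous_on UNIV (egrad w)" by (rule egrad_continuous[OF w(1)])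
  have [measurable]: "w \<in> borel_measurable borel" "egrad w \<in> borel_measurable borel"
    using cw cgw by (auto intro: borel_measurable_continuous_onI)
  have crn: "continuous_on UNIV (rn n)" for n by (rule Ck_on_continuous[OF open_UNIV rnC])
  have ch: "continuous_on {0..} h"
    using h(1) by (intro continuous_at_imp_continuous_on ballI) (auto intro: DERIV_isCont)
  \<comment> \<open>\<open>h\<close> is only controlled on the nonnegative half-line; composing with \<open>max 0\<close> makes it continuous everywhere.\<close>
  have ch2: "continuous_on UNIV (\<lambda>t. h (max 0 t))" "continuous_on UNIV (\<lambda>t. h' (max 0 t))"
    by (rule continuous_on_compose2[OF ch] continuous_on_compose2[OF h(2)]; auto intro!: continuous_intros)+
  have mh: "(\<lambda>t. h (max 0 t)) \<in> borel_measurable borel" "(\<lambda>t. h' (max 0 t)) \<in> borel_measurable borel"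
    using ch2 by (auto intro: borel_measurable_continuous_onI)
  have mr: "r \<in> borel_measurable borel" using r(1) by auto
  have mrn: "rn n \<in> borel_measurable borel" for n using crn by (rule borel_measurable_continuous_onI)
  have [measurable]: "(\<lambda>y. h (r y)) \<in> borel_measurable borel" "(\<lambda>y. h' (r y)) \<in> borel_measurable borel"
    "(\<lambda>y. h (rn n y)) \<in> borel_measurable borel" "(\<lambda>y. h' (rn n y)) \<in> borel_measurable borel" for n
    using measurable_compose[OF mr mh(1)] measurable_compose[OF mr mh(2)]
      measurable_compose[OF mrn mh(1)] measurable_compose[OF mrn mh(2)] r(2) rn0
    by (simp_all add: max_def)
  have [measurable]: "D \<in> borel_measurable borel" "Y \<in> borel_measurable borel" "Q \<in> borel_measurable borel"
    using D(1) Y(1) Q(2) by auto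
  have "compact (w ` S)" "compact (egrad w ` S)"
    by (intro compact_continuous_image[OF _ S(1)] continuous_on_subset[OF cw] continuous_on_subset[OF cgw] subset_UNIV)+
  then obtain W1 W2 where W12: "\<forall>y\<in>w ` S. norm y \<le> W1" "\<forall>y\<in>egrad w ` S. norm y \<le> W2"
    using compact_imp_bounded bounded_iff by metis
  define W where "W = max 0 (max W1 W2)"
  have W: "W \<ge> 0" "\<bar>w y\<bar> \<le> W" "norm (egrad w y) \<le> W * indicator S y" for y
  proof -
    show "W \<ge> 0" by (simp add: W_def)
    show "\<bar>w y\<bar> \<le> W"
    proof (cases "y \<in> S")
      case True
      then have "norm (w y) \<le> W1" using W12(1) by blast
      then show ?thesis by (simp add: W_def)
    qed (simp add: wS W_def)
    show "norm (egrad w y) \<le> W * indicator S y"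
    proof (cases "y \<in> S")
      case True
      then have "norm (egrad w y) \<le> W2" using W12(2) by blast
      then show ?thesis using True by (simp add: W_def)
    qed (simp add: gS)
  qed
  have Di: "\<bar>D y $ i\<bar> \<le> Q y" for y i
    using component_le_norm_cart[of "D y" i] D(2)[of y] by linarith
  have [measurable]: "(\<lambda>y. D y $ i) \<in> borel_measurable borel" for i
    unfolding cart_eq_inner_axis by measurable
  have iDi: "integrable lborel (\<lambda>y. D y $ i)" for i
    by (rule Bochner_Integration.integrable_bound[OF Q(2)]) (use Di Q(1) in auto)
  have iDip: "integrable lborel (\<lambda>y. \<bar>D y $ i\<bar> powr p)" for i
    by (rule Bochner_Integration.integrable_bound[OF Q(3)]) (use Di Q(1) assms(1) in \<open>auto intro!: powr_mono2\<close>)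
  have mDn: "(\<lambda>x. mollify (d n) (\<lambda>y. D y $ i) x) \<in> borel_measurable borel" for n i
    by (rule mollify_measurable[OF d(1) iDi])
  have [measurable]: "Dn n \<in> borel_measurable borel" for n
    unfolding Dn_def[abs_def] by (rule borel_measurable_vecI) (simp add: mDn)
  have p1: "1 \<le> p" using assms(1) by simp
  define \<phi> where "\<phi> n x = w x * h (rn n x)" for n x
  have der: "(\<phi> n has_derivative (\<lambda>v. w x * (h' (rn n x) * frechet_derivative (rn n) (at x) v)
      + frechet_derivative w (at x) v * h (rn n x))) (at x)" for n x
  proof -
    have "((\<lambda>x. h (rn n x)) has_derivative (\<lambda>v. h' (rn n x) * frechet_derivative (rn n) (at x) v)) (at x)"
      using has_derivative_compose[OF C1_D(1)[OF rnC] h(1)[OF rn0, unfolded has_field_derivative_def]] by simp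
    then show ?thesis
      unfolding \<phi>_def[abs_def] by (intro has_derivative_mult C1_D(1)[OF w(1)]) auto
  qed
  have ch'rn: "continuous_on UNIV (\<lambda>x. h' (rn n x))" for n
    by (rule continuous_on_compose2[OF h(2) crn]) (use rn0 in auto)
  have chrn: "continuous_on UNIV (\<lambda>x. h (rn n x))" for n
    by (rule continuous_on_compose2[OF ch crn]) (use rn0 in auto)
  have \<phi>C: "Ck_on 1 UNIV (\<phi> n)" for n
    by (rule C1_I[OF open_UNIV der])
      (intro continuous_intros cw ch'rn chrn C1_D(2)[OF w(1)] C1_D(2)[OF rnC])
  have \<phi>cs: "compact_support_in U (\<phi> n)" for n
    by (rule compact_support_in_mono[OF w(2)]) (auto simp: \<phi>_def)
  have \<phi>0: "0 \<le> \<phi> n y" for n y using w(3) h(3)[OF rn0] by (simp add: \<phi>_def)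
  have eg\<phi>: "egrad (\<phi> n) x = h (rn n x) *\<^sub>R egrad w x + (w x * h' (rn n x)) *\<^sub>R Dn n x" for n x
  proof (rule egrad_eqI[OF der])
    fix v
    have "egrad (rn n) x \<bullet> v = Dn n x \<bullet> v \<or> w x = 0" using egrn[of x n] wS[of x] by (cases "x \<in> S") auto
    then show "w x * (h' (rn n x) * frechet_derivative (rn n) (at x) v) + frechet_derivative w (at x) v * h (rn n x) =
       (h (rn n x) *\<^sub>R egrad w x + (w x * h' (rn n x)) *\<^sub>R Dn n x) \<bullet> v"
      using egrad_inner[OF C1_D(1)[OF w(1)], of x v] egrad_inner[OF C1_D(1)[OF rnC], of x n v]
      by (auto simp: inner_add_left)
  qed
  define T where "T n x = Y x \<bullet> (h (rn n x) *\<^sub>R egrad w x + (w x * h' (rn n x)) *\<^sub>R D x)" for n x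
  define T0 where "T0 x = Y x \<bullet> (h (r x) *\<^sub>R egrad w x + (w x * h' (r x)) *\<^sub>R D x)" for x
  define E where "E n x = (w x * h' (rn n x)) * (Y x \<bullet> (Dn n x - D x))" for n x
  have split: "Y x \<bullet> egrad (\<phi> n) x = T n x + E n x" for n x
    by (simp add: eg\<phi> T_def E_def inner_diff_right inner_add_right algebra_simps)
  have [measurable]: "T n \<in> borel_measurable borel" "T0 \<in> borel_measurable borel" "E n \<in> borel_measurable borel" for n
    unfolding T_def[abs_def] T0_def[abs_def] E_def[abs_def] by measurable
  \<comment> \<open>A majorant for all \<open>T n\<close>: \<open>egrad w\<close> vanishes off \<open>S\<close>, where $Q^{p-1} \le 1 + Q^p$,
    and $|Y|\,|D| \le Q^p$.\<close>
  define dom where "dom y = H * W * (indicator S y + Q y powr p) + W * H * Q y powr p" for y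
  have [measurable]: "S \<in> sets borel" using S(1) by (simp add: borel_compact)
  have "emeasure lborel S < \<infinity>" using S(1) emeasure_compact_finite by auto
  then have iS: "integrable lborel (indicator S :: real^'n \<Rightarrow> real)"
    by (simp add: less_top)
  have idom: "integrable lborel dom"
    unfolding dom_def[abs_def] using iS Q(3) by auto
  have gen: "\<bar>Y x \<bullet> (h t *\<^sub>R egrad w x + (w x * h' t) *\<^sub>R D x)\<bar> \<le> dom x" if "t \<ge> 0" for t x
  proof -
    have q: "Q x powr (p - 1) * indicator S x \<le> indicator S x + Q x powr p"
    proof (cases "Q x \<le> 1")
      case True
      then have "Q x powr (p - 1) \<le> 1" using Q(1)[of x] assms(1) by (intro powr_le1) auto
      then show ?thesis by (auto simp: indicator_def intro: add_increasing2)
    next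
      case False
      then have "Q x powr (p - 1) \<le> Q x powr p" by (intro powr_mono) auto
      then show ?thesis by (auto simp: indicator_def)
    qed
    have "\<bar>Y x \<bullet> egrad w x\<bar> \<le> Q x powr (p - 1) * (W * indicator S x)"
      by (rule order_trans[OF Cauchy_Schwarz_ineq2]) (intro mult_mono Y(2) W, auto)
    also have "\<dots> \<le> W * (indicator S x + Q x powr p)"
      using mult_left_mono[OF q W(1)] by (simp add: algebra_simps)
    finally have "\<bar>Y x \<bullet> egrad w x\<bar> \<le> W * (indicator S x + Q x powr p)" .
    then have 1: "\<bar>h t * (Y x \<bullet> egrad w x)\<bar> \<le> H * (W * (indicator S x + Q x powr p))"
      unfolding abs_mult using h(3,4)[OF that] H by (intro mult_mono) auto
    have "\<bar>Y x \<bullet> D x\<bar> \<le> Q x powr (p - 1) * Q x"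
      by (rule order_trans[OF Cauchy_Schwarz_ineq2]) (intro mult_mono Y(2) D(2), auto simp: Q(1))
    also have "\<dots> = Q x powr p" using Q(1)[of x] by (cases "Q x = 0") (auto simp: powr_diff)
    finally have "\<bar>w x * h' t * (Y x \<bullet> D x)\<bar> \<le> (W * H) * Q x powr p"
      unfolding abs_mult using W h(5)[OF that] H by (intro mult_mono) auto
    with 1 show ?thesis by (simp add: dom_def inner_add_right)
  qed
  have iT: "integrable lborel (T n)" for n
    by (rule Bochner_Integration.integrable_bound[OF idom])
      (auto simp: T_def intro!: order_trans[OF gen abs_ge_self] rn0)
  show iT0: "integrable lborel (\<lambda>y. Y y \<bullet> (h (r y) *\<^sub>R egrad w y + (w y * h' (r y)) *\<^sub>R D y))"
    by (rule Bochner_Integration.integrable_bound[OF idom])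
      (auto intro!: order_trans[OF gen abs_ge_self] r(2))
  define B where "B n y = W * H * (\<Sum>i\<in>UNIV. Q y powr (p - 1) * \<bar>Dn n y $ i - D y $ i\<bar>)" for n y
  have comp: "Dn n y $ i - D y $ i = mollify (d n) (\<lambda>y. D y $ i) y - D y $ i" for n y i
    by (simp add: Dn_def)
  note L = mollify_Lp[OF p1 iDi iDip d(1) dlim]
  have mF: "(\<lambda>y. Dn n y $ i - D y $ i) \<in> borel_measurable lborel" for n i
    unfolding comp using mDn by simp
  have LF: "integrable lborel (\<lambda>y. \<bar>Dn n y $ i - D y $ i\<bar> powr p)"
      "(\<lambda>n. \<integral>y. \<bar>Dn n y $ i - D y $ i\<bar> powr p \<partial>lborel) \<longlonglongrightarrow> 0" for n i
    unfolding comp by (rule L)+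
  have FL: "integrable lborel (\<lambda>y. Q y powr (p - 1) * \<bar>Dn n y $ i - D y $ i\<bar>)"
      "(\<lambda>n. \<integral>y. Q y powr (p - 1) * \<bar>Dn n y $ i - D y $ i\<bar> \<partial>lborel) \<longlonglongrightarrow> 0" for n i
    using holder_null[OF assms(1) Q(1) _ Q(3) mF[of _ i] LF(1)[of _ i] LF(2)[of i]] by auto
  have iB: "integrable lborel (B n)" for n
    unfolding B_def[abs_def] using FL(1) by auto
  have "(\<lambda>n. W * H * (\<Sum>i\<in>UNIV. \<integral>y. Q y powr (p - 1) * \<bar>Dn n y $ i - D y $ i\<bar> \<partial>lborel)) \<longlonglongrightarrow> 0"
    by (intro tendsto_mult_right_zero tendsto_null_sum FL(2))
  then have Blim: "(\<lambda>n. \<integral>y. B n y \<partial>lborel) \<longlonglongrightarrow> 0"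
    unfolding B_def using FL(1) by simp
  have EB: "\<bar>E n y\<bar> \<le> B n y" for n y
  proof -
    have "\<bar>Y y \<bullet> (Dn n y - D y)\<bar> \<le> (\<Sum>i\<in>UNIV. Q y powr (p - 1) * \<bar>Dn n y $ i - D y $ i\<bar>)"
      unfolding inner_vec_def
    proof (rule order_trans[OF sum_abs], rule sum_mono)
      fix i
      show "\<bar>inner (Y y $ i) ((Dn n y - D y) $ i)\<bar> \<le> Q y powr (p - 1) * \<bar>Dn n y $ i - D y $ i\<bar>"
        using component_le_norm_cart[of "Y y" i] Y(2)[of y] by (auto simp: abs_mult intro!: mult_right_mono)
    qed
    moreover have "\<bar>w y * h' (rn n y)\<bar> \<le> W * H"
      unfolding abs_mult using W h(5)[OF rn0] by (intro mult_mono) auto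
    ultimately show ?thesis
      unfolding E_def B_def abs_mult[of "w y * h' (rn n y)"] using W(1) H by (intro mult_mono) auto
  qed
  have iE: "integrable lborel (E n)" for n
    by (rule Bochner_Integration.integrable_bound[OF iB]) (auto intro!: order_trans[OF EB abs_ge_self])
  have Elim: "(\<lambda>n. \<integral>y. E n y \<partial>lborel) \<longlonglongrightarrow> 0"
  proof (rule Lim_null_comparison[OF _ Blim], rule always_eventually, rule allI)
    fix n
    have "norm (\<integral>y. E n y \<partial>lborel) \<le> (\<integral>y. \<bar>E n y\<bar> \<partial>lborel)" by simp
    also have "\<dots> \<le> (\<integral>y. B n y \<partial>lborel)"
      by (rule integral_mono) (use iE iB EB in auto)
    finally show "norm (\<integral>y. E n y \<partial>lborel) \<le> (\<integral>y. B n y \<partial>lborel)" .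
  qed
  \<comment> \<open>Only a subsequence converges almost everywhere, which is enough for the sign of the limit.\<close>
  have i1: "integrable lborel (\<lambda>x. \<bar>r x\<bar> powr 1)" using r(1) by (simp add: powr_one_gt_zero_iff r(2))
  note R = mollify_Lp[OF order_refl r(1) i1 d(1) dlim]
  have irn: "integrable lborel (\<lambda>y. rn n y - r y)" for n
    using R(1)[of n] mrn[of n] mr by (simp add: rn_def integrable_abs_iff)
  obtain \<nu> where \<nu>: "strict_mono \<nu>" "AE y in lborel. (\<lambda>n. rn (\<nu> n) y - r y) \<longlonglongrightarrow> 0"
    using tendsto_L1_AE_subseq[of lborel "\<lambda>n y. rn n y - r y", OF irn] R(2) by (auto simp: rn_def)
  have "(\<lambda>n. \<integral>y. T (\<nu> n) y \<partial>lborel) \<longlonglongrightarrow> (\<integral>y. T0 y \<partial>lborel)"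
  proof (rule integral_dominated_convergence[OF _ _ idom])
    show "AE y in lborel. (\<lambda>n. T (\<nu> n) y) \<longlonglongrightarrow> T0 y"
      using \<nu>(2)
    proof eventually_elim
      case (elim y)
      then have rl: "(\<lambda>n. rn (\<nu> n) y) \<longlonglongrightarrow> r y" by (rule LIM_zero_cancel)
      have "(\<lambda>n. h (rn (\<nu> n) y)) \<longlonglongrightarrow> h (r y)" "(\<lambda>n. h' (rn (\<nu> n) y)) \<longlonglongrightarrow> h' (r y)"
        using continuous_on_tendsto_compose[OF ch rl] continuous_on_tendsto_compose[OF h(2) rl] rn0 r(2) by auto
      then show ?case unfolding T_def T0_def by (intro tendsto_intros)
    qed
    show "AE y in lborel. norm (T (\<nu> n) y) \<le> dom y" for n
      using gen[OF rn0] by (auto simp: T_def)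
  qed auto
  moreover have "(\<lambda>n. \<integral>y. E (\<nu> n) y \<partial>lborel) \<longlonglongrightarrow> 0"
    using LIMSEQ_subseq_LIMSEQ[OF Elim \<nu>(1)] by (simp add: comp_def)
  ultimately have "(\<lambda>n. (\<integral>y. T (\<nu> n) y \<partial>lborel) + (\<integral>y. E (\<nu> n) y \<partial>lborel)) \<longlonglongrightarrow> (\<integral>y. T0 y \<partial>lborel) + 0"
    by (rule tendsto_add)
  moreover have "0 \<le> (\<integral>y. T n y \<partial>lborel) + (\<integral>y. E n y \<partial>lborel)" for n
    using super[OF \<phi>C \<phi>cs \<phi>0, of n] iT[of n] iE[of n] by (simp add: split)
  ultimately have "0 \<le> (\<integral>y. T0 y \<partial>lborel)"
    using LIMSEQ_le_const by force
  then show "0 \<le> (\<integral>y. Y y \<bullet> (h (r y) *\<^sub>R egrad w y + (w y * h' (r y)) *\<^sub>R D y) \<partial>lborel)"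
    by (simp add: T0_def)
qed

section \<open>Change of variables\<close>

text \<open>Carries the Jacobian determinant to another index type: permutations of the two index sets
  correspond under conjugation, with equal signs.\<close>

lemma det_reindex:
  fixes A :: "real^'n::finite^'n" and f :: "'m::finite \<Rightarrow> 'n"
  assumes f: "bij f"
  shows "det (\<chi> i j. A $ f i $ f j) = det A"
proof -
  have inj: "inj f" and fi: "f (inv f y) = y" "inv f (f x) = x" for x y
    using f by (auto simp: bij_def surj_f_inv_f)
  have bi: "bij (inv f)" using f by (rule bij_imp_bij_inv)
  have "(\<Sum>p\<in>{p. p permutes (UNIV :: 'm set)}. of_int (sign p) * (\<Prod>i\<in>UNIV. A $ f i $ f (p i))) =
      (\<Sum>p\<in>{p. p permutes (UNIV :: 'n set)}. of_int (sign p) * (\<Prod>i\<in>UNIV. A $ i $ p i))"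
  proof (rule sum.reindex_bij_witness[where j="map_permutation UNIV f" and i="map_permutation UNIV (inv f)"])
    fix p assume "p \<in> {p. p permutes (UNIV :: 'm set)}"
    then have p: "p permutes UNIV" by simp
    show "map_permutation UNIV (inv f) (map_permutation UNIV f p) = p"
      by (rule map_permutation_compose_inv[where B=UNIV]) (use f p fi bi in \<open>auto\<close>)
    show "map_permutation UNIV f p \<in> {p. p permutes UNIV}"
      using map_permutation_permutes[of f UNIV UNIV p] f p by simp
    have "(\<Prod>i\<in>UNIV. A $ i $ map_permutation UNIV f p i) = (\<Prod>i\<in>UNIV. A $ f i $ map_permutation UNIV f p (f i))"
      by (rule prod.reindex_bij_betw[OF f, symmetric])
    also have "\<dots> = (\<Prod>i\<in>UNIV. A $ f i $ f (p i))"
      using inj by (simp add: map_permutation_apply)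
    finally show "of_int (sign (map_permutation UNIV f p)) * (\<Prod>i\<in>UNIV. A $ i $ map_permutation UNIV f p i) =
        of_int (sign p) * (\<Prod>i\<in>UNIV. A $ f i $ f (p i))"
      using sign_map_permutation[of f UNIV p] inj p by simp
  next
    fix p assume "p \<in> {p. p permutes (UNIV :: 'n set)}"
    then have p: "p permutes UNIV" by simp
    show "map_permutation UNIV f (map_permutation UNIV (inv f) p) = p"
      by (rule map_permutation_compose_inv[where B=UNIV]) (use f p fi bi in \<open>auto\<close>)
    show "map_permutation UNIV (inv f) p \<in> {p. p permutes UNIV}"
      using map_permutation_permutes[of "inv f" UNIV UNIV p] bi p by simp
  qed
  then show ?thesis by (simp add: det_def)
qed

text \<open>Passes between absolute gauge integrability over a set and Lebesgue integrals of nonnegative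
  functions over the whole space.\<close>

lemma absolutely_integrable_on_iff_nn_integral:
  fixes F :: "'e::euclidean_space \<Rightarrow> real"
  assumes h: "(\<lambda>x. indicator S x * F x) \<in> borel_measurable borel" and pos: "\<And>x. 0 \<le> F x"
  shows "F absolutely_integrable_on S \<longleftrightarrow> (\<integral>\<^sup>+x. ennreal (indicator S x * F x) \<partial>lborel) < \<infinity>"
    and "F absolutely_integrable_on S \<Longrightarrow>
      ennreal (integral S F) = (\<integral>\<^sup>+x. ennreal (indicator S x * F x) \<partial>lborel)"
proof -
  have eq: "F absolutely_integrable_on S \<longleftrightarrow> integrable lborel (\<lambda>x. indicator S x * F x)"
    unfolding set_integrable_def using h by (simp add: integrable_completion)
  also have "\<dots> \<longleftrightarrow> (\<integral>\<^sup>+x. ennreal (indicator S x * F x) \<partial>lborel) < \<infinity>"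
    using h pos by (simp add: integrable_iff_bounded abs_mult)
  finally show "F absolutely_integrable_on S \<longleftrightarrow> (\<integral>\<^sup>+x. ennreal (indicator S x * F x) \<partial>lborel) < \<infinity>" .
  assume ai: "F absolutely_integrable_on S"
  then have "integral S F = (LINT x:S|lebesgue. F x)"
    by (rule set_lebesgue_integral_eq_integral(2)[symmetric])
  also have "\<dots> = (\<integral>x. indicator S x * F x \<partial>lborel)"
    unfolding set_lebesgue_integral_def using h by (simp add: integral_completion)
  finally show "ennreal (integral S F) = (\<integral>\<^sup>+x. ennreal (indicator S x * F x) \<partial>lborel)"
    using nn_integral_eq_integral[of lborel "\<lambda>x. indicator S x * F x"] ai eq pos by simp
qed

text \<open>For a nonnegative function the two sides are finite, or infinite, together.\<close>

lemma nn_integral_change_of_variables_wellorder: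
  fixes g :: "real^'m::{finite,wellorder} \<Rightarrow> real^'m::_" and f :: "real^'m::_ \<Rightarrow> real"
  assumes S: "S \<in> sets borel"
    and der: "\<And>x. x \<in> S \<Longrightarrow> (g has_derivative g' x) (at x within S)" and inj: "inj_on g S"
    and f: "\<And>y. 0 \<le> f y"
    and m1: "(\<lambda>y. indicator (g ` S) y * f y) \<in> borel_measurable borel"
    and m2: "(\<lambda>x. indicator S x * (\<bar>det (matrix (g' x))\<bar> * f (g x))) \<in> borel_measurable borel"
  shows "(\<integral>\<^sup>+y. ennreal (indicator (g ` S) y * f y) \<partial>lborel) =
    (\<integral>\<^sup>+x. ennreal (indicator S x * (\<bar>det (matrix (g' x))\<bar> * f (g x))) \<partial>lborel)"
proof -
  let ?F = "\<lambda>x. \<bar>det (matrix (g' x))\<bar> * f (g x)"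
  have F0: "0 \<le> ?F x" for x using f by simp
  note A = absolutely_integrable_on_iff_nn_integral[OF m1 f]
  note B = absolutely_integrable_on_iff_nn_integral[OF m2 F0]
  have SL: "S \<in> sets lebesgue" using S by auto
  have cv: "?F absolutely_integrable_on S \<and> integral S ?F = b \<longleftrightarrow>
      f absolutely_integrable_on (g ` S) \<and> integral (g ` S) f = b" for b
    using has_absolute_integral_change_of_variables[OF SL der inj, of "\<lambda>y. vec (f y) :: real^1" "vec b"]
    unfolding absolutely_integrable_on_1_iff integral_on_1_eq by (simp add: vec_eq_iff)
  show ?thesis
  proof (cases "f absolutely_integrable_on (g ` S)")
    case True
    then have "?F absolutely_integrable_on S \<and> integral S ?F = integral (g ` S) f"
      using cv by blast
    then show ?thesis using A(2)[OF True] B(2) by metis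
  next
    case False
    then have "\<not> ?F absolutely_integrable_on S" using cv by blast
    then have "(\<integral>\<^sup>+x. ennreal (indicator S x * ?F x) \<partial>lborel) = \<infinity>"
      unfolding B(1) by (simp add: less_top[symmetric])
    moreover have "(\<integral>\<^sup>+y. ennreal (indicator (g ` S) y * f y) \<partial>lborel) = \<infinity>"
      using False unfolding A(1) by (simp add: less_top[symmetric])
    ultimately show ?thesis by simp
  qed
qed

text \<open>A copy of a finite type, well-ordered by an enumeration. Copying the coordinates of a vector
  preserves Lebesgue measure, derivatives and determinants, so the change of variables formula
  carries over to arbitrary finite index types.\<close>

typedef 'n wo = "UNIV :: 'n set" by simp

lemma bij_Rep_wo: "bij Rep_wo"
  by (metis Abs_wo_inverse Rep_wo_inverse UNIV_I bijI')

definition index_nat :: "'n::finite \<Rightarrow> nat" where "index_nat = (SOME f. inj f)"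

lemma inj_index_nat: "inj (index_nat :: 'n::finite \<Rightarrow> nat)"
proof -
  have "\<exists>f :: 'n \<Rightarrow> nat. inj f" using finite_imp_inj_to_nat_seg[of "UNIV :: 'n set"] by auto
  then show ?thesis unfolding index_nat_def by (rule someI_ex)
qed

instance wo :: (finite) finite
proof
  have "(UNIV :: 'a wo set) = Abs_wo ` UNIV"
    by (metis Rep_wo_inverse surj_def)
  then show "finite (UNIV :: 'a wo set)" by (metis finite finite_imageI)
qed

instantiation wo :: (finite) wellorder
begin

definition less_eq_wo :: "'a wo \<Rightarrow> 'a wo \<Rightarrow> bool"
  where "a \<le> b \<longleftrightarrow> index_nat (Rep_wo a) \<le> index_nat (Rep_wo b)"

definition less_wo :: "'a wo \<Rightarrow> 'a wo \<Rightarrow> bool"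
  where "a < b \<longleftrightarrow> index_nat (Rep_wo a) < index_nat (Rep_wo b)"

instance
proof
  fix a b c :: "'a wo"
  show "(a < b) = (a \<le> b \<and> \<not> b \<le> a)" by (auto simp: less_eq_wo_def less_wo_def)
  show "a \<le> a" by (simp add: less_eq_wo_def)
  show "a \<le> b \<Longrightarrow> b \<le> c \<Longrightarrow> a \<le> c" by (simp add: less_eq_wo_def)
  show "a \<le> b \<Longrightarrow> b \<le> a \<Longrightarrow> a = b"
    unfolding less_eq_wo_def by (metis Rep_wo_inject injD inj_index_nat order_antisym)
  show "a \<le> b \<or> b \<le> a" by (auto simp: less_eq_wo_def)
next
  fix P :: "'a wo \<Rightarrow> bool" and a
  assume step: "\<And>x. (\<And>y. y < x \<Longrightarrow> P y) \<Longrightarrow> P x"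
  show "P a"
    by (induction a rule: measure_induct_rule[of "\<lambda>a. index_nat (Rep_wo a)"])
      (rule step, simp add: less_wo_def)
qed

end

definition to_wo :: "real^'n::finite \<Rightarrow> real^('n wo)" where "to_wo v = (\<chi> i. v $ Rep_wo i)"
definition from_wo :: "real^('n::finite wo) \<Rightarrow> real^'n" where "from_wo v = (\<chi> i. v $ Abs_wo i)"

lemma from_to_wo [simp]: "from_wo (to_wo v) = v" "to_wo (from_wo u) = u"
  by (simp_all add: to_wo_def from_wo_def vec_eq_iff Abs_wo_inverse Rep_wo_inverse)

lemma linear_wo: "linear to_wo" "linear from_wo"
  by (auto intro!: linearI simp: to_wo_def from_wo_def vec_eq_iff)

lemma has_derivative_wo: "(to_wo has_derivative to_wo) F" "(from_wo has_derivative from_wo) G"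
  using linear_wo by (auto intro!: bounded_linear_imp_has_derivative simp: linear_conv_bounded_linear)

lemma measurable_wo [measurable]: "to_wo \<in> borel_measurable borel" "from_wo \<in> borel_measurable borel"
  using linear_wo by (auto intro!: borel_measurable_continuous_onI linear_continuous_on simp: linear_conv_bounded_linear)

lemma prod_Basis_cart: "(\<Prod>b\<in>Basis. (v :: real^'n::finite) \<bullet> b) = (\<Prod>i\<in>UNIV. v $ i)"
  by (simp add: Basis_vec_def cart_eq_inner_axis axis_eq_axis prod.UNION_disjoint)

lemma distr_to_wo: "distr lborel borel (to_wo :: real^'n::finite \<Rightarrow> _) = lborel"
proof (rule lborel_eqI[symmetric])
  fix l u :: "real^('n wo)"
  assume le: "\<And>b. b \<in> Basis \<Longrightarrow> l \<bullet> b \<le> u \<bullet> b"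
  then have le': "l $ i \<le> u $ i" for i
    using le[of "axis i 1"] by (auto simp: Basis_vec_def inner_axis)
  have pre: "to_wo -` box l u = box (from_wo l) (from_wo u)"
  proof -
    have "(\<forall>i. l $ i < v $ Rep_wo i \<and> v $ Rep_wo i < u $ i) \<longleftrightarrow>
       (\<forall>i. l $ Abs_wo i < v $ i \<and> v $ i < u $ Abs_wo i)" for v :: "real^'n"
      by (metis Abs_wo_inverse Rep_wo_inverse UNIV_I)
    then show ?thesis by (auto simp: mem_box_cart to_wo_def from_wo_def)
  qed
  have "emeasure (distr lborel borel to_wo) (box l u) = emeasure lborel (box (from_wo l) (from_wo u))"
    by (simp add: emeasure_distr pre)
  also have "\<dots> = ennreal (\<Prod>b\<in>Basis. (from_wo u - from_wo l) \<bullet> b)"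
    by (rule emeasure_lborel_box) (use le' in \<open>auto simp: Basis_vec_def inner_axis from_wo_def\<close>)
  also have "(\<Prod>b\<in>Basis. (from_wo u - from_wo l) \<bullet> b) = (\<Prod>i\<in>UNIV. (u - l) $ Abs_wo i)"
    by (simp add: prod_Basis_cart from_wo_def)
  also have "\<dots> = (\<Prod>i\<in>UNIV. (u - l) $ Abs_wo (Rep_wo i))"
    by (rule prod.reindex_bij_betw[OF bij_Rep_wo, symmetric])
  also have "\<dots> = (\<Prod>b\<in>Basis. (u - l) \<bullet> b)"
    by (simp add: prod_Basis_cart Rep_wo_inverse)
  finally show "emeasure (distr lborel borel to_wo) (box l u) = ennreal (\<Prod>b\<in>Basis. (u - l) \<bullet> b)" .
qed simp

lemma nn_integral_to_wo:
  fixes h :: "real^'n::finite \<Rightarrow> ennreal"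
  assumes "h \<in> borel_measurable borel"
  shows "(\<integral>\<^sup>+y. h (from_wo y) \<partial>lborel) = (\<integral>\<^sup>+x. h x \<partial>lborel)"
proof -
  have "(\<integral>\<^sup>+y. h (from_wo y) \<partial>lborel) = (\<integral>\<^sup>+y. h (from_wo y) \<partial>distr lborel borel (to_wo :: real^'n \<Rightarrow> _))"
    by (simp add: distr_to_wo)
  also have "\<dots> = (\<integral>\<^sup>+x. h x \<partial>lborel)"
    using assms by (subst nn_integral_distr) auto
  finally show ?thesis .
qed

theorem nn_integral_change_of_variables:
  fixes g :: "real^'n::finite \<Rightarrow> real^'n" and f :: "real^'n \<Rightarrow> real"
  assumes S: "S \<in> sets borel"
    and der: "\<And>x. x \<in> S \<Longrightarrow> (g has_derivative g' x) (at x within S)" and inj: "inj_on g S"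
    and f: "\<And>y. 0 \<le> f y"
    and m1: "(\<lambda>y. indicator (g ` S) y * f y) \<in> borel_measurable borel"
    and m2: "(\<lambda>x. indicator S x * (\<bar>det (matrix (g' x))\<bar> * f (g x))) \<in> borel_measurable borel"
  shows "(\<integral>\<^sup>+y. ennreal (indicator (g ` S) y * f y) \<partial>lborel) =
    (\<integral>\<^sup>+x. ennreal (indicator S x * (\<bar>det (matrix (g' x))\<bar> * f (g x))) \<partial>lborel)"
proof -
  define S2 where "S2 = to_wo ` S"
  define g2 where "g2 y = to_wo (g (from_wo y))" for y
  define g2' where "g2' y v = to_wo (g' (from_wo y) (from_wo v))" for y v
  define f2 where "f2 y = f (from_wo y)" for y
  have S2: "S2 = from_wo -` S" unfolding S2_def by (auto simp: image_iff) (metis from_to_wo(2))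
  have iS2: "indicator S2 y = indicator S (from_wo y)" for y
    by (simp add: S2 indicator_def)
  have gS2: "g2 ` S2 = from_wo -` (g ` S)"
  proof -
    have "g2 ` S2 = to_wo ` (g ` S)" unfolding S2_def by (auto simp: g2_def image_image)
    also have "\<dots> = from_wo -` (g ` S)" by (auto simp: image_iff) (metis from_to_wo(2))
    finally show ?thesis .
  qed
  have igS2: "indicator (g2 ` S2) y = indicator (g ` S) (from_wo y)" for y
    by (simp add: gS2 indicator_def)
  have det2: "det (matrix (g2' y)) = det (matrix (g' (from_wo y)))" for y
  proof -
    have ax: "from_wo (axis j 1) = axis (Rep_wo j) 1" for j :: "'n wo"
      by (auto simp: from_wo_def vec_eq_iff axis_def Abs_wo_inverse Rep_wo_inverse)
    have "matrix (g2' y) = (\<chi> i j. matrix (g' (from_wo y)) $ Rep_wo i $ Rep_wo j)"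
      by (simp add: matrix_def g2'_def vec_eq_iff to_wo_def ax)
    then show ?thesis by (simp only: det_reindex[OF bij_Rep_wo])
  qed
  have "(\<integral>\<^sup>+y. ennreal (indicator (g ` S) y * f y) \<partial>lborel) =
      (\<integral>\<^sup>+y. ennreal (indicator (g2 ` S2) y * f2 y) \<partial>lborel)"
    unfolding igS2 f2_def by (rule nn_integral_to_wo[symmetric]) (use m1 in measurable)
  also have "\<dots> = (\<integral>\<^sup>+x. ennreal (indicator S2 x * (\<bar>det (matrix (g2' x))\<bar> * f2 (g2 x))) \<partial>lborel)"
  proof (rule nn_integral_change_of_variables_wellorder)
    show "S2 \<in> sets borel"
      unfolding S2 using measurable_sets[OF measurable_wo(2) S] by simp
    show "inj_on g2 S2"
    proof (rule inj_onI)
      fix x y assume "x \<in> S2" "y \<in> S2" "g2 x = g2 y"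
      then show "x = y" using inj unfolding S2 g2_def inj_on_def
        by (metis from_to_wo vimageD)
    qed
    fix x assume "x \<in> S2"
    then have x: "from_wo x \<in> S" by (simp add: S2)
    have "(from_wo has_derivative from_wo) (at x within S2)" by (rule has_derivative_wo)
    moreover have "(g has_derivative g' (from_wo x)) (at (from_wo x) within from_wo ` S2)"
      using der[OF x] by (simp add: S2_def image_image)
    ultimately have "((\<lambda>y. g (from_wo y)) has_derivative (\<lambda>v. g' (from_wo x) (from_wo v))) (at x within S2)"
      by (rule has_derivative_in_compose)
    then show "(g2 has_derivative g2' x) (at x within S2)"
      unfolding g2_def[abs_def] g2'_def[abs_def]
      by (rule has_derivative_compose) (rule has_derivative_wo)
  next
    show "(\<lambda>y. indicator (g2 ` S2) y * f2 y) \<in> borel_measurable borel"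
      unfolding igS2 f2_def by (rule measurable_compose[OF measurable_wo(2) m1])
    show "(\<lambda>x. indicator S2 x * (\<bar>det (matrix (g2' x))\<bar> * f2 (g2 x))) \<in> borel_measurable borel"
      unfolding iS2 f2_def det2 g2_def from_to_wo by (rule measurable_compose[OF measurable_wo(2) m2])
  qed (simp add: f2_def f)
  also have "\<dots> = (\<integral>\<^sup>+x. ennreal (indicator S x * (\<bar>det (matrix (g' x))\<bar> * f (g x))) \<partial>lborel)"
    unfolding iS2 f2_def det2 g2_def from_to_wo by (rule nn_integral_to_wo) (use m2 in measurable)
  finally show ?thesis .
qed

section \<open>Matrices and coordinate expressions\<close>

lemma continuous_on_det:
  fixes A :: "'a::topological_space \<Rightarrow> real^'n::finite^'n"
  assumes "continuous_on S A" shows "continuous_on S (\<lambda>x. det (A x))"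
  unfolding det_def by (intro continuous_intros assms)

lemma posdef_invertible:
  fixes A :: "real^'n::finite^'n"
  assumes "\<And>v. v \<noteq> 0 \<Longrightarrow> v \<bullet> (A *v v) > 0"
  shows "invertible A"
proof -
  have "\<forall>x. A *v x = 0 \<longrightarrow> x = 0" using assms by force
  then show ?thesis
    using matrix_left_invertible_ker invertible_left_inverse by blast
qed

text \<open>On the segment from the identity to \<open>A\<close> all matrices are positive definite, hence
  invertible, so the determinant keeps the sign that it has at the identity.\<close>

lemma posdef_det_pos:
  fixes A :: "real^'n::finite^'n"
  assumes A: "\<And>v. v \<noteq> 0 \<Longrightarrow> v \<bullet> (A *v v) > 0"
  shows "det A > 0"
proof (rule ccontr)
  assume neg: "\<not> det A > 0"
  define B where "B t = (1 - t) *\<^sub>R mat 1 + t *\<^sub>R A" for t :: real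
  have Bv: "B t *v v = (1 - t) *\<^sub>R v + t *\<^sub>R (A *v v)" for t v
    unfolding B_def by (simp add: matrix_vector_mult_add_rdistrib scaleR_matrix_vector_assoc[symmetric])
  have "continuous_on {0..1} (\<lambda>t. det (B t))"
    unfolding B_def by (intro continuous_on_det continuous_intros)
  moreover have "B 0 = mat 1" "B 1 = A" by (simp_all add: B_def)
  ultimately obtain t where t: "0 \<le> t" "t \<le> 1" "det (B t) = 0"
    using IVT2'[of "\<lambda>t. det (B t)" 1 0 0] neg by (auto simp: det_I)
  have "v \<bullet> (B t *v v) > 0" if "v \<noteq> 0" for v
  proof -
    have "v \<bullet> (B t *v v) = (1 - t) * (v \<bullet> v) + t * (v \<bullet> (A *v v))"
      by (simp add: Bv inner_add_right)
    moreover have "(1 - t) * (v \<bullet> v) + t * (v \<bullet> (A *v v)) > 0"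
      using t A[OF that] that by (cases "t = 0") (auto intro!: add_nonneg_pos)
    ultimately show ?thesis by simp
  qed
  then have "invertible (B t)" by (rule posdef_invertible)
  then show False using t(3) invertible_det_nz by blast
qed

abbreviation cimg :: "('a, 'n) chart \<Rightarrow> (real^'n) set" where "cimg c \<equiv> cmap c ` cdom c"

text \<open>The inverse of the coordinate map as a total function. The constant value outside makes it
  Borel measurable.\<close>

definition cext :: "('a, 'n::finite) chart \<Rightarrow> real^'n \<Rightarrow> 'a"
  where "cext c y = (if y \<in> cimg c then cinv c y else undefined)"

text \<open>The volume density in coordinates. Its extension by zero lets integrals over the image of the
  chart run over the whole space.\<close>

definition vdens :: "('a, 'n::finite) riemannian \<Rightarrow> ('a, 'n) chart \<Rightarrow> real^'n \<Rightarrow> real"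
  where "vdens M c y = (if y \<in> cimg c then sqrt (det (metric M c (cinv c y))) else 0)"

text \<open>The part of the volume measure that lives on the domain of \<open>c\<close>
  (\<open>vol_chart\<close>).\<close>

definition chart_measure :: "('a::topological_space, 'n::finite) riemannian \<Rightarrow> ('a, 'n) chart \<Rightarrow> 'a measure"
  where "chart_measure M c = distr (density lborel (\<lambda>y. ennreal (vdens M c y))) borel (cext c)"

lemma egrad_cong:
  assumes "open S" "y \<in> S" "\<And>x. x \<in> S \<Longrightarrow> f x = g x" "f differentiable (at y)"
  shows "egrad f y = egrad g y" "g differentiable (at y)"
proof -
  have "(g has_derivative (\<lambda>v. egrad f y \<bullet> v)) (at y)"
    by (rule has_derivative_transform_within_open[OF egrad_has_derivative[OF assms(4)] assms(1,2,3)])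
  then show "egrad f y = egrad g y" "g differentiable (at y)"
    using egrad_eqI[of g _ y "egrad f y"] by (auto simp: differentiable_def)
qed

lemma inner_transpose_mult:
  fixes A :: "real^'n::finite^'m::finite"
  shows "x \<bullet> (transpose A *v y) = (A *v x) \<bullet> y"
  by (metis dot_lmul_matrix inner_commute vector_transpose_matrix transpose_transpose)

lemma matrix_inv_mult:
  fixes A :: "real^'n::finite^'n"
  assumes "invertible A" shows "matrix_inv A ** A = mat 1" "A ** matrix_inv A = mat 1"
proof -
  have "\<exists>A'. A ** A' = mat 1 \<and> A' ** A = mat 1" using assms by (simp add: invertible_def)
  then have "A ** matrix_inv A = mat 1 \<and> matrix_inv A ** A = mat 1"
    unfolding matrix_inv_def by (rule someI_ex)
  then show "matrix_inv A ** A = mat 1" "A ** matrix_inv A = mat 1" by auto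
qed

text \<open>Functions of class $C^1$ on the manifold, without a condition on the support.\<close>

definition mC1 :: "('a, 'n::finite) riemannian \<Rightarrow> ('a \<Rightarrow> real) \<Rightarrow> bool"
  where "mC1 M u \<longleftrightarrow> (\<forall>c\<in>charts M. Ck_on 1 (cimg c) (u \<circ> cinv c))"

lemma C0k_1_iff: "u \<in> C0k M 1 \<Omega> \<longleftrightarrow> compact_support_in \<Omega> u \<and> mC1 M u"
  by (auto simp: C0k_def mC1_def)

text \<open>Together with \<open>pull\<close>: passage between functions on the image of a chart and
  functions on the manifold, extending by zero.\<close>

definition lift :: "('a, 'n::finite) chart \<Rightarrow> (real^'n \<Rightarrow> real) \<Rightarrow> 'a \<Rightarrow> real"
  where "lift c f x = (if x \<in> cdom c then f (cmap c x) else 0)"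

definition pull :: "('a, 'n::finite) chart \<Rightarrow> ('a \<Rightarrow> real) \<Rightarrow> real^'n \<Rightarrow> real"
  where "pull c w y = (if y \<in> cimg c then w (cinv c y) else 0)"

lemma vector_field_onD:
  assumes "vector_field_on M S X" "c \<in> charts M" "d \<in> charts M" "x \<in> S" "x \<in> cdom c" "x \<in> cdom d"
  shows "X d x = jac c d x *v X c x"
  using assms unfolding vector_field_on_def by blast

lemma continuous_on_matrix_vector:
  fixes A :: "'a::topological_space \<Rightarrow> real^'n::finite^'m::finite"
  assumes "continuous_on S A" "continuous_on S v"
  shows "continuous_on S (\<lambda>x. A x *v v x)"
  unfolding matrix_vector_mult_def
  by (intro continuous_on_vec_lambda continuous_intros assms)

text \<open>Homogeneity reduces the two estimates to unit vectors, where the quadratic form attains a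
  positive minimum and the image vector is bounded.\<close>

lemma elliptic_bounds:
  fixes G :: "real^'n::finite \<Rightarrow> real^'n^'n"
  assumes K: "compact K" and G: "continuous_on K G"
    and pos: "\<And>y v. y \<in> K \<Longrightarrow> v \<noteq> 0 \<Longrightarrow> v \<bullet> (G y *v v) > 0"
  shows "\<exists>a>0. \<forall>y\<in>K. \<forall>v. norm v \<le> a * sqrt (v \<bullet> (G y *v v)) \<and> norm (G y *v v) \<le> a * sqrt (v \<bullet> (G y *v v))"
proof (cases "K = {}")
  case True
  then show ?thesis by (intro exI[of _ 1]) auto
next
  case False
  let ?S = "K \<times> sphere (0 :: real^'n) 1"
  have S: "compact ?S" using K by (intro compact_Times) auto
  obtain i :: 'n where True by simp
  have "axis i 1 \<in> sphere (0 :: real^'n) 1" by simp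
  then have ne: "?S \<noteq> {}" using False by blast
  have c1: "continuous_on ?S (\<lambda>z. G (fst z) *v snd z)"
    by (intro continuous_on_matrix_vector continuous_on_compose2[OF G continuous_on_fst[OF continuous_on_id]]
        continuous_on_snd[OF continuous_on_id]) auto
  have c2: "continuous_on ?S (\<lambda>z. snd z \<bullet> (G (fst z) *v snd z))"
    by (intro continuous_on_inner c1 continuous_on_snd[OF continuous_on_id])
  obtain z0 where z0: "z0 \<in> ?S" "\<And>z. z \<in> ?S \<Longrightarrow> snd z0 \<bullet> (G (fst z0) *v snd z0) \<le> snd z \<bullet> (G (fst z) *v snd z)"
    using continuous_attains_inf[OF S ne c2] by blast
  define m where "m = snd z0 \<bullet> (G (fst z0) *v snd z0)"
  have "snd z0 \<noteq> 0" using z0(1) by (auto simp: mem_Times_iff)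
  then have m: "m > 0" unfolding m_def using pos[of "fst z0"] z0(1) by (auto simp: mem_Times_iff)
  have "compact ((\<lambda>z. G (fst z) *v snd z) ` ?S)" by (rule compact_continuous_image[OF c1 S])
  then obtain N where "\<forall>v\<in>(\<lambda>z. G (fst z) *v snd z) ` ?S. norm v \<le> N"
    using compact_imp_bounded bounded_iff by meson
  then have N: "\<And>z. z \<in> ?S \<Longrightarrow> norm (G (fst z) *v snd z) \<le> N" by blast
  define a where "a = max 1 N / sqrt m"
  have a: "a > 0" using m by (simp add: a_def)
  have "norm v \<le> a * sqrt (v \<bullet> (G y *v v)) \<and> norm (G y *v v) \<le> a * sqrt (v \<bullet> (G y *v v))" if y: "y \<in> K" for y v
  proof (cases "v = 0")
    case False
    define u where "u = (1 / norm v) *\<^sub>R v"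
    have u: "(y, u) \<in> ?S" using y False by (simp add: u_def)
    have v: "v = norm v *\<^sub>R u" using False by (simp add: u_def)
    have Gv: "G y *v v = norm v *\<^sub>R (G y *v u)" by (subst v) (simp only: matrix_vector_mult_scaleR)
    have "norm (G y *v v) = norm v * norm (G y *v u)" unfolding Gv by simp
    also have "\<dots> \<le> norm v * max 1 N" using N[OF u] by (intro mult_left_mono) auto
    finally have 1: "norm (G y *v v) \<le> max 1 N * norm v" by (simp add: mult.commute)
    have "v \<bullet> (G y *v v) = (norm v)\<^sup>2 * (u \<bullet> (G y *v u))"
      unfolding Gv by (subst v) (simp add: power2_eq_square)
    also have "\<dots> \<ge> (norm v)\<^sup>2 * m" using z0(2)[OF u] by (intro mult_left_mono) (auto simp: m_def)
    finally have "sqrt ((norm v)\<^sup>2 * m) \<le> sqrt (v \<bullet> (G y *v v))" by (rule real_sqrt_le_mono)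
    then have 2: "norm v * sqrt m \<le> sqrt (v \<bullet> (G y *v v))" by (simp add: real_sqrt_mult)
    have 3: "max 1 N * norm v \<le> a * sqrt (v \<bullet> (G y *v v))"
    proof -
      have "max 1 N * norm v = a * (norm v * sqrt m)" using m by (simp add: a_def)
      also have "\<dots> \<le> a * sqrt (v \<bullet> (G y *v v))" using a by (intro mult_left_mono 2) auto
      finally show ?thesis .
    qed
    have "norm v \<le> max 1 N * norm v" by (simp add: mult_le_cancel_right1)
    then show ?thesis using 1 3 by linarith
  qed simp
  then show ?thesis using a by blast
qed

lemma compact_finite_cover:
  assumes "compact K" "\<And>x. x \<in> K \<Longrightarrow> open (N x)" "\<And>x. x \<in> K \<Longrightarrow> x \<in> N x"
  shows "\<exists>D\<subseteq>K. finite D \<and> K \<subseteq> (\<Union>x\<in>D. N x)"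
proof -
  have "K \<subseteq> (\<Union>x\<in>K. N x)" using assms(3) by blast
  from compactE_image[OF assms(1,2) this] show ?thesis by metis
qed

text \<open>Makes $|u|^p$ a $C^1$ weight for every $C^1$ function $u$, also where $u$ changes sign; that
  \<open>p > 1\<close> is what makes the derivative vanish, and be continuous, at 0.\<close>

lemma abs_powr_derivative:
  fixes p :: real
  assumes p: "p > 1"
  shows "((\<lambda>t::real. \<bar>t\<bar> powr p) has_real_derivative p * \<bar>t\<bar> powr (p - 1) * sgn t) (at t)"
    and "continuous_on UNIV (\<lambda>t::real. p * \<bar>t\<bar> powr (p - 1) * sgn t)"
proof -
  show "((\<lambda>t::real. \<bar>t\<bar> powr p) has_real_derivative p * \<bar>t\<bar> powr (p - 1) * sgn t) (at t)"
  proof -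
    consider "t > 0" | "t < 0" | "t = 0" by linarith
    then show ?thesis
    proof cases
      case 1
      have "((\<lambda>t. t powr p) has_real_derivative p * t powr (p - 1)) (at t)" using 1 by (rule has_real_derivative_powr)
      then have "((\<lambda>t. \<bar>t\<bar> powr p) has_real_derivative p * t powr (p - 1)) (at t)"
        by (rule has_field_derivative_transform_within_open[of _ _ _ "{0<..}"]) (use 1 in auto)
      then show ?thesis using 1 by simp
    next
      case 2
      have "((\<lambda>t. (- t) powr p) has_real_derivative (p * (- t) powr (p - 1)) * (-1)) (at t)"
        by (rule DERIV_chain2[OF has_real_derivative_powr]) (use 2 in \<open>auto intro!: derivative_eq_intros\<close>)
      then have "((\<lambda>t. \<bar>t\<bar> powr p) has_real_derivative (p * (- t) powr (p - 1)) * (-1)) (at t)"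
        by (rule has_field_derivative_transform_within_open[of _ _ _ "{..<0}"]) (use 2 in auto)
      then show ?thesis using 2 by simp
    next
      case 3
      have "((\<lambda>h. (\<bar>0 + h\<bar> powr p - \<bar>0\<bar> powr p) / h) \<longlongrightarrow> 0) (at 0)"
      proof (rule Lim_null_comparison)
        have "norm ((\<bar>0 + h\<bar> powr p - \<bar>0\<bar> powr p) / h) \<le> \<bar>h\<bar> powr (p - 1)" if "h \<noteq> 0" for h :: real
          using that by (simp add: powr_diff)
        then show "\<forall>\<^sub>F h in at 0. norm ((\<bar>0 + h\<bar> powr p - \<bar>0\<bar> powr p) / h) \<le> \<bar>h\<bar> powr (p - 1)"
          by (auto simp: eventually_at_filter)
        have "((\<lambda>h::real. \<bar>h\<bar> powr (p - 1)) \<longlongrightarrow> \<bar>0\<bar> powr (p - 1)) (at 0)"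
          by (rule tendsto_powr2) (use p in \<open>auto intro!: tendsto_eq_intros\<close>)
        then show "((\<lambda>h::real. \<bar>h\<bar> powr (p - 1)) \<longlongrightarrow> 0) (at 0)" using p by simp
      qed
      then show ?thesis using 3 by (simp add: DERIV_def)
    qed
  qed
  have "isCont (\<lambda>t::real. p * \<bar>t\<bar> powr (p - 1) * sgn t) t" for t
  proof (cases "t = 0")
    case True
    have "((\<lambda>t::real. p * \<bar>t\<bar> powr (p - 1) * sgn t) \<longlongrightarrow> 0) (at 0)"
    proof (rule Lim_null_comparison)
      show "\<forall>\<^sub>F t in at 0. norm (p * \<bar>t\<bar> powr (p - 1) * sgn t) \<le> p * \<bar>t\<bar> powr (p - 1)" for t
        using p by (intro always_eventually allI) (auto simp: abs_mult sgn_real_def)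
      have "((\<lambda>h::real. \<bar>h\<bar> powr (p - 1)) \<longlongrightarrow> \<bar>0\<bar> powr (p - 1)) (at 0)"
        by (rule tendsto_powr2) (use p in \<open>auto intro!: tendsto_eq_intros\<close>)
      then show "((\<lambda>t::real. p * \<bar>t\<bar> powr (p - 1)) \<longlongrightarrow> 0) (at 0)"
        using p by (intro tendsto_mult_right_zero) simp
    qed
    then show ?thesis using True by (simp add: isCont_def)
  next
    case False
    then show ?thesis unfolding isCont_def by (intro tendsto_intros) auto
  qed
  then show "continuous_on UNIV (\<lambda>t::real. p * \<bar>t\<bar> powr (p - 1) * sgn t)"
    by (simp add: continuous_at_imp_continuous_on)
qed

text \<open>The quotients regularized by $1/(n+1)$ also recover the conventions \<open>a / 0 =
  \<infinity>\<close> and \<open>0 / 0 = 0\<close> in the limit: for \<open>r = 0\<close> they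
  vanish identically or tend to infinity.\<close>

lemma quotient_le_liminf:
  fixes a g r p :: real
  assumes "p > 1" "0 \<le> a" "0 \<le> g" "0 \<le> r"
  shows "ennreal (a powr p) / ennreal (r powr p) * ennreal (g powr p) \<le>
    liminf (\<lambda>n. ennreal ((a * g / (r + inverse (real (Suc n)))) powr p))"
proof (cases "r = 0")
  case False
  then have r: "r > 0" using assms by simp
  have "(\<lambda>n. (a * g / (r + inverse (real (Suc n)))) powr p) \<longlonglongrightarrow> (a * g / (r + 0)) powr p"
  proof (rule tendsto_powr2[OF _ tendsto_const])
    have "(\<lambda>n. r + inverse (real (Suc n))) \<longlonglongrightarrow> r + 0"
      by (rule tendsto_add[OF tendsto_const LIMSEQ_inverse_real_of_nat])
    then show "(\<lambda>n. a * g / (r + inverse (real (Suc n)))) \<longlonglongrightarrow> a * g / (r + 0)"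
      by (rule tendsto_divide[OF tendsto_const]) (use r in simp)
    show "\<forall>\<^sub>F n in sequentially. 0 \<le> a * g / (r + inverse (real (Suc n)))"
      using assms r by (intro always_eventually allI divide_nonneg_nonneg mult_nonneg_nonneg add_nonneg_nonneg) auto
  qed (use assms in simp)
  then have "(\<lambda>n. ennreal ((a * g / (r + inverse (real (Suc n)))) powr p)) \<longlonglongrightarrow> ennreal ((a * g / (r + 0)) powr p)"
    by (rule tendsto_ennrealI)
  then have "liminf (\<lambda>n. ennreal ((a * g / (r + inverse (real (Suc n)))) powr p)) = ennreal ((a * g / (r + 0)) powr p)"
    by (rule lim_imp_Liminf[OF sequentially_bot])
  also have "\<dots> = ennreal (a powr p) / ennreal (r powr p) * ennreal (g powr p)"
    using assms r by (simp add: divide_ennreal ennreal_mult[symmetric] powr_divide powr_mult)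
  finally show ?thesis by simp
next
  case r: True
  show ?thesis
  proof (cases "a = 0 \<or> g = 0")
    case True
    then show ?thesis by auto
  next
    case False
    then have ag: "a * g > 0" using assms by simp
    have "(\<lambda>n. (a * g / (r + inverse (real (Suc n)))) powr p) = (\<lambda>n. (a * g) powr p * real (Suc n) powr p)"
      using ag assms by (auto simp: r divide_inverse powr_mult simp del: of_nat_Suc)
    moreover have "filterlim (\<lambda>n. (a * g) powr p * real (Suc n) powr p) at_top sequentially"
    proof (rule filterlim_tendsto_pos_mult_at_top[OF tendsto_const])
      show "0 < (a * g) powr p" using ag by (metis less_irrefl powr_gt_zero)
      have "filterlim (\<lambda>n. real (Suc n)) at_top sequentially"
        using filterlim_real_sequentially by (subst filterlim_sequentially_Suc)
      moreover have "real (Suc n) \<le> real (Suc n) powr p" for n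
        using powr_mono[of 1 p "real (Suc n)"] assms(1) by simp
      ultimately show "filterlim (\<lambda>n. real (Suc n) powr p) at_top sequentially"
        by (rule filterlim_at_top_mono[OF _ always_eventually, rule_format])
    qed
    ultimately have "(\<lambda>n. ennreal ((a * g / (r + inverse (real (Suc n)))) powr p)) \<longlonglongrightarrow> top"
      by (simp add: ennreal_tendsto_top_eq_at_top)
    then have "liminf (\<lambda>n. ennreal ((a * g / (r + inverse (real (Suc n)))) powr p)) = top"
      by (rule lim_imp_Liminf[OF sequentially_bot])
    then show ?thesis by simp
  qed
qed

context
  fixes M :: "('a::{t2_space, second_countable_topology}, 'n::finite) riemannian"
  assumes riem: "riemannian_manifold M"
begin

section \<open>The volume measure\<close>

lemma chart_coordinates:
  assumes "c \<in> charts M"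
  shows "open (cdom c)" "open (cimg c)" "continuous_on (cdom c) (cmap c)" "continuous_on (cimg c) (cinv c)"
    "\<And>x. x \<in> cdom c \<Longrightarrow> cinv c (cmap c x) = x" "\<And>y. y \<in> cimg c \<Longrightarrow> cmap c (cinv c y) = y"
    "\<And>y. y \<in> cimg c \<Longrightarrow> cinv c y \<in> cdom c"
    "\<And>x. x \<in> cdom c \<Longrightarrow> cext c (cmap c x) = x" "\<And>y. y \<in> cimg c \<Longrightarrow> cmap c (cext c y) = y"
    "\<And>y. y \<in> cimg c \<Longrightarrow> cext c y \<in> cdom c"
    "inj_on (cmap c) (cdom c)"
proof -
  have ch: "is_chart c" using riem assms by (auto simp: riemannian_manifold_def smooth_atlas_def)
  then have h: "homeomorphism (cdom c) (cimg c) (cmap c) (cinv c)" by (simp add: is_chart_def)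
  show "open (cdom c)" "open (cimg c)" using ch by (auto simp: is_chart_def)
  show "continuous_on (cdom c) (cmap c)" "continuous_on (cimg c) (cinv c)"
    using h by (auto simp: homeomorphism_def)
  show 1: "\<And>x. x \<in> cdom c \<Longrightarrow> cinv c (cmap c x) = x" and 2: "\<And>y. y \<in> cimg c \<Longrightarrow> cmap c (cinv c y) = y"
    using h by (auto simp: homeomorphism_def)
  show 3: "\<And>y. y \<in> cimg c \<Longrightarrow> cinv c y \<in> cdom c" using 1 by auto
  show "\<And>x. x \<in> cdom c \<Longrightarrow> cext c (cmap c x) = x" "\<And>y. y \<in> cimg c \<Longrightarrow> cmap c (cext c y) = y"
    "\<And>y. y \<in> cimg c \<Longrightarrow> cext c y \<in> cdom c"
    using 1 2 3 by (auto simp: cext_def)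
  show "inj_on (cmap c) (cdom c)" using 1 by (metis inj_onI)
qed

lemma charts_cover: "\<exists>c\<in>charts M. x \<in> cdom c"
proof -
  have "(\<Union>c\<in>charts M. cdom c) = UNIV" using riem by (simp add: riemannian_manifold_def smooth_atlas_def)
  then show ?thesis by blast
qed

lemma metric_symmetric_posdef:
  assumes "c \<in> charts M" "x \<in> cdom c"
  shows "transpose (metric M c x) = metric M c x" "v \<noteq> 0 \<Longrightarrow> v \<bullet> (metric M c x *v v) > 0"
  using riem assms unfolding riemannian_manifold_def by blast+

lemma metric_continuous:
  assumes "c \<in> charts M" shows "continuous_on (cimg c) (\<lambda>y. metric M c (cinv c y))"
proof -
  have "smooth_on (cimg c) (\<lambda>y. metric M c (cinv c y))"
    using riem assms by (auto simp: riemannian_manifold_def)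
  then have "Ck_on 0 (cimg c) (\<lambda>y. metric M c (cinv c y))" unfolding smooth_on_def by blast
  then show ?thesis by simp
qed

lemma metric_transform:
  assumes "c \<in> charts M" "d \<in> charts M" "x \<in> cdom c" "x \<in> cdom d"
  shows "metric M c x = transpose (jac c d x) ** metric M d x ** jac c d x"
  using riem assms unfolding riemannian_manifold_def by blast

lemma chart_image_open:
  assumes "c \<in> charts M" "open U"
  shows "open (cmap c ` (cdom c \<inter> U))"
proof -
  have "cmap c ` (cdom c \<inter> U) = cinv c -` U \<inter> cimg c"
    using chart_coordinates[OF assms(1)] by force
  moreover have "open (cinv c -` U \<inter> cimg c)"
    using chart_coordinates(2,4)[OF assms(1)] assms(2) continuous_on_open_vimage by blast
  ultimately show ?thesis by simp
qed

lemma transition_C1: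
  assumes "c \<in> charts M" "d \<in> charts M"
  shows "Ck_on 1 (cmap c ` (cdom c \<inter> cdom d)) (cmap d \<circ> cinv c)"
proof -
  have "smooth_on (cmap c ` (cdom c \<inter> cdom d)) (cmap d \<circ> cinv c)"
    using riem assms by (auto simp: riemannian_manifold_def smooth_atlas_def)
  then show ?thesis unfolding smooth_on_def by blast
qed

lemma transition_derivative:
  assumes "c \<in> charts M" "d \<in> charts M" "x \<in> cdom c" "x \<in> cdom d"
  shows "((cmap d \<circ> cinv c) has_derivative (\<lambda>v. jac c d x *v v)) (at (cmap c x))"
proof -
  have d: "((cmap d \<circ> cinv c) has_derivative frechet_derivative (cmap d \<circ> cinv c) (at (cmap c x))) (at (cmap c x))"
    by (rule C1_D(1)[OF transition_C1[OF assms(1,2)]]) (use assms in auto)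
  then show ?thesis
    unfolding jac_def
    using matrix_works[of "frechet_derivative (cmap d \<circ> cinv c) (at (cmap c x))"] has_derivative_linear[OF d]
    by (simp add: linear_matrix_vector_mul_eq)
qed

lemma vdens_nonneg: "c \<in> charts M \<Longrightarrow> 0 \<le> vdens M c y"
  using posdef_det_pos[OF metric_symmetric_posdef(2), of c "cinv c y"] chart_coordinates(7)[of c y]
  by (auto simp: vdens_def intro: less_imp_le)

lemma vdens_pos: "c \<in> charts M \<Longrightarrow> y \<in> cimg c \<Longrightarrow> 0 < vdens M c y"
  using posdef_det_pos[OF metric_symmetric_posdef(2), of c "cinv c y"] chart_coordinates(7)[of c y]
  by (auto simp: vdens_def)

lemma vdens_continuous: "c \<in> charts M \<Longrightarrow> continuous_on (cimg c) (vdens M c)"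
proof -
  assume c: "c \<in> charts M"
  have "continuous_on (cimg c) (\<lambda>y. sqrt (det (metric M c (cinv c y))))"
    by (intro continuous_on_real_sqrt continuous_on_det metric_continuous c)
  then show ?thesis by (simp add: vdens_def cong: continuous_on_cong)
qed

lemma vdens_measurable: "c \<in> charts M \<Longrightarrow> vdens M c \<in> borel_measurable borel"
  unfolding vdens_def[abs_def]
  using chart_coordinates(2)
  by (intro borel_measurable_continuous_on_if continuous_on_real_sqrt continuous_on_det metric_continuous continuous_on_const)
    auto

lemma cext_measurable: "c \<in> charts M \<Longrightarrow> cext c \<in> borel_measurable borel"
  unfolding cext_def[abs_def]
  using chart_coordinates(2,4) by (intro borel_measurable_continuous_on_if continuous_on_const) auto

lemma chart_image_borel:
  assumes "c \<in> charts M" "B \<in> sets borel" "B \<subseteq> cdom c"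
  shows "cmap c ` B \<in> sets borel"
proof -
  have "cmap c ` B = cext c -` B \<inter> cimg c"
    using chart_coordinates[OF assms(1)] assms(3) by force
  moreover have "cext c -` B \<in> sets borel"
    using measurable_sets[OF cext_measurable[OF assms(1)] assms(2)] by simp
  ultimately show ?thesis using chart_coordinates(2)[OF assms(1)] by auto
qed

lemma vdens_transform:
  assumes "c \<in> charts M" "d \<in> charts M" "x \<in> cdom c" "x \<in> cdom d"
  shows "vdens M c (cmap c x) = \<bar>det (jac c d x)\<bar> * vdens M d (cmap d x)"
proof -
  have "det (metric M c x) = (det (jac c d x))\<^sup>2 * det (metric M d x)"
    unfolding metric_transform[OF assms] by (simp add: det_mul power2_eq_square)
  then show ?thesis
    using assms chart_coordinates(5)[of c x] chart_coordinates(5)[of d x] by (simp add: vdens_def real_sqrt_mult)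
qed

lemma chart_measure_sets: "sets (chart_measure M c) = sets borel"
  by (simp add: chart_measure_def)

lemma emeasure_chart_measure:
  assumes "c \<in> charts M" "B \<in> sets borel" "B \<subseteq> cdom c"
  shows "emeasure (chart_measure M c) B = (\<integral>\<^sup>+y. ennreal (indicator (cmap c ` B) y * vdens M c y) \<partial>lborel)"
proof -
  note m = vdens_measurable[OF assms(1)] cext_measurable[OF assms(1)]
  have s: "cext c -` B \<in> sets borel"
    using measurable_sets[OF m(2) assms(2)] by simp
  have "emeasure (chart_measure M c) B = (\<integral>\<^sup>+y. ennreal (vdens M c y) * indicator (cext c -` B) y \<partial>lborel)"
    unfolding chart_measure_def using m assms(2) s by (simp add: emeasure_distr emeasure_density)
  also have "\<dots> = (\<integral>\<^sup>+y. ennreal (indicator (cmap c ` B) y * vdens M c y) \<partial>lborel)"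
  proof (rule nn_integral_cong)
    fix y
    show "ennreal (vdens M c y) * indicator (cext c -` B) y = ennreal (indicator (cmap c ` B) y * vdens M c y)"
    proof (cases "y \<in> cimg c")
      case True
      have "y \<in> cmap c ` B \<longleftrightarrow> cext c y \<in> B"
      proof
        assume "y \<in> cmap c ` B"
        then obtain x where "x \<in> B" "y = cmap c x" by blast
        then show "cext c y \<in> B" using chart_coordinates(8)[OF assms(1), of x] assms(3) by auto
      next
        assume "cext c y \<in> B"
        moreover have "y = cmap c (cext c y)" using chart_coordinates(9)[OF assms(1) True] by simp
        ultimately show "y \<in> cmap c ` B" by (rule rev_image_eqI)
      qed
      then show ?thesis by (auto simp: indicator_def)
    next
      case False
      then show ?thesis by (simp add: vdens_def)
    qed
  qed
  finally show ?thesis .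
qed

text \<open>The change of variables formula for the transition map. By the transformation law of the
  metric, the absolute value of its Jacobian determinant is exactly the quotient of the two
  densities (\<open>vdens_transform\<close>).\<close>

lemma chart_measure_compatible:
  assumes c: "c \<in> charts M" and d: "d \<in> charts M" and B: "B \<in> sets borel" "B \<subseteq> cdom c" "B \<subseteq> cdom d"
  shows "emeasure (chart_measure M c) B = emeasure (chart_measure M d) B"
proof -
  define S where "S = cmap c ` B"
  define g where "g = cmap d \<circ> cinv c"
  define g' where "g' y = (\<lambda>v. jac c d (cinv c y) *v v)" for y
  have S: "S \<in> sets borel" unfolding S_def by (rule chart_image_borel[OF c B(1,2)])
  have inv: "cinv c y \<in> B" if "y \<in> S" for y
    using that B chart_coordinates(5)[OF c] by (auto simp: S_def)
  have gS: "g ` S = cmap d ` B"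
    unfolding S_def g_def image_comp o_def using chart_coordinates(5)[OF c] B(2) by (auto simp: image_iff) (metis subsetD)+
  have gSb: "cmap d ` B \<in> sets borel" by (rule chart_image_borel[OF d B(1,3)])
  have eq: "indicator S y * (\<bar>det (matrix (g' y))\<bar> * vdens M d (g y)) = indicator S y * vdens M c y" for y
  proof (cases "y \<in> S")
    case True
    have x: "cinv c y \<in> B" using inv True .
    have y: "cmap c (cinv c y) = y" using chart_coordinates(6)[OF c] True B(2) by (auto simp: S_def)
    have "matrix (g' y) = jac c d (cinv c y)" unfolding g'_def by (simp add: matrix_of_matrix_vector_mul)
    then show ?thesis
      using vdens_transform[OF c d subsetD[OF B(2) x] subsetD[OF B(3) x]] y by (simp add: g_def)
  qed auto
  have "emeasure (chart_measure M d) B = (\<integral>\<^sup>+y. ennreal (indicator (g ` S) y * vdens M d y) \<partial>lborel)"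
    unfolding gS by (rule emeasure_chart_measure[OF d B(1,3)])
  also have "\<dots> = (\<integral>\<^sup>+y. ennreal (indicator S y * (\<bar>det (matrix (g' y))\<bar> * vdens M d (g y))) \<partial>lborel)"
  proof (rule nn_integral_change_of_variables[OF S])
    show "inj_on g S"
    proof (rule inj_onI)
      fix y z assume yz: "y \<in> S" "z \<in> S" "g y = g z"
      then have "cinv c y = cinv c z"
        using chart_coordinates(11)[OF d] inv B(3) by (auto simp: g_def inj_on_def)
      then show "y = z" using chart_coordinates(6)[OF c] yz(1,2) B(2) unfolding S_def by (metis image_mono subsetD)
    qed
    show "(\<lambda>y. indicator (g ` S) y * vdens M d y) \<in> borel_measurable borel"
      unfolding gS using gSb vdens_measurable[OF d] by measurable
    show "(\<lambda>y. indicator S y * (\<bar>det (matrix (g' y))\<bar> * vdens M d (g y))) \<in> borel_measurable borel"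
      unfolding eq using S vdens_measurable[OF c] by measurable
    fix y assume y: "y \<in> S"
    have x: "cinv c y \<in> B" using inv y .
    have "cmap c (cinv c y) = y" using chart_coordinates(6)[OF c] y B(2) by (auto simp: S_def)
    then show "(g has_derivative g' y) (at y within S)"
      using transition_derivative[OF c d, of "cinv c y"] x B
      unfolding g_def g'_def by (auto intro: has_derivative_at_withinI)
  qed (rule vdens_nonneg[OF d])
  also have "\<dots> = emeasure (chart_measure M c) B"
    unfolding eq emeasure_chart_measure[OF c B(1,2)] by (simp add: S_def)
  finally show ?thesis by simp
qed

lemma countable_charts:
  "\<exists>C :: nat \<Rightarrow> ('a, 'n) chart. (\<forall>n. C n \<in> charts M) \<and> (\<Union>n. cdom (C n)) = UNIV"
proof -
  obtain F where F: "F \<subseteq> cdom ` charts M" "countable F" "\<Union>F = \<Union>(cdom ` charts M)"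
    using Lindelof[of "cdom ` charts M"] chart_coordinates(1) by blast
  have U: "\<Union>F = UNIV" using F(3) charts_cover by auto
  then have "F \<noteq> {}" by auto
  then obtain D :: "nat \<Rightarrow> 'a set" where D: "range D = F"
    using range_from_nat_into[of F] F(2) by blast
  have "\<forall>n. \<exists>c. c \<in> charts M \<and> cdom c = D n" using D F(1) by blast
  then obtain C where "\<And>n. C n \<in> charts M \<and> cdom (C n) = D n" by metis
  then show ?thesis using U D by (intro exI[of _ C]) auto
qed

text \<open>By second countability countably many charts cover the manifold; cutting each domain by the
  previous ones gives disjoint Borel pieces.\<close>

lemma borel_chart_partition:
  "\<exists>C A. (\<forall>n::nat. C n \<in> charts M) \<and> (\<forall>n. A n \<in> sets borel) \<and> (\<forall>n. A n \<subseteq> cdom (C n)) \<and>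
     disjoint_family A \<and> (\<Union>n. A n) = UNIV"
proof -
  obtain C where C: "\<forall>n::nat. C n \<in> charts M" "(\<Union>n. cdom (C n)) = UNIV"
    using countable_charts by auto
  define A where "A = disjointed (\<lambda>n. cdom (C n))"
  have "range (\<lambda>n. cdom (C n)) \<subseteq> sets borel" using chart_coordinates(1)[OF C(1)[rule_format]] by auto
  then have "A n \<in> sets borel" for n
    using sets.range_disjointed_sets unfolding A_def by blast
  moreover have "A n \<subseteq> cdom (C n)" for n unfolding A_def by (rule disjointed_subset)
  moreover have "disjoint_family A" unfolding A_def by (rule disjoint_family_disjointed)
  moreover have "(\<Union>n. A n) = UNIV" unfolding A_def UN_disjointed_eq by (rule C(2))
  ultimately show ?thesis using C(1) by blast
qed

lemma is_volume_iff:
  "is_volume M \<mu> \<longleftrightarrow> sets \<mu> = sets borel \<and>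
    (\<forall>c\<in>charts M. \<forall>B\<in>sets borel. B \<subseteq> cdom c \<longrightarrow> emeasure \<mu> B = emeasure (chart_measure M c) B)"
proof -
  have "(\<integral>\<^sup>+y\<in>cmap c ` B. ennreal (sqrt (det (metric M c (cinv c y)))) \<partial>lborel) = emeasure (chart_measure M c) B"
    if "c \<in> charts M" "B \<in> sets borel" "B \<subseteq> cdom c" for c B
    unfolding emeasure_chart_measure[OF that]
    by (rule nn_integral_cong) (use that(3) in \<open>auto simp: indicator_def vdens_def\<close>)
  then show ?thesis unfolding is_volume_def by auto
qed

lemma is_volume_unique:
  assumes "is_volume M \<mu>" "is_volume M \<nu>" shows "\<mu> = \<nu>"
proof -
  obtain C A :: "nat \<Rightarrow> _" where C: "\<And>n. C n \<in> charts M"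
    and A: "\<And>n. A n \<in> sets borel" "\<And>n. A n \<subseteq> cdom (C n)" "disjoint_family A" "(\<Union>n. A n) = UNIV"
    using borel_chart_partition by metis
  show ?thesis
  proof (rule measure_eqI)
    show "sets \<mu> = sets \<nu>" using assms by (simp add: is_volume_def)
    fix B assume "B \<in> sets \<mu>"
    then have B: "B \<in> sets borel" using assms by (simp add: is_volume_def)
    have "emeasure \<kappa> B = (\<Sum>n. emeasure (chart_measure M (C n)) (B \<inter> A n))" if "is_volume M \<kappa>" for \<kappa>
    proof -
      have s: "sets \<kappa> = sets borel" using that by (simp add: is_volume_def)
      have "emeasure \<kappa> B = emeasure \<kappa> (\<Union>n. B \<inter> A n)"
        using A(4) by (intro arg_cong[where f="emeasure \<kappa>"]) auto
      also have "\<dots> = (\<Sum>n. emeasure \<kappa> (B \<inter> A n))"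
        by (rule suminf_emeasure[symmetric]) (use A(1) B s disjoint_family_subset[OF A(3) Int_lower2] in auto)
      also have "\<dots> = (\<Sum>n. emeasure (chart_measure M (C n)) (B \<inter> A n))"
      proof (rule suminf_cong)
        fix n
        have "B \<inter> A n \<in> sets borel" "B \<inter> A n \<subseteq> cdom (C n)" using A(1,2)[of n] B by auto
        then show "emeasure \<kappa> (B \<inter> A n) = emeasure (chart_measure M (C n)) (B \<inter> A n)"
          using that C[of n] unfolding is_volume_iff by blast
      qed
      finally show ?thesis .
    qed
    then show "emeasure \<mu> B = emeasure \<nu> B" using assms by simp
  qed
qed

text \<open>Sum the chart measures over such a partition. Compatibility on overlaps shows that, inside any
  chart, the result is the measure of that chart.\<close>

lemma is_volume_exists: "\<exists>\<mu>. is_volume M \<mu>"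
proof -
  obtain C A :: "nat \<Rightarrow> _" where C: "\<And>n. C n \<in> charts M"
    and A: "\<And>n. A n \<in> sets borel" "\<And>n. A n \<subseteq> cdom (C n)" "disjoint_family A" "(\<Union>n. A n) = UNIV"
    using borel_chart_partition by metis
  define m where "m B = (\<integral>\<^sup>+n. emeasure (chart_measure M (C n)) (B \<inter> A n) \<partial>count_space UNIV)" for B
  define \<mu> where "\<mu> = measure_of UNIV (sets borel) m"
  have sets: "sets \<mu> = sets borel" unfolding \<mu>_def
    using sets.sigma_sets_eq[of "borel :: 'a measure"] by (simp add: sets_measure_of)
  have em: "emeasure \<mu> B = m B" if B: "B \<in> sets borel" for B
    unfolding \<mu>_def
  proof (rule emeasure_measure_of_sigma[OF _ _ _ B])
    show "sigma_algebra UNIV (sets (borel :: 'a measure))"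
      using sets.sigma_algebra_axioms[of "borel :: 'a measure"] by simp
    show "positive (sets borel) m" by (simp add: positive_def m_def)
    show "countably_additive (sets borel) m"
      unfolding countably_additive_def
    proof (intro allI impI)
      fix B :: "nat \<Rightarrow> 'a set" assume B: "range B \<subseteq> sets borel" "disjoint_family B"
      have "(\<Sum>i. m (B i)) = (\<integral>\<^sup>+n. (\<Sum>i. emeasure (chart_measure M (C n)) (B i \<inter> A n)) \<partial>count_space UNIV)"
        unfolding m_def by (rule nn_integral_suminf[symmetric]) simp
      also have "\<dots> = m (\<Union>i. B i)"
        unfolding m_def
      proof (rule nn_integral_cong)
        fix n
        have "(\<Sum>i. emeasure (chart_measure M (C n)) (B i \<inter> A n)) = emeasure (chart_measure M (C n)) (\<Union>i. B i \<inter> A n)"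
        proof (rule suminf_emeasure)
          show "range (\<lambda>i. B i \<inter> A n) \<subseteq> sets (chart_measure M (C n))"
            unfolding chart_measure_sets using A(1)[of n] B(1) by blast
          show "disjoint_family (\<lambda>i. B i \<inter> A n)"
            by (rule disjoint_family_subset[OF B(2)]) (rule Int_lower1)
        qed
        moreover have "(\<Union>i. B i \<inter> A n) = (\<Union>i. B i) \<inter> A n" by auto
        ultimately show "(\<Sum>i. emeasure (chart_measure M (C n)) (B i \<inter> A n)) = emeasure (chart_measure M (C n)) ((\<Union>i. B i) \<inter> A n)"
          by simp
      qed
      finally show "(\<Sum>i. m (B i)) = m (\<Union> (range B))" .
    qed
  qed
  have "emeasure \<mu> B = emeasure (chart_measure M c) B"
    if c: "c \<in> charts M" and B: "B \<in> sets borel" "B \<subseteq> cdom c" for c B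
  proof -
    have "emeasure \<mu> B = (\<integral>\<^sup>+n. emeasure (chart_measure M c) (B \<inter> A n) \<partial>count_space UNIV)"
      unfolding em[OF B(1)] m_def
      by (intro nn_integral_cong chart_measure_compatible) (use A B C c in auto)
    also have "\<dots> = (\<Sum>n. emeasure (chart_measure M c) (B \<inter> A n))"
      by (rule nn_integral_count_space_nat)
    also have "\<dots> = emeasure (chart_measure M c) (\<Union>n. B \<inter> A n)"
      by (rule suminf_emeasure)
        (use A(1) B(1) disjoint_family_subset[OF A(3) Int_lower2] in \<open>auto simp: chart_measure_sets\<close>)
    also have "(\<Union>n. B \<inter> A n) = B" using A(4) by auto
    finally show ?thesis .
  qed
  then have "is_volume M \<mu>" unfolding is_volume_iff using sets by auto
  then show ?thesis by blast
qed

lemma vol_is_volume: "is_volume M (vol M)"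
  unfolding vol_def using is_volume_exists is_volume_unique by (metis theI')

lemma sets_vol [measurable_cong]: "sets (vol M) = sets borel"
  using vol_is_volume by (simp add: is_volume_def)

lemma vol_chart:
  assumes c: "c \<in> charts M"
  shows "density (vol M) (indicator (cdom c)) = chart_measure M c"
proof (rule measure_eqI)
  have oc: "cdom c \<in> sets borel" using chart_coordinates(1)[OF c] by auto
  show "sets (density (vol M) (indicator (cdom c))) = sets (chart_measure M c)"
    by (simp add: chart_measure_sets sets_vol)
  fix B assume "B \<in> sets (density (vol M) (indicator (cdom c)))"
  then have B: "B \<in> sets borel" by (simp add: sets_vol)
  have "emeasure (density (vol M) (indicator (cdom c))) B = emeasure (vol M) (B \<inter> cdom c)"
  proof -
    have "emeasure (density (vol M) (indicator (cdom c))) B = (\<integral>\<^sup>+x. indicator (cdom c) x * indicator B x \<partial>vol M)"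
      using B oc by (subst emeasure_density) (auto simp: sets_vol)
    also have "\<dots> = (\<integral>\<^sup>+x. indicator (B \<inter> cdom c) x \<partial>vol M)"
      by (intro nn_integral_cong) (auto simp: indicator_def)
    finally show ?thesis using B oc by (simp add: sets_vol)
  qed
  also have "\<dots> = emeasure (chart_measure M c) (B \<inter> cdom c)"
    using vol_is_volume c B oc by (simp add: is_volume_iff)
  also have "\<dots> = emeasure (chart_measure M c) B"
  proof (rule emeasure_eq_AE)
    show "AE x in chart_measure M c. x \<in> B \<inter> cdom c \<longleftrightarrow> x \<in> B"
    proof -
      have d: "AE y in density lborel (\<lambda>y. ennreal (vdens M c y)). cext c y \<in> B \<inter> cdom c \<longleftrightarrow> cext c y \<in> B"
      proof (subst AE_density)
        have "vdens M c y = 0 \<or> cext c y \<in> cdom c" for y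
          using chart_coordinates(10)[OF c, of y] by (cases "y \<in> cimg c") (auto simp: vdens_def)
        then show "AE y in lborel. 0 < ennreal (vdens M c y) \<longrightarrow> (cext c y \<in> B \<inter> cdom c \<longleftrightarrow> cext c y \<in> B)"
          by (intro AE_I2) (metis Int_iff ennreal_0 less_irrefl)
      qed (use vdens_measurable[OF c] in simp)
      have "{x \<in> space borel. x \<in> B \<inter> cdom c \<longleftrightarrow> x \<in> B} = (B \<inter> cdom c) \<union> - B" by auto
      then have "{x \<in> space borel. x \<in> B \<inter> cdom c \<longleftrightarrow> x \<in> B} \<in> sets borel" using B oc by auto
      moreover have "cext c \<in> measurable (density lborel (\<lambda>y. ennreal (vdens M c y))) borel"
        using cext_measurable[OF c] by simp
      ultimately show ?thesis
        unfolding chart_measure_def using d by (subst AE_distr_iff)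
    qed
  qed (use B oc in \<open>auto simp: chart_measure_sets\<close>)
  finally show "emeasure (density (vol M) (indicator (cdom c))) B = emeasure (chart_measure M c) B" .
qed

lemma integral_vol_chart:
  fixes F :: "'a \<Rightarrow> real"
  assumes c: "c \<in> charts M" and F: "F \<in> borel_measurable borel" and zero: "\<And>x. x \<notin> cdom c \<Longrightarrow> F x = 0"
  shows "integrable (vol M) F \<longleftrightarrow> integrable lborel (\<lambda>y. vdens M c y * F (cext c y))"
    and "(\<integral>x. F x \<partial>vol M) = (\<integral>y. vdens M c y * F (cext c y) \<partial>lborel)"
proof -
  have oc: "cdom c \<in> sets borel" using chart_coordinates(1)[OF c] by auto
  have Fv: "F \<in> borel_measurable (vol M)"
    by (subst measurable_cong_sets[OF sets_vol refl]) (rule F)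
  have Fi: "(\<lambda>x. indicator (cdom c) x *\<^sub>R F x) = F" using zero by (auto simp: indicator_def fun_eq_iff)
  have e: "density (vol M) (indicator (cdom c)) = density (vol M) (\<lambda>x. ennreal (indicator (cdom c) x))"
    by (simp add: ennreal_indicator)
  have im: "(indicator (cdom c) :: 'a \<Rightarrow> real) \<in> borel_measurable (vol M)"
    using oc by (simp add: sets_vol)
  have Fc: "(\<lambda>y. F (cext c y)) \<in> borel_measurable (density lborel (\<lambda>y. ennreal (vdens M c y)))"
    using measurable_compose[OF cext_measurable[OF c] F] by simp
  have cm: "cext c \<in> measurable (density lborel (\<lambda>y. ennreal (vdens M c y))) borel"
    using cext_measurable[OF c] by simp
  have v: "AE y in lborel. 0 \<le> vdens M c y" using vdens_nonneg[OF c] by simp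
  have Fcl: "(\<lambda>y. F (cext c y)) \<in> borel_measurable lborel" "vdens M c \<in> borel_measurable lborel"
    using Fc vdens_measurable[OF c] by auto
  have "integrable (vol M) F \<longleftrightarrow> integrable (density (vol M) (\<lambda>x. ennreal (indicator (cdom c) x))) F"
    using integrable_density[OF Fv im] unfolding Fi by simp
  also have "\<dots> \<longleftrightarrow> integrable (density lborel (\<lambda>y. ennreal (vdens M c y))) (\<lambda>y. F (cext c y))"
    unfolding e[symmetric] vol_chart[OF c] chart_measure_def by (rule integrable_distr_eq[OF cm F])
  also have "\<dots> \<longleftrightarrow> integrable lborel (\<lambda>y. vdens M c y * F (cext c y))"
    using integrable_density[OF Fcl v] by simp
  finally show "integrable (vol M) F \<longleftrightarrow> integrable lborel (\<lambda>y. vdens M c y * F (cext c y))" .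
  have "(\<integral>x. F x \<partial>vol M) = (\<integral>x. F x \<partial>density (vol M) (\<lambda>x. ennreal (indicator (cdom c) x)))"
    using integral_density[OF Fv im] unfolding Fi by simp
  also have "\<dots> = (\<integral>y. F (cext c y) \<partial>density lborel (\<lambda>y. ennreal (vdens M c y)))"
    unfolding e[symmetric] vol_chart[OF c] chart_measure_def by (rule integral_distr[OF cm F])
  also have "\<dots> = (\<integral>y. vdens M c y * F (cext c y) \<partial>lborel)"
    using integral_density[OF Fcl v] by simp
  finally show "(\<integral>x. F x \<partial>vol M) = (\<integral>y. vdens M c y * F (cext c y) \<partial>lborel)" .
qed

section \<open>Gradients and test functions on the manifold\<close>

text \<open>The Jacobians of the vector fields cancel against those of the metric.\<close>

lemma gdot_chart:
  assumes c: "c \<in> charts M" "x \<in> cdom c" and x: "x \<in> S"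
    and X: "vector_field_on M S X" and Z: "vector_field_on M S Z"
  shows "gdot M X Z x = X c x \<bullet> (metric M c x *v Z c x)"
proof -
  define d where "d = chart_at M x"
  have "\<exists>d. d \<in> charts M \<and> x \<in> cdom d" using c by blast
  then have d: "d \<in> charts M" "x \<in> cdom d" unfolding d_def chart_at_def by (metis (mono_tags, lifting) someI_ex)+
  let ?J = "jac c d x"
  have e: "X d x = ?J *v X c x" "Z d x = ?J *v Z c x"
    by (rule vector_field_onD[OF _ c(1) d(1) x c(2) d(2)]; rule X Z)+
  have "X c x \<bullet> (metric M c x *v Z c x) = X c x \<bullet> (transpose ?J *v (metric M d x *v (?J *v Z c x)))"
    by (subst metric_transform[OF c(1) d(1) c(2) d(2)])
      (simp only: matrix_vector_mul_assoc matrix_mul_assoc)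
  also have "\<dots> = X d x \<bullet> (metric M d x *v Z d x)"
    by (simp only: inner_transpose_mult e)
  finally show ?thesis by (simp add: gdot_def d_def Let_def)
qed

lemma metric_invertible:
  assumes "c \<in> charts M" "x \<in> cdom c"
  shows "metric M c x *v (matrix_inv (metric M c x) *v v) = v"
    "metric M c x *v v = metric M c x *v v' \<Longrightarrow> v = v'"
proof -
  have i: "invertible (metric M c x)"
    by (rule posdef_invertible) (rule metric_symmetric_posdef(2)[OF assms])
  show "metric M c x *v (matrix_inv (metric M c x) *v v) = v"
    using matrix_inv_mult(2)[OF i] by (simp add: matrix_vector_mul_assoc)
  assume "metric M c x *v v = metric M c x *v v'"
  then have "matrix_inv (metric M c x) *v (metric M c x *v v) = matrix_inv (metric M c x) *v (metric M c x *v v')"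
    by simp
  then show "v = v'" using matrix_inv_mult(1)[OF i] by (simp add: matrix_vector_mul_assoc)
qed

lemma metric_grad:
  assumes "c \<in> charts M" "x \<in> cdom c"
  shows "metric M c x *v grad M u c x = egrad (u \<circ> cinv c) (cmap c x)"
  unfolding grad_def egrad_def[symmetric] by (rule metric_invertible(1)[OF assms])

lemma mC1_differentiable:
  assumes "mC1 M u" "c \<in> charts M" "x \<in> cdom c"
  shows "(u \<circ> cinv c) differentiable (at (cmap c x))"
  using assms C1_differentiable[of "cimg c" "u \<circ> cinv c"] unfolding mC1_def by blast

lemma egrad_transform:
  assumes u: "mC1 M u" and c: "c \<in> charts M" "x \<in> cdom c" and d: "d \<in> charts M" "x \<in> cdom d"
  shows "egrad (u \<circ> cinv c) (cmap c x) = transpose (jac c d x) *v egrad (u \<circ> cinv d) (cmap d x)"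
proof -
  define O' where "O' = cmap c ` (cdom c \<inter> cdom d)"
  have O': "open O'" "cmap c x \<in> O'"
    using chart_image_open[OF c(1) chart_coordinates(1)[OF d(1)]] c d by (auto simp: O'_def)
  have "((u \<circ> cinv d) has_derivative (\<lambda>v. egrad (u \<circ> cinv d) (cmap d x) \<bullet> v)) (at ((cmap d \<circ> cinv c) (cmap c x)))"
    using egrad_has_derivative[OF mC1_differentiable[OF u d]] chart_coordinates(5)[OF c] by simp
  from has_derivative_compose[OF transition_derivative[OF c(1) d(1) c(2) d(2)] this]
  have "((\<lambda>y. (u \<circ> cinv d) ((cmap d \<circ> cinv c) y)) has_derivative
      (\<lambda>v. egrad (u \<circ> cinv d) (cmap d x) \<bullet> (jac c d x *v v))) (at (cmap c x))" .
  then have "((u \<circ> cinv c) has_derivative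
      (\<lambda>v. egrad (u \<circ> cinv d) (cmap d x) \<bullet> (jac c d x *v v))) (at (cmap c x))"
    by (rule has_derivative_transform_within_open[OF _ O'])
      (auto simp: O'_def chart_coordinates(5)[OF c(1)] chart_coordinates(5)[OF d(1)])
  then show ?thesis
    by (rule egrad_eqI) (metis inner_commute inner_transpose_mult)
qed

text \<open>The differential transforms with the transposed Jacobian $J^T$, the metric as $J^T G J$. Since
  $\det J \neq 0$, the common factor $J^T G$ can be cancelled.\<close>

lemma grad_vector_field:
  assumes u: "mC1 M u" shows "vector_field_on M S (grad M u)"
  unfolding vector_field_on_def
proof (intro ballI)
  fix c d x assume c: "c \<in> charts M" and d: "d \<in> charts M" and "x \<in> S \<inter> cdom c \<inter> cdom d"
  then have x: "x \<in> cdom c" "x \<in> cdom d" by auto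
  let ?J = "jac c d x" and ?Gc = "metric M c x" and ?Gd = "metric M d x"
  have G: "?Gc = transpose ?J ** ?Gd ** ?J" by (rule metric_transform[OF c d x])
  have "det ?Gc \<noteq> 0" using posdef_det_pos[OF metric_symmetric_posdef(2)[OF c x(1)]] by simp
  then have "det (transpose ?J) \<noteq> 0" by (subst (asm) G) (simp add: det_mul)
  then have "invertible (transpose ?J)" using invertible_det_nz by blast
  then have injT: "v = v'" if "transpose ?J *v v = transpose ?J *v v'" for v v'
    using that by (metis invertible_def matrix_vector_mul_assoc matrix_vector_mul_lid)
  have "transpose ?J *v (?Gd *v (?J *v grad M u c x)) = ?Gc *v grad M u c x"
    by (subst G) (simp only: matrix_vector_mul_assoc matrix_mul_assoc)
  also have "\<dots> = transpose ?J *v (?Gd *v grad M u d x)"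
    unfolding metric_grad[OF c x(1)] metric_grad[OF d x(2)] by (rule egrad_transform[OF u c x(1) d x(2)])
  finally show "grad M u d x = ?J *v grad M u c x"
    using injT metric_invertible(2)[OF d x(2)] by metis
qed

lemma gdot_grad_chart:
  assumes u: "mC1 M u" and c: "c \<in> charts M" "x \<in> cdom c" and X: "vector_field_on M S X" and x: "x \<in> S"
  shows "gdot M X (grad M u) x = X c x \<bullet> egrad (u \<circ> cinv c) (cmap c x)"
  using gdot_chart[OF c x X grad_vector_field[OF u]] metric_grad[OF c] by simp

lemma chart_at_chart: "chart_at M x \<in> charts M" "x \<in> cdom (chart_at M x)"
  using charts_cover[of x] unfolding chart_at_def by (metis (mono_tags, lifting) someI_ex)+

lemma gdot_self_nonneg: "0 \<le> gdot M X X x"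
proof (cases "X (chart_at M x) x = 0")
  case False
  then show ?thesis
    using metric_symmetric_posdef(2)[OF chart_at_chart False] by (simp add: gdot_def Let_def less_imp_le)
qed (simp add: gdot_def)

lemma gnorm_nonneg: "0 \<le> gnorm M X x" and gnorm_square: "(gnorm M X x)\<^sup>2 = gdot M X X x"
  using gdot_self_nonneg by (auto simp: gnorm_def)

lemma gdot_Cauchy_Schwarz: "\<bar>gdot M X Z x\<bar> \<le> gnorm M X x * gnorm M Z x"
proof -
  let ?c = "chart_at M x"
  define G where "G = metric M ?c x"
  define B where "B v w = v \<bullet> (G *v w)" for v w
  have pos: "v \<noteq> 0 \<Longrightarrow> 0 < B v v" for v
    using metric_symmetric_posdef(2)[OF chart_at_chart] by (auto simp: B_def G_def)
  then have nn: "0 \<le> B v v" for v by (cases "v = 0") (auto simp: B_def intro: less_imp_le)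
  have sym: "B v w = B w v" for v w
    unfolding B_def using inner_transpose_mult[of v G w] metric_symmetric_posdef(1)[OF chart_at_chart, of x]
    by (simp add: G_def inner_commute)
  have "(B v w)\<^sup>2 \<le> B v v * B w w" for v w
  proof (cases "w = 0")
    case False
    define t where "t = B v w / B w w"
    have "0 \<le> B (v - t *\<^sub>R w) (v - t *\<^sub>R w)" by (rule nn)
    also have "\<dots> = B v v - t * B v w - t * B w v + t * t * B w w"
      by (simp add: B_def matrix_vector_mult_diff_distrib matrix_vector_mult_scaleR inner_diff_left inner_diff_right algebra_simps)
    also have "\<dots> = B v v - (B v w)\<^sup>2 / B w w"
      using pos[OF False] by (simp add: t_def sym[of w v] power2_eq_square field_simps)
    finally show ?thesis using pos[OF False] by (simp add: field_simps)
  qed (simp add: B_def)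
  from real_sqrt_le_mono[OF this[of "X ?c x" "Z ?c x"]]
  show ?thesis
    by (simp add: real_sqrt_mult gnorm_def gdot_def Let_def B_def G_def)
qed

text \<open>The chart domain and the complement of the support form an open cover; on the first the
  function is a composition with a transition map, on the second it is zero.\<close>

lemma lift_C0:
  assumes c: "c \<in> charts M" and f: "Ck_on 1 UNIV f" and cs: "compact_support_in (cmap c ` (\<Omega> \<inter> cdom c)) f"
  shows "lift c f \<in> C0k M 1 \<Omega>" "compact_support_in (\<Omega> \<inter> cdom c) (lift c f)"
proof -
  define K where "K = cinv c ` closure {y. f y \<noteq> 0}"
  have sub: "closure {y. f y \<noteq> 0} \<subseteq> cmap c ` (\<Omega> \<inter> cdom c)" and comp: "compact (closure {y. f y \<noteq> 0})"
    using cs by (auto simp: compact_support_in_def)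
  have K: "compact K" unfolding K_def
    by (rule compact_continuous_image[OF continuous_on_subset[OF chart_coordinates(4)[OF c]] comp]) (use sub in auto)
  have Ksub: "K \<subseteq> \<Omega> \<inter> cdom c" using sub chart_coordinates(5)[OF c] unfolding K_def by fastforce
  have zero: "lift c f x = 0" if "x \<notin> K" for x
  proof (rule ccontr)
    assume "lift c f x \<noteq> 0"
    then have x: "x \<in> cdom c" "f (cmap c x) \<noteq> 0" by (auto simp: lift_def split: if_splits)
    then have "cmap c x \<in> closure {y. f y \<noteq> 0}" using closure_subset[of "{y. f y \<noteq> 0}"] by auto
    then have "cinv c (cmap c x) \<in> K" unfolding K_def by (rule imageI)
    then show False using that chart_coordinates(5)[OF c x(1)] by simp
  qed
  show cs': "compact_support_in (\<Omega> \<inter> cdom c) (lift c f)" by (rule compact_support_inI[OF K Ksub zero])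
  have "mC1 M (lift c f)"
    unfolding mC1_def
  proof
    fix d assume d: "d \<in> charts M"
    define T1 where "T1 = cmap d ` (cdom d \<inter> cdom c)"
    define T2 where "T2 = cmap d ` (cdom d \<inter> - K)"
    have o1: "open T1" unfolding T1_def by (rule chart_image_open[OF d chart_coordinates(1)[OF c]])
    have o2: "open T2" unfolding T2_def
      by (rule chart_image_open[OF d]) (use K compact_imp_closed in \<open>auto simp: open_Compl\<close>)
    have un: "cimg d = T1 \<union> T2" using Ksub by (auto simp: T1_def T2_def)
    have 1: "Ck_on 1 T1 (lift c f \<circ> cinv d)"
    proof (rule Ck_on_cong[OF o1])
      show "Ck_on 1 T1 (\<lambda>y. f ((cmap c \<circ> cinv d) y))"
        by (rule C1_compose[OF o1 open_UNIV transition_C1[OF d c, folded T1_def] f subset_UNIV])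
      show "f ((cmap c \<circ> cinv d) y) = (lift c f \<circ> cinv d) y" if "y \<in> T1" for y
        using that chart_coordinates(5)[OF d] by (auto simp: T1_def lift_def)
    qed
    have 2: "Ck_on 1 T2 (lift c f \<circ> cinv d)"
    proof (rule Ck_on_cong[OF o2 _ Ck_on_const[OF o2, of 1 0]])
      show "0 = (lift c f \<circ> cinv d) y" if "y \<in> T2" for y
        using that chart_coordinates(5)[OF d] zero by (auto simp: T2_def)
    qed
    show "Ck_on 1 (cimg d) (lift c f \<circ> cinv d)"
      unfolding un by (rule Ck_on_Un[OF o1 o2 1 2])
  qed
  moreover have "compact_support_in \<Omega> (lift c f)"
    using cs' by (auto simp: compact_support_in_def)
  ultimately show "lift c f \<in> C0k M 1 \<Omega>" unfolding C0k_1_iff by simp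
qed

lemma egrad_lift:
  assumes c: "c \<in> charts M" "y \<in> cimg c" and f: "Ck_on 1 UNIV f"
  shows "egrad (lift c f \<circ> cinv c) y = egrad f y"
proof (rule egrad_cong(1)[OF chart_coordinates(2)[OF c(1)] c(2), symmetric])
  show "f differentiable at y" using C1_differentiable[OF f] by simp
  show "f x = (lift c f \<circ> cinv c) x" if "x \<in> cimg c" for x
    using that chart_coordinates(6,7)[OF c(1)] by (simp add: lift_def)
qed

lemma pull_C1:
  assumes c: "c \<in> charts M" and w: "w \<in> C0k M 1 \<Omega>" and cs: "closure {x. w x \<noteq> 0} \<subseteq> cdom c"
  shows "Ck_on 1 UNIV (pull c w)" "compact_support_in (cmap c ` (\<Omega> \<inter> cdom c)) (pull c w)"
proof -
  define K where "K = cmap c ` closure {x. w x \<noteq> 0}"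
  have wc: "compact (closure {x. w x \<noteq> 0})" "closure {x. w x \<noteq> 0} \<subseteq> \<Omega>" and wC: "mC1 M w"
    using w unfolding C0k_1_iff compact_support_in_def by auto
  have K: "compact K" unfolding K_def
    by (rule compact_continuous_image[OF continuous_on_subset[OF chart_coordinates(3)[OF c] cs] wc(1)])
  have Ksub: "K \<subseteq> cmap c ` (\<Omega> \<inter> cdom c)" using cs wc(2) by (auto simp: K_def)
  have zero: "pull c w y = 0" if "y \<notin> K" for y
  proof (rule ccontr)
    assume "pull c w y \<noteq> 0"
    then have y: "y \<in> cimg c" "w (cinv c y) \<noteq> 0" by (auto simp: pull_def split: if_splits)
    then have "cinv c y \<in> closure {x. w x \<noteq> 0}" using closure_subset[of "{x. w x \<noteq> 0}"] by auto
    then have "cmap c (cinv c y) \<in> K" unfolding K_def by (rule imageI)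
    then show False using that chart_coordinates(6)[OF c y(1)] by simp
  qed
  show "compact_support_in (cmap c ` (\<Omega> \<inter> cdom c)) (pull c w)"
    by (rule compact_support_inI[OF K Ksub zero])
  have oK: "open (- K)" using K compact_imp_closed by (auto simp: open_Compl)
  have 1: "Ck_on 1 (cimg c) (pull c w)"
    by (rule Ck_on_cong[OF chart_coordinates(2)[OF c], of "w \<circ> cinv c"]) (use wC c in \<open>auto simp: pull_def mC1_def simp del: Ck_on.simps\<close>)
  have 2: "Ck_on 1 (- K) (pull c w)"
    by (rule Ck_on_cong[OF oK _ Ck_on_const[OF oK, of 1 0]]) (use zero in auto)
  have "cimg c \<union> - K = UNIV" using Ksub by auto
  then show "Ck_on 1 UNIV (pull c w)" using Ck_on_Un[OF chart_coordinates(2)[OF c] oK 1 2] by simp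
qed

lemma egrad_pull:
  assumes c: "c \<in> charts M" "y \<in> cimg c" and w: "mC1 M w"
  shows "egrad (pull c w) y = egrad (w \<circ> cinv c) y"
proof (rule egrad_cong(1)[OF chart_coordinates(2)[OF c(1)] c(2), symmetric])
  show "(w \<circ> cinv c) differentiable at y"
    using mC1_differentiable[OF w c(1), of "cinv c y"] chart_coordinates(6,7)[OF c] by simp
  show "(w \<circ> cinv c) x = pull c w x" if "x \<in> cimg c" for x
    using that by (simp add: pull_def)
qed

lemma mC1_mult: "mC1 M u \<Longrightarrow> mC1 M v \<Longrightarrow> mC1 M (\<lambda>x. u x * v x)"
  unfolding mC1_def comp_def by (auto intro!: Ck_on_mult chart_coordinates(2) simp del: Ck_on.simps)

lemma mC1_one_minus: "mC1 M u \<Longrightarrow> mC1 M (\<lambda>x. 1 - u x)"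
  unfolding mC1_def comp_def by (auto intro!: Ck_on_diff Ck_on_const chart_coordinates(2) simp del: Ck_on.simps)

lemma C0k_mult: "u \<in> C0k M 1 \<Omega> \<Longrightarrow> mC1 M v \<Longrightarrow> (\<lambda>x. u x * v x) \<in> C0k M 1 \<Omega>"
  unfolding C0k_1_iff by (auto intro: compact_support_in_mono mC1_mult)

text \<open>These functions serve both as a partition of unity and as the test functions for local
  integrability.\<close>

lemma plateau_exists:
  assumes "open \<Omega>" "x \<in> \<Omega>"
  shows "\<exists>b c N. b \<in> C0k M 1 \<Omega> \<and> (\<forall>z. 0 \<le> b z \<and> b z \<le> 1) \<and> c \<in> charts M \<and> closure {z. b z \<noteq> 0} \<subseteq> cdom c \<and>
    open N \<and> x \<in> N \<and> (\<forall>z\<in>N. b z = 1)"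
proof -
  obtain c where c: "c \<in> charts M" "x \<in> cdom c" using charts_cover by blast
  define W where "W = cmap c ` (\<Omega> \<inter> cdom c)"
  have oW: "open W" using chart_image_open[OF c(1) assms(1)] by (simp add: W_def Int_commute)
  define y0 where "y0 = cmap c x"
  have "y0 \<in> W" using c assms(2) by (auto simp: W_def y0_def)
  then obtain R where R: "R > 0" "cball y0 R \<subseteq> W" using oW open_contains_cball by blast
  \<comment> \<open>The value of the bump at distance \<open>R / 2\<close> from the centre.\<close>
  define c0 where "c0 = flat_exp 0 (3/4 * R\<^sup>2)"
  have c0: "c0 > 0" using R by (simp add: c0_def flat_exp_def)
  define f where "f y = 1 - (max 0 (1 - bump R (y0 - y) / c0))\<^sup>2" for y
  have bC: "Ck_on 1 UNIV (\<lambda>y. bump R (y0 - y))" using bump_smooth[of R y0] unfolding smooth_on_def by blast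
  have PC: "Ck_on 1 UNIV (\<lambda>t::real. (max 0 t)\<^sup>2)"
  proof (rule C1_real_I[where f'="\<lambda>t. 2 * max 0 t"])
    fix t :: real
    consider "t > 0" | "t < 0" | "t = 0" by linarith
    then show "((\<lambda>t. (max 0 t)\<^sup>2) has_real_derivative 2 * max 0 t) (at t)"
    proof cases
      case 1
      have "((\<lambda>t. t\<^sup>2) has_real_derivative 2 * t) (at t)" by (auto intro!: derivative_eq_intros)
      then have "((\<lambda>t. (max 0 t)\<^sup>2) has_real_derivative 2 * t) (at t)"
        by (rule has_field_derivative_transform_within_open[of _ _ _ "{0<..}"]) (use 1 in auto)
      then show ?thesis using 1 by simp
    next
      case 2
      have "((\<lambda>t. 0) has_real_derivative 0) (at t)" by simp
      then have "((\<lambda>t. (max 0 t)\<^sup>2) has_real_derivative 0) (at t)"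
        by (rule has_field_derivative_transform_within_open[of _ _ _ "{..<0}"]) (use 2 in auto)
      then show ?thesis using 2 by simp
    next
      case 3
      have "((\<lambda>t::real. (max 0 t)\<^sup>2) has_real_derivative 0) (at 0)"
        by (rule has_real_derivative_of_square_bound[where C=1]) (auto simp: max_def)
      then show ?thesis using 3 by simp
    qed
  qed (auto intro!: continuous_intros)
  have inC: "Ck_on 1 UNIV (\<lambda>y. 1 - bump R (y0 - y) / c0)"
    using Ck_on_diff[OF open_UNIV Ck_on_const[OF open_UNIV, of 1 1] Ck_on_cmult[OF open_UNIV bC, of "1/c0"]] by simp
  have fC: "Ck_on 1 UNIV f"
    unfolding f_def[abs_def]
    by (rule Ck_on_diff[OF open_UNIV Ck_on_const[OF open_UNIV]
          C1_compose[OF open_UNIV open_UNIV inC PC]]) simp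
  have fcs: "compact_support_in W f"
  proof (rule compact_support_inI[OF compact_cball R(2)])
    fix y assume "y \<notin> cball y0 R"
    then have "\<not> 0 < bump R (y0 - y)" using bump_pos_iff[OF R(1), of "y0 - y"] by (simp add: dist_norm)
    then have "bump R (y0 - y) = 0" using bump_nonneg[of R "y0 - y"] by simp
    then show "f y = 0" by (simp add: f_def)
  qed
  have f01: "0 \<le> f y" "f y \<le> 1" for y
  proof -
    have "0 \<le> bump R (y0 - y) / c0" using bump_nonneg[of R "y0 - y"] c0 by simp
    then have "0 \<le> max 0 (1 - bump R (y0 - y) / c0)" "max 0 (1 - bump R (y0 - y) / c0) \<le> 1" by auto
    then show "0 \<le> f y" "f y \<le> 1" by (auto simp: f_def power_le_one)
  qed
  have f1: "f y = 1" if "y \<in> ball y0 (R/2)" for y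
  proof -
    have n: "norm (y0 - y) < R / 2" using that by (simp add: dist_norm)
    then have "(norm (y0 - y))\<^sup>2 \<le> (R/2)\<^sup>2" by (intro power_mono) auto
    then have "3/4 * R\<^sup>2 \<le> R\<^sup>2 - (y0 - y) \<bullet> (y0 - y)"
      by (simp add: power2_norm_eq_inner[symmetric] power_divide)
    moreover have "flat_exp 0 s \<le> flat_exp 0 t" if "0 < s" "s \<le> t" for s t
      using that by (simp add: flat_exp_def frac_le)
    ultimately have "c0 \<le> bump R (y0 - y)"
      using R by (simp add: c0_def bump_def)
    then show ?thesis using c0 by (simp add: f_def)
  qed
  define N where "N = cmap c -` ball y0 (R/2) \<inter> cdom c"
  have "open N" unfolding N_def
    using continuous_on_open_vimage[OF chart_coordinates(1)[OF c(1)]] chart_coordinates(3)[OF c(1)] by blast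
  moreover have "x \<in> N" using c R by (simp add: N_def y0_def)
  moreover have "\<forall>z\<in>N. lift c f z = 1" using f1 by (auto simp: N_def lift_def)
  moreover have "\<forall>z. 0 \<le> lift c f z \<and> lift c f z \<le> 1" using f01 by (auto simp: lift_def)
  moreover note lift_C0[OF c(1) fC fcs[unfolded W_def]]
  moreover have "closure {z. lift c f z \<noteq> 0} \<subseteq> cdom c"
    using calculation(6) by (auto simp: compact_support_in_def)
  ultimately show ?thesis using c(1) by blast
qed

section \<open>Integrals over the manifold\<close>

lemma cmap_measurable:
  assumes "c \<in> charts M" shows "(\<lambda>x. if x \<in> cdom c then cmap c x else 0) \<in> borel_measurable borel"
  using chart_coordinates(1,3)[OF assms] by (intro borel_measurable_continuous_on_if continuous_on_const) auto

lemma lift_measurable: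
  assumes c: "c \<in> charts M" and f: "f \<in> borel_measurable borel" shows "lift c f \<in> borel_measurable borel"
proof -
  have "(\<lambda>x. indicator (cdom c) x * f (if x \<in> cdom c then cmap c x else 0)) \<in> borel_measurable borel"
    using chart_coordinates(1)[OF c] measurable_compose[OF cmap_measurable[OF c] f]
    by (intro borel_measurable_times borel_measurable_indicator) auto
  moreover have "(\<lambda>x. indicator (cdom c) x * f (if x \<in> cdom c then cmap c x else 0)) = lift c f"
    by (auto simp: lift_def)
  ultimately show ?thesis by simp
qed

lemma integral_lift:
  assumes c: "c \<in> charts M" and f: "f \<in> borel_measurable borel"
  shows "integrable (vol M) (lift c f) \<longleftrightarrow> integrable lborel (\<lambda>y. vdens M c y * f y)"
    and "(\<integral>x. lift c f x \<partial>vol M) = (\<integral>y. vdens M c y * f y \<partial>lborel)"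
proof -
  have e: "vdens M c y * lift c f (cext c y) = vdens M c y * f y" for y
    using chart_coordinates(9,10)[OF c, of y] by (cases "y \<in> cimg c") (auto simp: lift_def vdens_def)
  have z: "lift c f x = 0" if "x \<notin> cdom c" for x using that by (simp add: lift_def)
  show "integrable (vol M) (lift c f) \<longleftrightarrow> integrable lborel (\<lambda>y. vdens M c y * f y)"
    "(\<integral>x. lift c f x \<partial>vol M) = (\<integral>y. vdens M c y * f y \<partial>lborel)"
    using integral_vol_chart[OF c lift_measurable[OF c f] z] by (simp_all add: e)
qed

lemma AE_chart:
  assumes c: "c \<in> charts M" and P: "AE x in vol M. P x"
  shows "AE y in lborel. y \<in> cimg c \<longrightarrow> P (cext c y)"
proof -
  have oc: "cdom c \<in> sets borel" using chart_coordinates(1)[OF c] by auto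
  have "(indicator (cdom c) :: 'a \<Rightarrow> ennreal) \<in> borel_measurable (vol M)"
    by (rule borel_measurable_indicator) (simp add: sets_vol oc)
  then have "AE x in density (vol M) (indicator (cdom c)). P x"
    using P by (subst AE_density) auto
  then have "AE x in distr (density lborel (\<lambda>y. ennreal (vdens M c y))) borel (cext c). P x"
    unfolding vol_chart[OF c] chart_measure_def .
  then have "AE y in density lborel (\<lambda>y. ennreal (vdens M c y)). P (cext c y)"
    by (rule AE_distrD[rotated]) (use cext_measurable[OF c] in simp)
  then have "AE y in lborel. 0 < ennreal (vdens M c y) \<longrightarrow> P (cext c y)"
    by (subst (asm) AE_density) (use vdens_measurable[OF c] in auto)
  then show ?thesis
    by eventually_elim (use vdens_pos[OF c] in auto)
qed

lemma grad_off_support: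
  assumes c: "c \<in> charts M" "x \<in> cdom c" and x: "x \<notin> closure {x. w x \<noteq> 0}"
  shows "egrad (w \<circ> cinv c) (cmap c x) = 0" "grad M w c x = 0"
proof -
  define T where "T = cmap c ` (cdom c \<inter> - closure {x. w x \<noteq> 0})"
  have T: "open T" unfolding T_def by (rule chart_image_open[OF c(1)]) auto
  have xT: "cmap c x \<in> T" using c x by (auto simp: T_def)
  have z: "w (cinv c y) = 0" if "y \<in> T" for y
    using that chart_coordinates(5)[OF c(1)] closure_subset[of "{x. w x \<noteq> 0}"] by (auto simp: T_def)
  have "((\<lambda>_. 0 :: real) has_derivative (\<lambda>_. 0)) (at (cmap c x))" by simp
  then have "(w \<circ> cinv c has_derivative (\<lambda>_. 0)) (at (cmap c x))"
    by (rule has_derivative_transform_within_open[OF _ T xT]) (simp add: z)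
  then show e: "egrad (w \<circ> cinv c) (cmap c x) = 0" by (rule egrad_eqI) simp
  show "grad M w c x = 0" using e by (simp add: grad_def egrad_def[symmetric])
qed

lemma gdot_grad_off_support:
  assumes "x \<notin> closure {x. w x \<noteq> 0}" shows "gdot M X (grad M w) x = 0"
  using grad_off_support(2)[OF chart_at_chart assms] by (simp add: gdot_def Let_def)

text \<open>On a compact subset of the chart the density has a positive minimum, by which it can be
  divided away.\<close>

lemma chart_Lp_integrable:
  assumes c: "c \<in> charts M" and K: "compact K" "K \<subseteq> cmap c ` (\<Omega> \<inter> cdom c)" and f: "Lp_loc M s \<Omega> f"
  shows "integrable lborel (\<lambda>y. indicator K y * \<bar>f (cext c y)\<bar> powr s)"
proof (cases "K = {}")
  case False
  have Kc: "K \<subseteq> cimg c" using K(2) by auto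
  define KM where "KM = cinv c ` K"
  have KM: "compact KM" unfolding KM_def
    by (rule compact_continuous_image[OF continuous_on_subset[OF chart_coordinates(4)[OF c] Kc] K(1)])
  have KM\<Omega>: "KM \<subseteq> \<Omega> \<inter> cdom c" using K(2) chart_coordinates(5)[OF c] unfolding KM_def by fastforce
  have int: "set_integrable (vol M) KM (\<lambda>x. \<bar>f x\<bar> powr s)" using f KM KM\<Omega> by (auto simp: Lp_loc_def)
  have fm: "(\<lambda>x. indicator \<Omega> x *\<^sub>R f x) \<in> borel_measurable borel"
    using f by (simp add: Lp_loc_def set_borel_measurable_def)
  have Kb: "K \<in> sets borel" using K(1) by (simp add: borel_compact)
  have KMb: "KM \<in> sets borel" using KM by (simp add: borel_compact)
  define F where "F x = indicator KM x * \<bar>indicator \<Omega> x *\<^sub>R f x\<bar> powr s" for x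
  have Fm: "F \<in> borel_measurable borel" unfolding F_def[abs_def] using fm KMb by measurable
  have Feq: "F = (\<lambda>x. indicator KM x *\<^sub>R \<bar>f x\<bar> powr s)"
    using KM\<Omega> by (auto simp: F_def indicator_def fun_eq_iff)
  have "integrable (vol M) F" using int by (simp add: Feq set_integrable_def)
  then have iF: "integrable lborel (\<lambda>y. vdens M c y * F (cext c y))"
    using integral_vol_chart(1)[OF c Fm] KM\<Omega> by (auto simp: F_def indicator_def)
  obtain y0 where y0: "y0 \<in> K" "\<And>y. y \<in> K \<Longrightarrow> vdens M c y0 \<le> vdens M c y"
    using continuous_attains_inf[OF K(1) False continuous_on_subset[OF vdens_continuous[OF c] Kc]] by blast
  have b: "vdens M c y0 > 0" using vdens_pos[OF c] y0(1) Kc by auto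
  have FK: "F (cext c y) = indicator K y * \<bar>f (cext c y)\<bar> powr s" if "y \<in> cimg c" for y
  proof -
    have "cext c y \<in> KM \<longleftrightarrow> y \<in> K"
    proof
      assume "cext c y \<in> KM"
      then obtain y' where "y' \<in> K" "cext c y = cinv c y'" by (auto simp: KM_def)
      then show "y \<in> K" using chart_coordinates(6)[OF c] chart_coordinates(9)[OF c that] Kc by (metis subsetD)
    next
      assume "y \<in> K"
      then show "cext c y \<in> KM" using that by (auto simp: KM_def cext_def)
    qed
    then show ?thesis by (simp add: Feq indicator_def)
  qed
  show ?thesis
  proof (rule Bochner_Integration.integrable_bound[OF integrable_mult_right[OF iF, of "1 / vdens M c y0"]])
    have "(\<lambda>y. indicator K y * \<bar>f (cext c y)\<bar> powr s) = (\<lambda>y. indicator K y * F (cext c y))"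
      using FK Kc by (auto simp: indicator_def fun_eq_iff)
    then show "(\<lambda>y. indicator K y * \<bar>f (cext c y)\<bar> powr s) \<in> borel_measurable lborel"
      using Kb measurable_compose[OF cext_measurable[OF c] Fm] by simp
    show "AE y in lborel. norm (indicator K y * \<bar>f (cext c y)\<bar> powr s) \<le> norm (1 / vdens M c y0 * (vdens M c y * F (cext c y)))"
    proof (rule AE_I2)
      fix y
      show "norm (indicator K y * \<bar>f (cext c y)\<bar> powr s) \<le> norm (1 / vdens M c y0 * (vdens M c y * F (cext c y)))"
      proof (cases "y \<in> K")
        case True
        then have y: "y \<in> cimg c" using Kc by auto
        have "1 \<le> vdens M c y / vdens M c y0" using y0(2)[OF True] b by simp
        then have "1 * \<bar>f (cext c y)\<bar> powr s \<le> (vdens M c y / vdens M c y0) * \<bar>f (cext c y)\<bar> powr s"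
          by (rule mult_right_mono) simp
        then show ?thesis
          using True FK[OF y] vdens_nonneg[OF c, of y] b by (simp add: abs_mult)
      qed simp
    qed
  qed
qed simp

lemma gdot_grad_eq:
  "gdot M X (grad M u) x = X (chart_at M x) x \<bullet> egrad (u \<circ> cinv (chart_at M x)) (cmap (chart_at M x) x)"
  using metric_grad[OF chart_at_chart] by (simp add: gdot_def Let_def)

lemma gdot_grad_add:
  assumes "mC1 M u" "mC1 M v"
  shows "gdot M X (grad M (\<lambda>x. u x + v x)) x = gdot M X (grad M u) x + gdot M X (grad M v) x"
proof -
  let ?c = "chart_at M x"
  note d = egrad_has_derivative[OF mC1_differentiable[OF assms(1) chart_at_chart]]
    egrad_has_derivative[OF mC1_differentiable[OF assms(2) chart_at_chart]]
  have "egrad (\<lambda>y. (u \<circ> cinv ?c) y + (v \<circ> cinv ?c) y) (cmap ?c x) =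
      egrad (u \<circ> cinv ?c) (cmap ?c x) + egrad (v \<circ> cinv ?c) (cmap ?c x)"
    by (rule egrad_eqI[OF has_derivative_add[OF d(1)[of x] d(2)[of x]]]) (simp add: inner_add_left)
  then show ?thesis by (simp add: gdot_grad_eq comp_def inner_add_right)
qed

lemma mC1_compose_real:
  assumes u: "mC1 M u" and g: "\<And>t. (g has_real_derivative g' t) (at t)" "continuous_on UNIV g'"
  shows "mC1 M (\<lambda>x. g (u x))" "gdot M X (grad M (\<lambda>x. g (u x))) x = g' (u x) * gdot M X (grad M u) x"
proof -
  have gC: "Ck_on 1 UNIV g" by (rule C1_real_I[OF open_UNIV g])
  show "mC1 M (\<lambda>x. g (u x))"
    unfolding mC1_def comp_def
  proof
    fix c assume c: "c \<in> charts M"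
    have uc: "Ck_on 1 (cimg c) (\<lambda>y. u (cinv c y))" using u c unfolding mC1_def comp_def by blast
    show "Ck_on 1 (cimg c) (\<lambda>y. g (u (cinv c y)))"
      by (rule C1_compose[OF chart_coordinates(2)[OF c] open_UNIV uc gC subset_UNIV])
  qed
  let ?c = "chart_at M x"
  have cx: "cinv ?c (cmap ?c x) = x" using chart_coordinates(5)[OF chart_at_chart] .
  have "((\<lambda>y. g ((u \<circ> cinv ?c) y)) has_derivative
      (\<lambda>v. g' ((u \<circ> cinv ?c) (cmap ?c x)) * (egrad (u \<circ> cinv ?c) (cmap ?c x) \<bullet> v))) (at (cmap ?c x))"
    using has_derivative_compose[OF egrad_has_derivative[OF mC1_differentiable[OF u chart_at_chart]]
        g(1)[unfolded has_field_derivative_def]] .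
  then have "egrad (\<lambda>y. g ((u \<circ> cinv ?c) y)) (cmap ?c x) = g' (u x) *\<^sub>R egrad (u \<circ> cinv ?c) (cmap ?c x)"
    by (rule egrad_eqI) (simp add: cx)
  then show "gdot M X (grad M (\<lambda>x. g (u x))) x = g' (u x) * gdot M X (grad M u) x"
    by (simp add: gdot_grad_eq comp_def)
qed

lemma mC1_continuous: "mC1 M u \<Longrightarrow> continuous_on UNIV u"
proof (rule continuous_at_imp_continuous_on, rule ballI)
  fix x assume u: "mC1 M u"
  obtain c where c: "c \<in> charts M" "x \<in> cdom c" using charts_cover by blast
  have "continuous_on (cimg c) (u \<circ> cinv c)"
    using Ck_on_continuous[OF chart_coordinates(2)[OF c(1)]] u c(1) unfolding mC1_def by blast
  then have "continuous_on (cdom c) (\<lambda>x. (u \<circ> cinv c) (cmap c x))"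
    by (rule continuous_on_compose2[OF _ chart_coordinates(3)[OF c(1)]]) auto
  then have "continuous_on (cdom c) u"
    by (rule continuous_on_cong[THEN iffD1, rotated 2]) (auto simp: chart_coordinates(5)[OF c(1)])
  then show "isCont u x" using chart_coordinates(1)[OF c(1)] c(2) by (simp add: continuous_on_eq_continuous_at)
qed

text \<open>Cramer's rule expresses the components of the gradient rationally in the metric and the
  differential.\<close>

lemma gnorm_grad_continuous:
  assumes u: "mC1 M u" shows "continuous_on UNIV (gnorm M (grad M u))"
proof (rule continuous_at_imp_continuous_on, rule ballI)
  fix x
  obtain c where c: "c \<in> charts M" "x \<in> cdom c" using charts_cover by blast
  define G where "G y = metric M c (cinv c y)" for y
  define e where "e y = egrad (u \<circ> cinv c) y" for y
  define g where "g y = (\<chi> k. det (\<chi> i j. if j = k then e y $ i else G y $ i $ j) / det (G y))" for y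
  have Gc: "continuous_on (cimg c) G" unfolding G_def[abs_def] by (rule metric_continuous[OF c(1)])
  have ec: "continuous_on (cimg c) e" unfolding e_def[abs_def]
    by (rule egrad_continuous) (use u c(1) in \<open>auto simp: mC1_def simp del: Ck_on.simps\<close>)
  have dG: "det (G y) \<noteq> 0" if "y \<in> cimg c" for y
    using posdef_det_pos[OF metric_symmetric_posdef(2)[OF c(1) chart_coordinates(7)[OF c(1) that]]] by (simp add: G_def)
  have mk: "continuous_on (cimg c) (\<lambda>y. (\<chi> i j. if j = k then e y $ i else G y $ i $ j))" for k
  proof (intro continuous_on_vec_lambda)
    fix i j
    show "continuous_on (cimg c) (\<lambda>y. if j = k then e y $ i else G y $ i $ j)"
      by (cases "j = k") (auto intro!: continuous_on_component ec Gc)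
  qed
  have gc: "continuous_on (cimg c) g"
    unfolding g_def[abs_def]
    by (rule continuous_on_vec_lambda, rule continuous_on_divide[OF continuous_on_det[OF mk] continuous_on_det[OF Gc]])
      (use dG in auto)
  have grad: "grad M u c (cinv c y) = g y" if "y \<in> cimg c" for y
  proof -
    have "G y *v grad M u c (cinv c y) = e y"
      using metric_grad[OF c(1) chart_coordinates(7)[OF c(1) that]] chart_coordinates(6)[OF c(1) that] by (simp add: G_def e_def)
    then show ?thesis unfolding g_def using cramer[OF dG[OF that]] by blast
  qed
  have eq: "gnorm M (grad M u) x = sqrt (g (cmap c x) \<bullet> e (cmap c x))" if "x \<in> cdom c" for x
    using gdot_grad_chart[OF u c(1) that grad_vector_field[OF u, of UNIV]] grad[of "cmap c x"] chart_coordinates(5)[OF c(1) that] that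
    by (simp add: gnorm_def e_def)
  have "continuous_on (cdom c) (\<lambda>x. sqrt (g (cmap c x) \<bullet> e (cmap c x)))"
    by (intro continuous_on_real_sqrt continuous_on_inner
        continuous_on_compose2[OF gc chart_coordinates(3)[OF c(1)]] continuous_on_compose2[OF ec chart_coordinates(3)[OF c(1)]]) auto
  then have "continuous_on (cdom c) (gnorm M (grad M u))"
    using eq by (simp cong: continuous_on_cong)
  then show "isCont (gnorm M (grad M u)) x" using chart_coordinates(1)[OF c(1)] c(2) by (simp add: continuous_on_eq_continuous_at)
qed

lemma vol_compact_finite:
  assumes K: "compact K" shows "emeasure (vol M) K < \<infinity>"
proof -
  have "\<exists>N. open N \<and> x \<in> N \<and> emeasure (vol M) N < \<infinity>" for x
  proof -
    obtain c where c: "c \<in> charts M" "x \<in> cdom c" using charts_cover by blast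
    obtain R where R: "R > 0" "cball (cmap c x) R \<subseteq> cimg c"
      using open_contains_cball[of "cimg c"] chart_coordinates(2)[OF c(1)] c(2) by (metis imageI)
    define V where "V = ball (cmap c x) R"
    define N where "N = cmap c -` V \<inter> cdom c"
    have oN: "open N" unfolding N_def V_def
      using continuous_on_open_vimage[OF chart_coordinates(1)[OF c(1)]] chart_coordinates(3)[OF c(1)] by blast
    have "compact (vdens M c ` cball (cmap c x) R)"
      by (rule compact_continuous_image[OF continuous_on_subset[OF vdens_continuous[OF c(1)] R(2)] compact_cball])
    then obtain B where B: "\<forall>v\<in>vdens M c ` cball (cmap c x) R. norm v \<le> B"
      using compact_imp_bounded bounded_iff by metis
    have "emeasure (vol M) N = emeasure (chart_measure M c) N"
      using vol_is_volume c(1) oN unfolding is_volume_iff N_def by auto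
    also have "\<dots> = (\<integral>\<^sup>+y. ennreal (indicator (cmap c ` N) y * vdens M c y) \<partial>lborel)"
      by (rule emeasure_chart_measure[OF c(1)]) (use oN in \<open>auto simp: N_def\<close>)
    also have "\<dots> \<le> (\<integral>\<^sup>+y. ennreal B * indicator V y \<partial>lborel)"
    proof (rule nn_integral_mono)
      fix y
      show "ennreal (indicator (cmap c ` N) y * vdens M c y) \<le> ennreal B * indicator V y"
      proof (cases "y \<in> cmap c ` N")
        case True
        then have "y \<in> V" by (auto simp: N_def)
        moreover then have "vdens M c y \<le> B" using B by (auto simp: V_def intro: order_trans[OF abs_ge_self])
        ultimately show ?thesis using True by (simp add: ennreal_leI)
      qed simp
    qed
    also have "\<dots> = ennreal B * emeasure lborel V"
      by (simp add: nn_integral_cmult_indicator V_def)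
    also have "\<dots> < \<infinity>"
      using emeasure_bounded_finite[of V] by (simp add: V_def ennreal_mult_less_top)
    finally show ?thesis using oN c R(1) by (intro exI[of _ N]) (auto simp: N_def V_def)
  qed
  then obtain N where N: "\<And>x. open (N x)" "\<And>x. x \<in> N x" "\<And>x. emeasure (vol M) (N x) < \<infinity>" by metis
  obtain D where D: "D \<subseteq> K" "finite D" "K \<subseteq> (\<Union>x\<in>D. N x)"
    using compact_finite_cover[of K N, OF K N(1,2)] by blast
  have "emeasure (vol M) K \<le> emeasure (vol M) (\<Union>x\<in>D. N x)"
    by (rule emeasure_mono[OF D(3)]) (use N(1) D(2) in \<open>auto simp: sets_vol\<close>)
  also have "\<dots> \<le> (\<Sum>x\<in>D. emeasure (vol M) (N x))"
    by (rule emeasure_subadditive_finite[OF D(2)]) (use N(1) in \<open>auto simp: sets_vol\<close>)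
  also have "\<dots> < \<infinity>" using N(3) D(2) by simp
  finally show ?thesis .
qed

lemma gnorm_grad_integrable:
  assumes u: "u \<in> C0k M 1 \<Omega>" and p: "p > 0"
  shows "integrable (vol M) (\<lambda>x. gnorm M (grad M u) x powr p)"
proof -
  have uC: "mC1 M u" and K: "compact (closure {x. u x \<noteq> 0})"
    using u unfolding C0k_1_iff compact_support_in_def by auto
  define K where "K = closure {x. u x \<noteq> 0}"
  have K: "compact K" using K by (simp add: K_def)
  let ?g = "gnorm M (grad M u)"
  have gc: "continuous_on UNIV ?g" by (rule gnorm_grad_continuous[OF uC])
  have "compact (?g ` K)" using K gc continuous_on_subset by (blast intro: compact_continuous_image)
  then obtain B where B: "\<forall>v\<in>?g ` K. norm v \<le> B" using compact_imp_bounded bounded_iff by metis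
  have Kb: "K \<in> sets (vol M)" using K by (simp add: sets_vol borel_compact)
  have iK: "integrable (vol M) (\<lambda>x. \<bar>B\<bar> powr p * indicator K x)"
    using vol_compact_finite[OF K] Kb by (intro integrable_mult_right) (simp add: less_top)
  show ?thesis
  proof (rule Bochner_Integration.integrable_bound[OF iK])
    have "?g \<in> borel_measurable borel" using gc by (rule borel_measurable_continuous_onI)
    then have "?g \<in> borel_measurable (vol M)" by (subst measurable_cong_sets[OF sets_vol refl])
    then show "(\<lambda>x. ?g x powr p) \<in> borel_measurable (vol M)" by measurable
    show "AE x in vol M. norm (?g x powr p) \<le> norm (\<bar>B\<bar> powr p * indicator K x :: real)"
    proof (rule AE_I2)
      fix x
      show "norm (?g x powr p) \<le> norm (\<bar>B\<bar> powr p * indicator K x :: real)"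
      proof (cases "x \<in> K")
        case True
        then have "?g x \<le> \<bar>B\<bar>" using B by force
        then show ?thesis using True p gnorm_nonneg by (simp add: powr_mono2)
      next
        case False
        then have "gdot M (grad M u) (grad M u) x = 0" unfolding K_def by (rule gdot_grad_off_support)
        then show ?thesis by (simp add: gnorm_def)
      qed
    qed
  qed
qed

section \<open>The Hardy inequality for a supersolution\<close>

context
  fixes \<Omega> :: "'a set" and p :: real and \<rho> :: "'a \<Rightarrow> real" and X :: "('a, 'n) vfield"
  assumes p: "p > 1" and \<Omega>: "open \<Omega>"
    and X: "is_weak_grad M \<Omega> \<rho> X" and Xp: "Lp_loc M p \<Omega> (gnorm M X)"
    and \<rho>0: "AE x in vol M. x \<in> \<Omega> \<longrightarrow> 0 \<le> \<rho> x"
    and super: "\<And>\<phi>. \<phi> \<in> C0k M 1 \<Omega> \<Longrightarrow> (\<And>x. 0 \<le> \<phi> x) \<Longrightarrow>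
      0 \<le> (LINT x:\<Omega>|vol M. gnorm M X x powr (p - 2) * gdot M X (grad M \<phi>) x)"
begin

text \<open>The expression $|\nabla\rho|^{p-2}\,\nabla\rho\cdot\nabla(w\,h(\rho))$, expanded by the
  product and chain rules. Truncating \<open>\<rho>\<close> at 0 changes it on a null set only
  and keeps the argument of \<open>h\<close> in the range where \<open>h\<close> is controlled.\<close>

definition test_integrand :: "(real \<Rightarrow> real) \<Rightarrow> (real \<Rightarrow> real) \<Rightarrow> ('a \<Rightarrow> real) \<Rightarrow> 'a \<Rightarrow> real"
  where "test_integrand h h' w x = indicator \<Omega> x *
    (gnorm M X x powr (p - 2) * (h (max 0 (\<rho> x)) * gdot M X (grad M w) x)
     + w x * h' (max 0 (\<rho> x)) * gnorm M X x powr p)"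

text \<open>For weights supported in one chart this is \<open>weak_inequality_test\<close> in coordinates,
  with the volume density made part of the field \<open>Y\<close>.\<close>

lemma chart_test_inequality:
  assumes h: "\<And>t. 0 \<le> t \<Longrightarrow> (h has_real_derivative h' t) (at t)" "continuous_on {0..} h'"
      "\<And>t. 0 \<le> t \<Longrightarrow> 0 \<le> h t" "\<And>t. 0 \<le> t \<Longrightarrow> h t \<le> H" "\<And>t. 0 \<le> t \<Longrightarrow> \<bar>h' t\<bar> \<le> H"
    and c: "c \<in> charts M"
    and w: "w \<in> C0k M 1 \<Omega>" "\<And>x. 0 \<le> w x" "closure {x. w x \<noteq> 0} \<subseteq> cdom c"
  shows "integrable (vol M) (test_integrand h h' w)" "0 \<le> (\<integral>x. test_integrand h h' w x \<partial>vol M)"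
proof -
  have vf: "vector_field_on M \<Omega> X" and Xm: "set_borel_measurable borel (\<Omega> \<inter> cdom c) (X c)"
    and \<rho>1: "Lp_loc M 1 \<Omega> \<rho>" and X1: "Lp_loc M 1 \<Omega> (gnorm M X)"
    using X c unfolding is_weak_grad_def by auto
  have wC: "mC1 M w" and wcs: "compact (closure {x. w x \<noteq> 0})" "closure {x. w x \<noteq> 0} \<subseteq> \<Omega>"
    using w(1) unfolding C0k_1_iff compact_support_in_def by auto
  define W where "W = cmap c ` (\<Omega> \<inter> cdom c)"
  have oW: "open W" unfolding W_def using chart_image_open[OF c \<Omega>] by (simp add: Int_commute)
  have Wc: "W \<subseteq> cimg c" by (auto simp: W_def)
  have W\<Omega>: "cext c y \<in> \<Omega>" "cext c y \<in> cdom c" "cext c y = cinv c y" "cmap c (cext c y) = y" if "y \<in> W" for y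
  proof -
    obtain x where x: "x \<in> \<Omega>" "x \<in> cdom c" "y = cmap c x" using \<open>y \<in> W\<close> by (auto simp: W_def)
    then show "cext c y \<in> \<Omega>" "cext c y \<in> cdom c" "cext c y = cinv c y" "cmap c (cext c y) = y"
      using chart_coordinates(5)[OF c x(2)] chart_coordinates(8)[OF c x(2)] by simp_all
  qed
  define S where "S = cmap c ` closure {x. w x \<noteq> 0}"
  have S: "compact S" unfolding S_def
    by (rule compact_continuous_image[OF continuous_on_subset[OF chart_coordinates(3)[OF c] w(3)] wcs(1)])
  have SW: "S \<subseteq> W" using wcs(2) w(3) by (auto simp: S_def W_def)
  obtain e where e: "e > 0" "(\<Union>x\<in>S. cball x e) \<subseteq> W"
    using compact_subset_open_imp_cball_epsilon_subset[OF S oW SW] .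
  define U where "U = (\<Union>x\<in>S. ball x e)"
  define K where "K = (\<lambda>(x, z). x + z) ` (S \<times> cball 0 e)"
  have U: "open U" "S \<subseteq> U" using e(1) by (auto simp: U_def)
  have K: "compact K" unfolding K_def case_prod_unfold
    by (intro compact_continuous_image compact_Times S compact_cball continuous_intros)
  have KU: "K = (\<Union>x\<in>S. cball x e)"
  proof -
    have "y \<in> K" if "x \<in> S" "y \<in> cball x e" for x y
      unfolding K_def by (rule image_eqI[of _ _ "(x, y - x)"]) (use that in \<open>auto simp: dist_norm norm_minus_commute\<close>)
    then show ?thesis by (auto simp: K_def dist_norm)
  qed
  have UK: "U \<subseteq> K" unfolding KU U_def by force
  have KW: "K \<subseteq> W" using e(2) by (simp add: KU)
  have UW: "U \<subseteq> W" using UK KW by auto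
  have Kc: "K \<subseteq> cimg c" using KW Wc by auto
  have Ub[measurable]: "U \<in> sets borel" using U by auto
  have Wb[measurable]: "W \<in> sets borel" using oW by auto
  \<comment> \<open>Everything is cut off to \<open>U\<close>, which turns local integrability into integrability on the whole space.\<close>
  define XX where "XX y = indicator (\<Omega> \<inter> cdom c) (cext c y) *\<^sub>R X c (cext c y)" for y
  define GG where "GG y = (if y \<in> cimg c then metric M c (cinv c y) else 0)" for y
  define q where "q y = indicator U y * gnorm M X (cext c y)" for y
  define r where "r y = indicator U y * max 0 (\<rho> (cext c y))" for y
  define D where "D y = indicator U y *\<^sub>R (GG y *v XX y)" for y
  define Y where "Y y = (indicator U y * vdens M c y * q y powr (p - 2)) *\<^sub>R XX y" for y
  have cm: "cext c \<in> borel_measurable borel" by (rule cext_measurable[OF c])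
  have vm[measurable]: "vdens M c \<in> borel_measurable borel" by (rule vdens_measurable[OF c])
  have XXm[measurable]: "XX \<in> borel_measurable borel"
    unfolding XX_def[abs_def] using measurable_compose[OF cm Xm[unfolded set_borel_measurable_def]] by simp
  have GGij: "(\<lambda>y. GG y $ i $ j) \<in> borel_measurable borel" for i j
  proof -
    have "(\<lambda>y. if y \<in> cimg c then metric M c (cinv c y) $ i $ j else 0) \<in> borel_measurable borel"
      using chart_coordinates(2)[OF c] by (intro borel_measurable_continuous_on_if continuous_on_const continuous_on_component metric_continuous[OF c]) auto
    moreover have "(\<lambda>y. if y \<in> cimg c then metric M c (cinv c y) $ i $ j else 0) = (\<lambda>y. GG y $ i $ j)"
      by (auto simp: GG_def)
    ultimately show ?thesis by simp
  qed
  have XXj: "(\<lambda>y. XX y $ j) \<in> borel_measurable borel" for j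
    unfolding cart_eq_inner_axis by measurable
  have GXm: "(\<lambda>y. GG y *v XX y) \<in> borel_measurable borel"
    by (rule borel_measurable_vecI) (use GGij XXj in \<open>simp add: matrix_vector_mult_def\<close>)
  have Dm[measurable]: "D \<in> borel_measurable borel" unfolding D_def[abs_def] using GXm by measurable
  have m1: "(\<lambda>x. indicator \<Omega> x *\<^sub>R gnorm M X x) \<in> borel_measurable borel"
    and m2: "(\<lambda>x. indicator \<Omega> x *\<^sub>R \<rho> x) \<in> borel_measurable borel"
    using X1 \<rho>1 by (auto simp: Lp_loc_def set_borel_measurable_def)
  have qe: "q = (\<lambda>y. indicator U y * (indicator \<Omega> (cext c y) *\<^sub>R gnorm M X (cext c y)))"
    using UW W\<Omega> by (auto simp: q_def fun_eq_iff indicator_def)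
  have re: "r = (\<lambda>y. indicator U y * max 0 (indicator \<Omega> (cext c y) *\<^sub>R \<rho> (cext c y)))"
    using UW W\<Omega> by (auto simp: r_def fun_eq_iff indicator_def)
  have qm[measurable]: "q \<in> borel_measurable borel" unfolding qe using measurable_compose[OF cm m1] by measurable
  have rm[measurable]: "r \<in> borel_measurable borel" unfolding re using measurable_compose[OF cm m2] by measurable
  have Ym[measurable]: "Y \<in> borel_measurable borel" unfolding Y_def[abs_def] by measurable
  have q0: "0 \<le> q y" for y by (simp add: q_def gnorm_nonneg)
  have r0: "0 \<le> r y" for y by (simp add: r_def)
  have XXU: "XX y = X c (cext c y)" if "y \<in> W" for y using W\<Omega>[OF that] by (simp add: XX_def)
  have GGU: "GG y = metric M c (cext c y)" if "y \<in> W" for y using W\<Omega>[OF that] that Wc by (auto simp: GG_def)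
  have qsq: "q y = sqrt (XX y \<bullet> (GG y *v XX y))" "(q y)\<^sup>2 = XX y \<bullet> (GG y *v XX y)" if "y \<in> U" for y
  proof -
    have y: "y \<in> W" using that UW by auto
    have g: "gdot M X X (cext c y) = XX y \<bullet> (GG y *v XX y)"
      using gdot_chart[OF c W\<Omega>(2)[OF y] W\<Omega>(1)[OF y] vf vf] XXU[OF y] GGU[OF y] by simp
    then show "q y = sqrt (XX y \<bullet> (GG y *v XX y))" using that by (simp add: q_def gnorm_def)
    then show "(q y)\<^sup>2 = XX y \<bullet> (GG y *v XX y)"
      using gdot_self_nonneg[of X "cext c y"] g by simp
  qed
  \<comment> \<open>On \<open>K\<close> the metric is uniformly elliptic and the density bounded, so a multiple \<open>Q\<close> of the length of \<open>X\<close>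
    dominates \<open>D\<close>, and its power of exponent \<open>p - 1\<close> dominates \<open>Y\<close>. The constant \<open>C\<close> is chosen to serve both.\<close>
  have cG: "continuous_on K (\<lambda>y. metric M c (cinv c y))"
    by (rule continuous_on_subset[OF metric_continuous[OF c] Kc])
  have posK: "v \<bullet> (metric M c (cinv c y) *v v) > 0" if "y \<in> K" "v \<noteq> 0" for y v
    by (rule metric_symmetric_posdef(2)[OF c chart_coordinates(7)[OF c] that(2)]) (use that Kc in auto)
  obtain a where a: "a > 0" "\<And>y v. y \<in> K \<Longrightarrow> norm v \<le> a * sqrt (v \<bullet> (metric M c (cinv c y) *v v))"
      "\<And>y v. y \<in> K \<Longrightarrow> norm (metric M c (cinv c y) *v v) \<le> a * sqrt (v \<bullet> (metric M c (cinv c y) *v v))"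
    using elliptic_bounds[OF K cG posK] by blast
  have "compact (vdens M c ` K)"
    by (rule compact_continuous_image[OF continuous_on_subset[OF vdens_continuous[OF c] Kc] K])
  then obtain B0 where B0: "\<forall>v\<in>vdens M c ` K. norm v \<le> B0" using compact_imp_bounded bounded_iff by metis
  define B where "B = max 0 B0"
  have B: "0 \<le> B" "\<And>y. y \<in> K \<Longrightarrow> vdens M c y \<le> B" using B0 by (fastforce simp: B_def)+
  have Xq: "norm (XX y) \<le> a * q y" "norm (GG y *v XX y) \<le> a * q y" if "y \<in> U" for y
  proof -
    have y: "y \<in> W" "y \<in> K" using that UW UK by auto
    have G: "GG y = metric M c (cinv c y)" using GGU[OF y(1)] W\<Omega>(3)[OF y(1)] by simp
    show "norm (XX y) \<le> a * q y" "norm (GG y *v XX y) \<le> a * q y"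
      using a(2)[OF y(2), of "XX y"] a(3)[OF y(2), of "XX y"] unfolding qsq(1)[OF that] G by auto
  qed
  define C where "C = max a ((B * a) powr (1 / (p - 1)))"
  have C: "C > 0" "a \<le> C" using a(1) by (auto simp: C_def)
  have Cp: "B * a \<le> C powr (p - 1)"
  proof -
    have "B * a = ((B * a) powr (1 / (p - 1))) powr (p - 1)"
      using p a(1) B(1) by (cases "B * a = 0") (auto simp: powr_powr)
    also have "\<dots> \<le> C powr (p - 1)" using p by (intro powr_mono2) (auto simp: C_def)
    finally show ?thesis .
  qed
  define Q where "Q y = C * q y" for y
  have DQ: "norm (D y) \<le> Q y" for y
  proof (cases "y \<in> U")
    case True
    have "a * q y \<le> C * q y" using C q0 by (intro mult_right_mono) auto
    then show ?thesis using Xq(2)[OF True] True by (simp add: D_def Q_def)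
  qed (simp add: D_def Q_def q_def)
  have YQ: "norm (Y y) \<le> Q y powr (p - 1)" for y
  proof (cases "y \<in> U")
    case True
    have v: "0 \<le> vdens M c y" "vdens M c y \<le> B" using vdens_nonneg[OF c] B(2) UK True by auto
    have "norm (Y y) = (vdens M c y * q y powr (p - 2)) * norm (XX y)"
      using True v by (simp add: Y_def)
    also have "\<dots> \<le> (B * q y powr (p - 2)) * (a * q y)"
      by (intro mult_mono mult_right_mono v Xq True) (use B in auto)
    also have "\<dots> = (B * a) * q y powr (p - 1)"
      using q0[of y] powr_add[of "q y" "p - 2" 1] by (cases "q y = 0") (auto simp: algebra_simps)
    also have "\<dots> \<le> C powr (p - 1) * q y powr (p - 1)" by (intro mult_right_mono Cp) auto
    also have "\<dots> = Q y powr (p - 1)" using C q0 by (simp add: Q_def powr_mult)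
    finally show ?thesis .
  qed (simp add: Y_def)
  have Qm: "Q \<in> borel_measurable borel" unfolding Q_def[abs_def] by measurable
  note KW' = KW[unfolded W_def]
  have iQ: "integrable lborel Q"
  proof (rule Bochner_Integration.integrable_bound[OF integrable_mult_right[OF chart_Lp_integrable[OF c K KW' X1], of C]])
    show "AE y in lborel. norm (Q y) \<le> norm (C * (indicator K y * \<bar>gnorm M X (cext c y)\<bar> powr 1))"
      using UK C gnorm_nonneg[of X] by (intro AE_I2) (auto simp: Q_def q_def indicator_def)
  qed (use Qm in simp)
  have iQp: "integrable lborel (\<lambda>y. Q y powr p)"
  proof (rule Bochner_Integration.integrable_bound[OF integrable_mult_right[OF chart_Lp_integrable[OF c K KW' Xp], of "C powr p"]])
    show "AE y in lborel. norm (Q y powr p) \<le> norm (C powr p * (indicator K y * \<bar>gnorm M X (cext c y)\<bar> powr p))"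
      using UK C gnorm_nonneg[of X] by (intro AE_I2) (auto simp: Q_def q_def indicator_def powr_mult)
  qed (use Qm in simp)
  have ir: "integrable lborel r"
  proof (rule Bochner_Integration.integrable_bound[OF chart_Lp_integrable[OF c K KW' \<rho>1]])
    show "AE y in lborel. norm (r y) \<le> norm (indicator K y * \<bar>\<rho> (cext c y)\<bar> powr 1)"
      using UK by (intro AE_I2) (auto simp: r_def indicator_def)
  qed simp
  \<comment> \<open>For test functions supported in \<open>U\<close> the cut-off has no effect, and taking the positive part of \<open>\<rho>\<close>
    changes the integrand on a null set only.\<close>
  have weak: "(\<integral>y. r y * partial \<psi> i y \<partial>lborel) = - (\<integral>y. D y $ i * \<psi> y \<partial>lborel)"
    if \<psi>: "smooth_on UNIV \<psi>" "compact_support_in U \<psi>" for \<psi> i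
  proof -
    have \<psi>W: "compact_support_in W \<psi>" using \<psi>(2) UW by (auto simp: compact_support_in_def)
    have \<psi>C: "Ck_on 1 UNIV \<psi>" using \<psi>(1) unfolding smooth_on_def by blast
    have off: "\<psi> y = 0" "partial \<psi> i y = 0" if "y \<notin> U" for y
    proof -
      have n: "y \<notin> closure {y. \<psi> y \<noteq> 0}" using that \<psi>(2) by (auto simp: compact_support_in_def)
      then show "\<psi> y = 0" using closure_subset[of "{y. \<psi> y \<noteq> 0}"] by auto
      have "egrad \<psi> y $ i = 0" using egrad_zero_off_support[OF n] by simp
      then show "partial \<psi> i y = 0" by (simp add: egrad_def)
    qed
    have pm: "(\<lambda>y. partial \<psi> i y) \<in> borel_measurable borel"
      using C1_D(2)[OF \<psi>C, of "axis i 1"] unfolding partial_def by (rule borel_measurable_continuous_onI)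
    have main: "(LINT y:W|lborel. \<rho> (cinv c y) * partial \<psi> i y) =
      - (LINT y:W|lborel. (metric M c (cinv c y) *v X c (cinv c y)) $ i * \<psi> y)"
      using X c \<psi>(1) \<psi>W unfolding is_weak_grad_def W_def Let_def by blast
    have "(\<integral>y. r y * partial \<psi> i y \<partial>lborel) = (LINT y:W|lborel. \<rho> (cinv c y) * partial \<psi> i y)"
      unfolding set_lebesgue_integral_def
    proof (rule integral_cong_AE)
      show "(\<lambda>y. r y * partial \<psi> i y) \<in> borel_measurable lborel" using pm rm by simp
      have "(\<lambda>y. indicator W y *\<^sub>R (\<rho> (cinv c y) * partial \<psi> i y)) =
          (\<lambda>y. indicator W y *\<^sub>R ((indicator \<Omega> (cext c y) *\<^sub>R \<rho> (cext c y)) * partial \<psi> i y))"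
        using W\<Omega> by (auto simp: indicator_def fun_eq_iff)
      moreover have "(\<lambda>y. indicator W y *\<^sub>R ((indicator \<Omega> (cext c y) *\<^sub>R \<rho> (cext c y)) * partial \<psi> i y)) \<in> borel_measurable borel"
        using measurable_compose[OF cm m2] pm by measurable
      ultimately show "(\<lambda>y. indicator W y *\<^sub>R (\<rho> (cinv c y) * partial \<psi> i y)) \<in> borel_measurable lborel" by simp
      show "AE y in lborel. r y * partial \<psi> i y = indicator W y *\<^sub>R (\<rho> (cinv c y) * partial \<psi> i y)"
        using AE_chart[OF c \<rho>0]
      proof eventually_elim
        case (elim y)
        show ?case
        proof (cases "y \<in> U")
          case True
          then have "y \<in> W" "y \<in> cimg c" using UW Wc by auto
          then show ?thesis using elim W\<Omega>[of y] True by (simp add: r_def)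
        qed (simp add: off)
      qed
    qed
    also have "\<dots> = - (\<integral>y. D y $ i * \<psi> y \<partial>lborel)"
    proof -
      have "indicator W y *\<^sub>R ((metric M c (cinv c y) *v X c (cinv c y)) $ i * \<psi> y) = D y $ i * \<psi> y" for y
      proof (cases "y \<in> U")
        case True
        then have y: "y \<in> W" using UW by auto
        then show ?thesis using True XXU[OF y] GGU[OF y] W\<Omega>(3)[OF y] by (simp add: D_def)
      qed (simp add: off)
      note pt = this
      show ?thesis unfolding main unfolding set_lebesgue_integral_def pt by (rule refl)
    qed
    finally show ?thesis .
  qed
  have superU: "0 \<le> (\<integral>y. Y y \<bullet> egrad \<phi> y \<partial>lborel)"
    if \<phi>: "Ck_on 1 UNIV \<phi>" "compact_support_in U \<phi>" "\<And>y. 0 \<le> \<phi> y" for \<phi>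
  proof -
    have \<phi>W: "compact_support_in (cmap c ` (\<Omega> \<inter> cdom c)) \<phi>"
      using \<phi>(2) UW by (auto simp: compact_support_in_def W_def)
    note L = lift_C0[OF c \<phi>(1) \<phi>W]
    have off: "egrad \<phi> y = 0" if "y \<notin> U" for y
      by (rule egrad_zero_off_support) (use that \<phi>(2) in \<open>auto simp: compact_support_in_def\<close>)
    define f where "f y = indicator U y * q y powr (p - 2) * (XX y \<bullet> egrad \<phi> y)" for y
    have "egrad \<phi> \<in> borel_measurable borel"
      using egrad_continuous[OF \<phi>(1)] by (rule borel_measurable_continuous_onI)
    then have fm: "f \<in> borel_measurable borel" unfolding f_def[abs_def] by measurable
    have eq: "indicator \<Omega> x *\<^sub>R (gnorm M X x powr (p - 2) * gdot M X (grad M (lift c \<phi>)) x) = lift c f x" for x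
    proof (cases "x \<in> \<Omega> \<and> x \<in> cdom c")
      case True
      define y where "y = cmap c x"
      have y: "y \<in> W" "y \<in> cimg c" and x: "cext c y = x" using True chart_coordinates(8)[OF c] by (auto simp: y_def W_def)
      have "mC1 M (lift c \<phi>)" using L(1) unfolding C0k_1_iff by simp
      then have "gdot M X (grad M (lift c \<phi>)) x = X c x \<bullet> egrad \<phi> y"
        using gdot_grad_chart[OF _ c _ vf] True egrad_lift[OF c y(2) \<phi>(1)] by (simp add: y_def)
      then show ?thesis
        using True XXU[OF y(1)] off[of y] x by (cases "y \<in> U") (auto simp: lift_def f_def q_def y_def[symmetric])
    next
      case False
      have "x \<notin> closure {x. lift c \<phi> x \<noteq> 0}" using False L(2) by (auto simp: compact_support_in_def)
      then have 0: "gdot M X (grad M (lift c \<phi>)) x = 0" by (rule gdot_grad_off_support)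
      have "lift c f x = 0"
      proof (cases "x \<in> cdom c")
        case True
        then have "cmap c x \<notin> W" using False W\<Omega>(1)[of "cmap c x"] chart_coordinates(8)[OF c True] by auto
        then have "cmap c x \<notin> U" using UW by auto
        then show ?thesis by (simp add: lift_def f_def)
      qed (simp add: lift_def)
      then show ?thesis using 0 by simp
    qed
    have "0 \<le> (LINT x:\<Omega>|vol M. gnorm M X x powr (p - 2) * gdot M X (grad M (lift c \<phi>)) x)"
      by (rule super[OF L(1)]) (use \<phi>(3) in \<open>simp add: lift_def\<close>)
    also have "\<dots> = (\<integral>y. vdens M c y * f y \<partial>lborel)"
      unfolding set_lebesgue_integral_def eq by (rule integral_lift(2)[OF c fm])
    also have "\<dots> = (\<integral>y. Y y \<bullet> egrad \<phi> y \<partial>lborel)"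
      by (rule Bochner_Integration.integral_cong) (auto simp: Y_def f_def)
    finally show ?thesis .
  qed
  define w' where "w' = pull c w"
  have w'C: "Ck_on 1 UNIV w'" unfolding w'_def by (rule pull_C1(1)[OF c w(1,3)])
  have w'0: "0 \<le> w' y" for y using w(2) by (simp add: w'_def pull_def)
  have woff: "w x = 0" if "x \<notin> closure {x. w x \<noteq> 0}" for x
    using that closure_subset[of "{x. w x \<noteq> 0}"] by auto
  have w'S: "w' y = 0" if "y \<notin> S" for y
  proof (cases "y \<in> cimg c")
    case True
    then have "cinv c y \<notin> closure {x. w x \<noteq> 0}"
      using that chart_coordinates(6)[OF c True] unfolding S_def by (metis imageI)
    then have "w (cinv c y) = 0" by (rule woff)
    then show ?thesis by (simp add: w'_def pull_def)
  qed (simp add: w'_def pull_def)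
  have w'cs: "compact_support_in U w'" by (rule compact_support_inI[OF S U(2) w'S])
  define T where "T y = Y y \<bullet> (h (r y) *\<^sub>R egrad w' y + (w' y * h' (r y)) *\<^sub>R D y)" for y
  have iT: "integrable lborel T" and T0: "0 \<le> (\<integral>y. T y \<partial>lborel)"
    unfolding T_def[abs_def]
    by (rule weak_inequality_test[OF p U(1) ir r0 _ DQ _ YQ _ iQ iQp weak superU h w'C w'cs w'0];
        use C q0 in \<open>simp add: Q_def\<close>)+
  \<comment> \<open>The density is contained in \<open>Y\<close> and reappears when the integral is taken over the manifold, hence the division.\<close>
  define f where "f y = T y / vdens M c y" for y
  have fm: "f \<in> borel_measurable borel" unfolding f_def[abs_def] using iT by measurable
  have vf': "vdens M c y * f y = T y" for y
    using vdens_pos[OF c, of y] UW Wc by (cases "y \<in> U") (force simp: f_def T_def Y_def)+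
  have LT: "test_integrand h h' w = lift c f"
  proof
    fix x
    show "test_integrand h h' w x = lift c f x"
    proof (cases "x \<in> \<Omega> \<and> x \<in> cdom c")
      case True
      define y where "y = cmap c x"
      have y: "y \<in> W" "y \<in> cimg c" and x: "cext c y = x" using True chart_coordinates(8)[OF c] by (auto simp: y_def W_def)
      have xi: "cinv c y = x" using W\<Omega>(3)[OF y(1)] x by simp
      have gd: "gdot M X (grad M w) x = X c x \<bullet> egrad w' y"
        using gdot_grad_chart[OF wC c _ vf] True egrad_pull[OF c y(2) wC] by (simp add: y_def w'_def)
      have wy: "w x = w' y" using y(2) xi by (simp add: w'_def pull_def)
      show ?thesis
      proof (cases "y \<in> U")
        case U: True
        have v: "vdens M c y > 0" by (rule vdens_pos[OF c y(2)])
        have qy: "q y = gnorm M X x" and ry: "r y = max 0 (\<rho> x)" using U x by (auto simp: q_def r_def)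
        have "q y powr (p - 2) * (XX y \<bullet> (GG y *v XX y)) = q y powr p"
          using q0[of y] powr_add[of "q y" "p - 2" 2]
          by (cases "q y = 0") (auto simp: qsq(2)[OF U, symmetric])
        then have "q y powr (p - 2) * (XX y \<bullet> D y) = q y powr p" using U by (simp add: D_def)
        moreover have "f y = q y powr (p - 2) * (h (r y) * (XX y \<bullet> egrad w' y) + w' y * h' (r y) * (XX y \<bullet> D y))"
          using U v by (simp add: f_def T_def Y_def inner_add_right, simp add: field_simps)
        ultimately have "f y = q y powr (p - 2) * (h (r y) * (XX y \<bullet> egrad w' y)) + w' y * h' (r y) * q y powr p"
          by (simp add: algebra_simps)
        then show ?thesis
          using True gd wy XXU[OF y(1)] x by (simp add: test_integrand_def lift_def y_def[symmetric] qy ry)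
      next
        case nU: False
        have "w' y = 0" using w'S nU U(2) by auto
        moreover have "egrad w' y = 0"
          by (rule egrad_zero_off_support) (use nU w'cs in \<open>auto simp: compact_support_in_def\<close>)
        ultimately show ?thesis using True gd wy nU
          by (simp add: test_integrand_def lift_def y_def[symmetric] f_def T_def Y_def)
      qed
    next
      case False
      have n: "x \<notin> closure {x. w x \<noteq> 0}" using False wcs(2) w(3) by auto
      have "lift c f x = 0"
      proof (cases "x \<in> cdom c")
        case True
        then have "cmap c x \<notin> W" using False W\<Omega>(1)[of "cmap c x"] chart_coordinates(8)[OF c True] by auto
        then have "cmap c x \<notin> U" using UW by auto
        then show ?thesis by (simp add: lift_def f_def T_def Y_def)
      qed (simp add: lift_def)
      then show ?thesis using gdot_grad_off_support[OF n] woff[OF n] by (simp add: test_integrand_def)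
    qed
  qed
  show "integrable (vol M) (test_integrand h h' w)"
    unfolding LT integral_lift(1)[OF c fm] vf' by (rule iT)
  show "0 \<le> (\<integral>x. test_integrand h h' w x \<partial>vol M)"
    unfolding LT integral_lift(2)[OF c fm] vf' by (rule T0)
qed

lemma test_integrand_add:
  assumes "mC1 M u" "mC1 M v"
  shows "test_integrand h h' (\<lambda>x. u x + v x) x = test_integrand h h' u x + test_integrand h h' v x"
  using gdot_grad_add[OF assms] by (simp add: test_integrand_def algebra_simps)

text \<open>The integrand is additive in the weight, so it is enough to write \<open>w\<close> as a finite
  sum of nonnegative weights, each supported in one chart. With plateau functions $b_1, \dots,
  b_m$ whose regions $\{b_i = 1\}$ cover the support, $w = \sum_i w\,b_i \prod_{j<i} (1 - b_j)$:
  the remainder $w \prod_j (1 - b_j)$ vanishes. The induction splits off one summand at a time.\<close>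

lemma test_inequality:
  assumes h: "\<And>t. 0 \<le> t \<Longrightarrow> (h has_real_derivative h' t) (at t)" "continuous_on {0..} h'"
      "\<And>t. 0 \<le> t \<Longrightarrow> 0 \<le> h t" "\<And>t. 0 \<le> t \<Longrightarrow> h t \<le> H" "\<And>t. 0 \<le> t \<Longrightarrow> \<bar>h' t\<bar> \<le> H"
    and w: "w \<in> C0k M 1 \<Omega>" "\<And>x. 0 \<le> w x"
  shows "integrable (vol M) (test_integrand h h' w) \<and> 0 \<le> (\<integral>x. test_integrand h h' w x \<partial>vol M)"
proof -
  let ?L = "test_integrand h h'"
  let ?P = "\<lambda>w. integrable (vol M) (?L w) \<and> 0 \<le> (\<integral>x. ?L w x \<partial>vol M)"
  let ?good = "\<lambda>b. b \<in> C0k M 1 \<Omega> \<and> (\<forall>z. 0 \<le> b z \<and> b z \<le> 1) \<and> (\<exists>c\<in>charts M. closure {z. b z \<noteq> 0} \<subseteq> cdom c)"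
  have chart: "?P w" if "c \<in> charts M" "w \<in> C0k M 1 \<Omega>" "\<And>x. 0 \<le> w x" "closure {x. w x \<noteq> 0} \<subseteq> cdom c" for c w
    using chart_test_inequality[OF h that] by blast
  have induct: "?P w" if "\<forall>b\<in>set bs. ?good b" "w \<in> C0k M 1 \<Omega>" "\<And>x. 0 \<le> w x"
      "\<And>x. w x * (\<Prod>b\<leftarrow>bs. 1 - b x) = 0" for bs w
    using that
  proof (induction bs arbitrary: w)
    case Nil
    then have "{x. w x \<noteq> 0} = {}" by simp
    then have "closure {x. w x \<noteq> 0} \<subseteq> cdom c" for c :: "('a, 'n) chart" by simp
    then show ?case using chart[OF _ Nil.prems(2,3)] charts_cover by blast
  next
    case (Cons b bs)
    then have b: "b \<in> C0k M 1 \<Omega>" "\<And>z. 0 \<le> b z" "\<And>z. b z \<le> 1" by auto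
    obtain c where c: "c \<in> charts M" "closure {z. b z \<noteq> 0} \<subseteq> cdom c" using Cons.prems(1) by auto
    have bC: "mC1 M b" and wC: "mC1 M w" using b(1) Cons.prems(2) unfolding C0k_1_iff by auto
    have w1: "(\<lambda>x. w x * b x) \<in> C0k M 1 \<Omega>" by (rule C0k_mult[OF Cons.prems(2) bC])
    have w2: "(\<lambda>x. w x * (1 - b x)) \<in> C0k M 1 \<Omega>" by (rule C0k_mult[OF Cons.prems(2) mC1_one_minus[OF bC]])
    have "closure {x. w x * b x \<noteq> 0} \<subseteq> closure {z. b z \<noteq> 0}" by (rule closure_mono) auto
    then have sub: "closure {x. w x * b x \<noteq> 0} \<subseteq> cdom c" using c(2) by (rule order_trans)
    have 1: "?P (\<lambda>x. w x * b x)"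
      by (rule chart[OF c(1) w1 _ sub]) (use Cons.prems(3) b(2) in simp)
    have 2: "?P (\<lambda>x. w x * (1 - b x))"
    proof (rule Cons.IH[OF _ w2])
      show "\<forall>b\<in>set bs. ?good b" using Cons.prems(1) by simp
      show "0 \<le> w x * (1 - b x)" for x using Cons.prems(3) b(3) by simp
      show "w x * (1 - b x) * (\<Prod>b\<leftarrow>bs. 1 - b x) = 0" for x
        using Cons.prems(4)[of x] by (simp add: mult.assoc)
    qed
    have C12: "mC1 M (\<lambda>x. w x * b x)" "mC1 M (\<lambda>x. w x * (1 - b x))" using w1 w2 unfolding C0k_1_iff by auto
    have "?L w x = ?L (\<lambda>x. w x * b x) x + ?L (\<lambda>x. w x * (1 - b x)) x" for x
    proof -
      have "(\<lambda>x. w x * b x + w x * (1 - b x)) = w" by (auto simp: algebra_simps)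
      with test_integrand_add[OF C12, of h h' x] show ?thesis by (simp only:)
    qed
    then have "?L w = (\<lambda>x. ?L (\<lambda>x. w x * b x) x + ?L (\<lambda>x. w x * (1 - b x)) x)" by (rule ext)
    then show ?case using 1 2 by simp
  qed
  define K where "K = closure {x. w x \<noteq> 0}"
  have K: "compact K" "K \<subseteq> \<Omega>" using w(1) unfolding C0k_1_iff compact_support_in_def K_def by auto
  have "\<forall>x\<in>K. \<exists>b N. ?good b \<and> open N \<and> x \<in> N \<and> (\<forall>z\<in>N. b z = 1)"
    using plateau_exists[OF \<Omega>] K(2) by (meson subsetD)
  from bchoice[OF this] obtain b where
    b: "\<forall>x\<in>K. \<exists>N. ?good (b x) \<and> open N \<and> x \<in> N \<and> (\<forall>z\<in>N. b x z = 1)" by auto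
  from bchoice[OF this] obtain N where
    N: "\<forall>x\<in>K. ?good (b x) \<and> open (N x) \<and> x \<in> N x \<and> (\<forall>z\<in>N x. b x z = 1)" by auto
  have bN: "\<And>x. x \<in> K \<Longrightarrow> ?good (b x)" "\<And>x. x \<in> K \<Longrightarrow> open (N x)" "\<And>x. x \<in> K \<Longrightarrow> x \<in> N x"
      "\<And>x z. x \<in> K \<Longrightarrow> z \<in> N x \<Longrightarrow> b x z = 1"
    using N by auto
  obtain D where D: "D \<subseteq> K" "finite D" "K \<subseteq> (\<Union>x\<in>D. N x)"
    using compact_finite_cover[of K N, OF K(1) bN(2,3)] by blast
  obtain xs where xs: "set xs = D" using finite_list[OF D(2)] by blast
  show ?thesis
  proof (rule induct[of "map b xs"])
    show "\<forall>b\<in>set (map b xs). ?good b" using bN(1) D(1) xs by auto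
    show "w x * (\<Prod>b\<leftarrow>map b xs. 1 - b x) = 0" for x
    proof (cases "w x = 0")
      case False
      then have "x \<in> K" using closure_subset[of "{x. w x \<noteq> 0}"] by (auto simp: K_def)
      then obtain z where z: "z \<in> D" "x \<in> N z" using D(3) by blast
      then have "1 - b z x = 0" using bN(4)[of z x] D(1) by auto
      then have "0 \<in> set (map (\<lambda>b. 1 - b x) (map b xs))" using z(1) xs by force
      then show ?thesis by (simp add: prod_list_zero_iff)
    qed simp
  qed (use w in auto)
qed

text \<open>Test with \<open>h t = (t + e) powr (1 - p)\<close> and the weight $|u|^p$. With $A =
  |u|\,|X|/(\rho + e)$ and $b = |\nabla u|$, the Cauchy-Schwarz inequality bounds the integrand
  by $p\,A^{p-1} b - (p-1) A^p$, and \<open>Young_powr\<close> with $s = (p-1)/p$ bounds this by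
  $s^{1-p} b^p - s A^p$, because $(p-1)(1-s) = s$. The integral being nonnegative, $s^p \int A^p
  \le \int b^p$. The regularization \<open>e\<close> keeps \<open>h\<close> and its derivative
  bounded.\<close>

lemma regularized_Hardy_inequality:
  assumes u: "u \<in> C0k M 1 \<Omega>" and e: "e > 0"
  shows "ennreal (((p - 1) / p) powr p) *
      (\<integral>\<^sup>+x. ennreal (indicator \<Omega> x * (\<bar>u x\<bar> * gnorm M X x / (max 0 (\<rho> x) + e)) powr p) \<partial>vol M)
    \<le> (\<integral>\<^sup>+x. ennreal (indicator \<Omega> x * gnorm M (grad M u) x powr p) \<partial>vol M)"
proof -
  define h where "h t = (t + e) powr (1 - p)" for t :: real
  define h' where "h' t = (1 - p) * (t + e) powr (- p)" for t :: real
  define H where "H = max (e powr (1 - p)) ((p - 1) * e powr (- p))"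
  define s where "s = (p - 1) / p"
  have s: "s > 0" using p by (simp add: s_def)
  have uC: "mC1 M u" and ucs: "compact_support_in \<Omega> u" using u unfolding C0k_1_iff by auto
  define w where "w x = \<bar>u x\<bar> powr p" for x
  note ap = abs_powr_derivative[OF p]
  have wC: "mC1 M w" unfolding w_def[abs_def] by (rule mC1_compose_real(1)[OF uC ap])
  have gw: "gdot M X (grad M w) x = p * \<bar>u x\<bar> powr (p - 1) * sgn (u x) * gdot M X (grad M u) x" for x
    unfolding w_def[abs_def] by (rule mC1_compose_real(2)[OF uC ap])
  have w: "w \<in> C0k M 1 \<Omega>"
    unfolding C0k_1_iff using wC compact_support_in_mono[OF ucs, of w] by (simp add: w_def)
  let ?L = "test_integrand h h' w"
  have "integrable (vol M) ?L \<and> 0 \<le> (\<integral>x. ?L x \<partial>vol M)"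
  proof (rule test_inequality[OF _ _ _ _ _ w])
    fix t :: real assume t: "0 \<le> t"
    show "(h has_real_derivative h' t) (at t)"
    proof -
      have "((\<lambda>t. (t + e) powr (1 - p)) has_real_derivative ((1 - p) * (t + e) powr (1 - p - 1)) * 1) (at t)"
        by (rule DERIV_chain2[OF has_real_derivative_powr]) (use t e in \<open>auto intro!: derivative_eq_intros\<close>)
      then show ?thesis by (simp add: h_def[abs_def] h'_def)
    qed
    show "0 \<le> h t" by (simp add: h_def)
    have "(t + e) powr (1 - p) \<le> e powr (1 - p)" "(t + e) powr (- p) \<le> e powr (- p)"
      using t e p by (auto intro!: powr_mono2')
    then show "h t \<le> H" "\<bar>h' t\<bar> \<le> H"
      using p by (auto simp: h_def h'_def H_def abs_mult le_max_iff_disj mult_left_mono)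
  next
    show "continuous_on {0..} h'"
      unfolding h'_def[abs_def] using e by (auto intro!: continuous_intros)
  qed (simp_all add: w_def)
  then have iL: "integrable (vol M) ?L" and L0: "0 \<le> (\<integral>x. ?L x \<partial>vol M)" by auto
  define A where "A x = \<bar>u x\<bar> * gnorm M X x / (max 0 (\<rho> x) + e)" for x
  define b where "b x = gnorm M (grad M u) x" for x
  have g0: "0 \<le> gnorm M X x" and b0: "0 \<le> b x" for x using gnorm_nonneg by (auto simp: b_def)
  have d0: "0 < max 0 (\<rho> x) + e" for x using e by (simp add: add_nonneg_pos)
  have A0: "0 \<le> A x" for x unfolding A_def using g0 d0[of x] by simp
  have pw: "indicator \<Omega> x * (s powr p * A x powr p) \<le> indicator \<Omega> x * b x powr p - s powr (p - 1) * ?L x" for x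
  proof (cases "x \<in> \<Omega>")
    case True
    define t where "t = max 0 (\<rho> x) + e"
    define g where "g = gnorm M X x"
    have t: "t > 0" using d0 by (simp add: t_def)
    have g: "g \<ge> 0" using g0 by (simp add: g_def)
    have Ax: "A x = \<bar>u x\<bar> * g / t" by (simp add: A_def g_def t_def)
    have hx: "h (max 0 (\<rho> x)) = t powr (1 - p)" "h' (max 0 (\<rho> x)) = (1 - p) * t powr (- p)"
      by (simp_all add: h_def h'_def t_def)
    have Ap: "A x powr p = \<bar>u x\<bar> powr p * g powr p * t powr (- p)"
      using g t by (simp add: Ax powr_divide powr_mult powr_minus_divide)
    have Ap1: "A x powr (p - 1) = \<bar>u x\<bar> powr (p - 1) * g powr (p - 1) * t powr (1 - p)"
      using g t powr_minus_divide[of t "p - 1"] by (simp add: Ax powr_divide powr_mult)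
    have gg: "g powr (p - 2) * (g * b x) = g powr (p - 1) * b x"
      using g powr_add[of g "p - 2" 1] by (cases "g = 0") (auto simp: algebra_simps)
    have "sgn (u x) * gdot M X (grad M u) x \<le> \<bar>gdot M X (grad M u) x\<bar>"
      by (auto simp: sgn_real_def)
    also have "\<dots> \<le> g * b x" using gdot_Cauchy_Schwarz by (simp add: g_def b_def)
    finally have cs: "sgn (u x) * gdot M X (grad M u) x \<le> g * b x" .
    have "g powr (p - 2) * (h (max 0 (\<rho> x)) * gdot M X (grad M w) x) =
        (g powr (p - 2) * t powr (1 - p) * p * \<bar>u x\<bar> powr (p - 1)) * (sgn (u x) * gdot M X (grad M u) x)"
      by (simp add: hx gw)
    also have "\<dots> \<le> (g powr (p - 2) * t powr (1 - p) * p * \<bar>u x\<bar> powr (p - 1)) * (g * b x)"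
      using p by (intro mult_left_mono cs) auto
    also have "\<dots> = (t powr (1 - p) * p * \<bar>u x\<bar> powr (p - 1)) * (g powr (p - 2) * (g * b x))" by simp
    also have "\<dots> = p * (A x powr (p - 1) * b x)" unfolding gg Ap1 by simp
    also have "\<dots> \<le> (p - 1) * s * A x powr p + s powr (1 - p) * b x powr p"
      by (rule Young_powr) (use p A0 b0 s in auto)
    finally have 1: "g powr (p - 2) * (h (max 0 (\<rho> x)) * gdot M X (grad M w) x)
        \<le> (p - 1) * s * A x powr p + s powr (1 - p) * b x powr p" .
    have 2: "w x * h' (max 0 (\<rho> x)) * g powr p = - (p - 1) * A x powr p"
      unfolding hx Ap w_def by (simp add: algebra_simps)
    have "?L x = g powr (p - 2) * (h (max 0 (\<rho> x)) * gdot M X (grad M w) x) + w x * h' (max 0 (\<rho> x)) * g powr p"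
      using True by (simp add: test_integrand_def g_def)
    also have "\<dots> \<le> (p - 1) * s * A x powr p + s powr (1 - p) * b x powr p - (p - 1) * A x powr p"
      using 1 2 by linarith
    also have "\<dots> = s powr (1 - p) * b x powr p - s * A x powr p"
    proof -
      have "(p - 1) * s - (p - 1) = - s" using p by (simp add: s_def field_simps)
      then have "(p - 1) * s * A x powr p - (p - 1) * A x powr p = - s * A x powr p"
        by (metis left_diff_distrib)
      then show ?thesis by linarith
    qed
    finally have "s powr (p - 1) * ?L x \<le> s powr (p - 1) * (s powr (1 - p) * b x powr p - s * A x powr p)"
      by (rule mult_left_mono) simp
    also have "\<dots> = (s powr (p - 1) * s powr (1 - p)) * b x powr p - (s powr (p - 1) * s) * A x powr p"
      by (simp add: algebra_simps)
    also have "s powr (p - 1) * s powr (1 - p) = 1" using s by (simp add: powr_add[symmetric])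
    also have "s powr (p - 1) * s = s powr p" using s powr_add[of s "p - 1" 1] by simp
    finally show ?thesis using True by simp
  next
    case False
    then show ?thesis by (simp add: test_integrand_def)
  qed
  have \<Omega>b: "\<Omega> \<in> sets (vol M)" using \<Omega> by (simp add: sets_vol)
  have ib: "integrable (vol M) (\<lambda>x. indicator \<Omega> x * b x powr p)"
    using integrable_mult_indicator[OF \<Omega>b gnorm_grad_integrable[OF u, of p]] p by (simp add: b_def)
  have meas: "(\<lambda>x. indicator \<Omega> x * (s powr p * A x powr p)) \<in> borel_measurable (vol M)"
  proof -
    define G where "G x = indicator \<Omega> x *\<^sub>R gnorm M X x" for x
    define R where "R x = indicator \<Omega> x *\<^sub>R \<rho> x" for x
    have [measurable]: "G \<in> borel_measurable borel" "R \<in> borel_measurable borel"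
      using X unfolding is_weak_grad_def Lp_loc_def set_borel_measurable_def G_def[abs_def] R_def[abs_def] by auto
    have [measurable]: "\<Omega> \<in> sets borel" using \<Omega> by simp
    have [measurable]: "u \<in> borel_measurable borel" by (rule borel_measurable_continuous_onI[OF mC1_continuous[OF uC]])
    have "(\<lambda>x. indicator \<Omega> x * (s powr p *
        (\<bar>u x\<bar> * G x / (max 0 (R x) + e)) powr p)) \<in> borel_measurable borel"
      by measurable
    moreover have "(\<lambda>x. indicator \<Omega> x * (s powr p *
        (\<bar>u x\<bar> * G x / (max 0 (R x) + e)) powr p)) =
        (\<lambda>x. indicator \<Omega> x * (s powr p * A x powr p))"
    proof
      show "indicator \<Omega> x * (s powr p * (\<bar>u x\<bar> * G x / (max 0 (R x) + e)) powr p) =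
          indicator \<Omega> x * (s powr p * A x powr p)" for x
        by (cases "x \<in> \<Omega>") (simp_all add: A_def G_def R_def)
    qed
    ultimately have "(\<lambda>x. indicator \<Omega> x * (s powr p * A x powr p)) \<in> borel_measurable borel" by (simp only:)
    then show ?thesis by (subst measurable_cong_sets[OF sets_vol refl])
  qed
  have iR: "integrable (vol M) (\<lambda>x. indicator \<Omega> x * b x powr p - s powr (p - 1) * ?L x)"
    using ib iL by auto
  have iA: "integrable (vol M) (\<lambda>x. indicator \<Omega> x * (s powr p * A x powr p))"
    by (rule Bochner_Integration.integrable_bound[OF iR meas])
      (use pw in \<open>auto simp: abs_mult intro!: AE_I2 intro: order_trans[OF _ abs_ge_self]\<close>)
  have "(\<integral>x. indicator \<Omega> x * (s powr p * A x powr p) \<partial>vol M) \<le> (\<integral>x. indicator \<Omega> x * b x powr p - s powr (p - 1) * ?L x \<partial>vol M)"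
    by (rule integral_mono[OF iA iR pw])
  also have "\<dots> = (\<integral>x. indicator \<Omega> x * b x powr p \<partial>vol M) - s powr (p - 1) * (\<integral>x. ?L x \<partial>vol M)"
    using ib iL by simp
  also have "\<dots> \<le> (\<integral>x. indicator \<Omega> x * b x powr p \<partial>vol M)" using L0 by simp
  finally have main: "(\<integral>x. indicator \<Omega> x * (s powr p * A x powr p) \<partial>vol M) \<le> (\<integral>x. indicator \<Omega> x * b x powr p \<partial>vol M)" .
  have eqn: "indicator \<Omega> x * (s powr p * A x powr p) = s powr p * (indicator \<Omega> x * A x powr p)" for x by simp
  have iA': "integrable (vol M) (\<lambda>x. indicator \<Omega> x * A x powr p)"
    using iA unfolding eqn using s by simp
  have "ennreal (s powr p) * (\<integral>\<^sup>+x. ennreal (indicator \<Omega> x * A x powr p) \<partial>vol M) =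
      ennreal (s powr p) * ennreal (\<integral>x. indicator \<Omega> x * A x powr p \<partial>vol M)"
    by (subst nn_integral_eq_integral[OF iA']) auto
  also have "\<dots> = ennreal (\<integral>x. indicator \<Omega> x * (s powr p * A x powr p) \<partial>vol M)"
    unfolding eqn by (subst ennreal_mult[symmetric]) auto
  also have "\<dots> \<le> ennreal (\<integral>x. indicator \<Omega> x * b x powr p \<partial>vol M)" by (rule ennreal_leI[OF main])
  also have "\<dots> = (\<integral>\<^sup>+x. ennreal (indicator \<Omega> x * b x powr p) \<partial>vol M)"
    by (rule nn_integral_eq_integral[OF ib, symmetric]) auto
  finally show ?thesis by (simp add: s_def A_def b_def)
qed

text \<open>Fatou's lemma as the regularization tends to 0.\<close>

lemma Hardy_inequality:
  assumes u: "u \<in> C0k M 1 \<Omega>"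
  shows "ennreal (((p - 1) / p) powr p) *
        (\<integral>\<^sup>+x\<in>\<Omega>. ennreal (\<bar>u x\<bar> powr p) / ennreal (\<rho> x powr p) * ennreal (gnorm M X x powr p) \<partial>vol M)
      \<le> (\<integral>\<^sup>+x\<in>\<Omega>. ennreal (gnorm M (grad M u) x powr p) \<partial>vol M)"
proof -
  let ?c = "((p - 1) / p) powr p"
  have c: "?c > 0" using p by simp
  define f where "f n x = ennreal (indicator \<Omega> x * (\<bar>u x\<bar> * gnorm M X x / (max 0 (\<rho> x) + inverse (real (Suc n)))) powr p)" for n x
  define B where "B = (\<integral>\<^sup>+x. ennreal (indicator \<Omega> x * gnorm M (grad M u) x powr p) \<partial>vol M)"
  have fB: "(\<integral>\<^sup>+x. f n x \<partial>vol M) \<le> ennreal (1 / ?c) * B" for n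
  proof -
    have "ennreal (1 / ?c) * (ennreal ?c * (\<integral>\<^sup>+x. f n x \<partial>vol M)) \<le> ennreal (1 / ?c) * B"
      unfolding f_def B_def by (intro mult_left_mono regularized_Hardy_inequality[OF u]) auto
    moreover have "ennreal (1 / ?c) * ennreal ?c = 1"
      using c by (subst ennreal_mult[symmetric]) auto
    ultimately show ?thesis by (simp add: mult.assoc[symmetric])
  qed
  have uC: "mC1 M u" using u unfolding C0k_1_iff by simp
  have fm: "f n \<in> borel_measurable (vol M)" for n
  proof -
    define G where "G x = indicator \<Omega> x *\<^sub>R gnorm M X x" for x
    define R where "R x = indicator \<Omega> x *\<^sub>R \<rho> x" for x
    have [measurable]: "G \<in> borel_measurable borel" "R \<in> borel_measurable borel"
      using X unfolding is_weak_grad_def Lp_loc_def set_borel_measurable_def G_def[abs_def] R_def[abs_def] by auto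
    have [measurable]: "\<Omega> \<in> sets borel" using \<Omega> by simp
    have [measurable]: "u \<in> borel_measurable borel" by (rule borel_measurable_continuous_onI[OF mC1_continuous[OF uC]])
    have "(\<lambda>x. ennreal (indicator \<Omega> x *
        (\<bar>u x\<bar> * G x / (max 0 (R x) + inverse (real (Suc n)))) powr p)) \<in> borel_measurable borel"
      by measurable
    moreover have "(\<lambda>x. ennreal (indicator \<Omega> x *
        (\<bar>u x\<bar> * G x / (max 0 (R x) + inverse (real (Suc n)))) powr p)) = f n"
    proof
      show "ennreal (indicator \<Omega> x * (\<bar>u x\<bar> * G x / (max 0 (R x) + inverse (real (Suc n)))) powr p) = f n x" for x
        by (cases "x \<in> \<Omega>") (simp_all add: f_def G_def R_def)
    qed
    ultimately have "f n \<in> borel_measurable borel" by (simp only:)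
    then show ?thesis by (subst measurable_cong_sets[OF sets_vol refl])
  qed
  have "(\<integral>\<^sup>+x\<in>\<Omega>. ennreal (\<bar>u x\<bar> powr p) / ennreal (\<rho> x powr p) * ennreal (gnorm M X x powr p) \<partial>vol M)
      \<le> (\<integral>\<^sup>+x. liminf (\<lambda>n. f n x) \<partial>vol M)"
  proof (rule nn_integral_mono_AE)
    show "AE x in vol M. ennreal (\<bar>u x\<bar> powr p) / ennreal (\<rho> x powr p) * ennreal (gnorm M X x powr p) * indicator \<Omega> x
        \<le> liminf (\<lambda>n. f n x)"
      using \<rho>0
    proof eventually_elim
      case (elim x)
      show ?case
      proof (cases "x \<in> \<Omega>")
        case True
        then have r: "0 \<le> \<rho> x" using elim by simp
        show ?thesis
          using quotient_le_liminf[OF p abs_ge_zero gnorm_nonneg r, of "u x" X x] True r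
          by (simp add: f_def)
      qed simp
    qed
  qed
  also have "\<dots> \<le> liminf (\<lambda>n. \<integral>\<^sup>+x. f n x \<partial>vol M)"
    by (rule nn_integral_liminf[OF fm])
  also have "\<dots> \<le> ennreal (1 / ?c) * B"
    by (rule Liminf_le) (auto intro: always_eventually fB)
  finally have "ennreal ?c * (\<integral>\<^sup>+x\<in>\<Omega>. ennreal (\<bar>u x\<bar> powr p) / ennreal (\<rho> x powr p) * ennreal (gnorm M X x powr p) \<partial>vol M)
      \<le> ennreal ?c * (ennreal (1 / ?c) * B)" by (rule mult_left_mono) simp
  also have "\<dots> = B"
  proof -
    have "ennreal ?c * ennreal (1 / ?c) = 1" using c by (subst ennreal_mult[symmetric]) auto
    then show ?thesis by (simp add: mult.assoc[symmetric])
  qed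
  also have "B = (\<integral>\<^sup>+x\<in>\<Omega>. ennreal (gnorm M (grad M u) x powr p) \<partial>vol M)"
    unfolding B_def by (rule nn_integral_cong) (auto simp: indicator_def)
  finally show ?thesis .
qed

text \<open>Finitely many regions $\{b = 1\}$ of plateau functions cover a compact set, and on each of
  them the Hardy inequality for \<open>b\<close> bounds the integral of the quotient.\<close>

lemma quotient_L1_loc:
  "L1_loc_nonneg M \<Omega> (\<lambda>x. ennreal (gnorm M X x powr p) / ennreal (\<rho> x powr p))"
proof -
  let ?F = "\<lambda>x. ennreal (gnorm M X x powr p) / ennreal (\<rho> x powr p)"
  have \<Omega>b: "\<Omega> \<inter> space borel \<in> sets borel" using \<Omega> by simp
  have "gnorm M X \<in> borel_measurable (restrict_space borel \<Omega>)" "\<rho> \<in> borel_measurable (restrict_space borel \<Omega>)"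
    using X \<Omega>b unfolding is_weak_grad_def Lp_loc_def set_borel_measurable_def
    by (auto simp: borel_measurable_restrict_space_iff)
  then have Fm: "?F \<in> borel_measurable (restrict_space borel \<Omega>)" by measurable
  then have "(\<lambda>x. ?F x * indicator \<Omega> x) \<in> borel_measurable borel"
    by (rule iffD1[OF borel_measurable_restrict_space_iff_ennreal[OF \<Omega>b]])
  then have F\<Omega>: "(\<lambda>x. ?F x * indicator \<Omega> x) \<in> borel_measurable (vol M)"
    by (subst measurable_cong_sets[OF sets_vol refl])
  have "(\<integral>\<^sup>+x\<in>K. ?F x \<partial>vol M) < \<infinity>" if K: "compact K" "K \<subseteq> \<Omega>" for K
  proof -
    have "\<forall>x\<in>K. \<exists>b N. b \<in> C0k M 1 \<Omega> \<and> open N \<and> x \<in> N \<and> (\<forall>z\<in>N. b z = 1)"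
      using plateau_exists[OF \<Omega>] K(2) by (meson subsetD)
    then obtain b N where bN: "\<And>x. x \<in> K \<Longrightarrow> b x \<in> C0k M 1 \<Omega>" "\<And>x. x \<in> K \<Longrightarrow> open (N x)" "\<And>x. x \<in> K \<Longrightarrow> x \<in> N x"
        "\<And>x z. x \<in> K \<Longrightarrow> z \<in> N x \<Longrightarrow> b x z = 1"
      by metis
    obtain D where D: "D \<subseteq> K" "finite D" "K \<subseteq> (\<Union>x\<in>D. N x)"
      using compact_finite_cover[of K N, OF K(1) bN(2,3)] by blast
    have fin: "(\<integral>\<^sup>+x. ?F x * indicator \<Omega> x * indicator (N z) x \<partial>vol M) < \<infinity>" if z: "z \<in> D" for z
    proof -
      have zK: "z \<in> K" using z D by auto
      let ?I = "\<integral>\<^sup>+x\<in>\<Omega>. ennreal (\<bar>b z x\<bar> powr p) / ennreal (\<rho> x powr p) * ennreal (gnorm M X x powr p) \<partial>vol M"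
      have "(\<integral>\<^sup>+x\<in>\<Omega>. ennreal (gnorm M (grad M (b z)) x powr p) \<partial>vol M) \<le> (\<integral>\<^sup>+x. ennreal (gnorm M (grad M (b z)) x powr p) \<partial>vol M)"
        by (rule nn_integral_mono) (auto simp: indicator_def)
      also have "\<dots> < \<infinity>"
        using gnorm_grad_integrable[OF bN(1)[OF zK], of p] p by (simp add: integrable_iff_bounded)
      finally have "ennreal (((p - 1) / p) powr p) * ?I < \<infinity>"
        using Hardy_inequality[OF bN(1)[OF zK]] by (rule le_less_trans[rotated])
      moreover have "ennreal (((p - 1) / p) powr p) \<noteq> 0" using p by simp
      ultimately have "?I < \<infinity>" by (auto simp: ennreal_mult_less_top)
      moreover have "(\<integral>\<^sup>+x. ?F x * indicator \<Omega> x * indicator (N z) x \<partial>vol M) \<le> ?I"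
      proof (rule nn_integral_mono)
        fix x
        show "?F x * indicator \<Omega> x * indicator (N z) x \<le>
            ennreal (\<bar>b z x\<bar> powr p) / ennreal (\<rho> x powr p) * ennreal (gnorm M X x powr p) * indicator \<Omega> x"
          using bN(4)[OF zK, of x]
          by (cases "x \<in> N z") (auto simp: divide_ennreal_def mult.commute)
      qed
      ultimately show ?thesis by (rule le_less_trans[rotated])
    qed
    have "(\<integral>\<^sup>+x\<in>K. ?F x \<partial>vol M) \<le> (\<integral>\<^sup>+x. (\<Sum>z\<in>D. ?F x * indicator \<Omega> x * indicator (N z) x) \<partial>vol M)"
    proof (rule nn_integral_mono)
      fix x
      show "?F x * indicator K x \<le> (\<Sum>z\<in>D. ?F x * indicator \<Omega> x * indicator (N z) x)"
      proof (cases "x \<in> K")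
        case True
        then obtain z where z: "z \<in> D" "x \<in> N z" using D(3) by blast
        have "?F x * indicator K x = ?F x * indicator \<Omega> x * indicator (N z) x"
          using True z K(2) by (auto simp: indicator_def)
        also have "\<dots> \<le> (\<Sum>z\<in>D. ?F x * indicator \<Omega> x * indicator (N z) x)"
          by (rule member_le_sum[OF z(1)]) (use D(2) in auto)
        finally show ?thesis .
      qed simp
    qed
    also have "\<dots> = (\<Sum>z\<in>D. \<integral>\<^sup>+x. ?F x * indicator \<Omega> x * indicator (N z) x \<partial>vol M)"
    proof (rule nn_integral_sum)
      fix z assume "z \<in> D"
      then have "N z \<in> sets (vol M)" using bN(2) D(1) by (auto simp: sets_vol)
      then show "(\<lambda>x. ?F x * indicator \<Omega> x * indicator (N z) x) \<in> borel_measurable (vol M)"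
        by (intro borel_measurable_times_ennreal F\<Omega> borel_measurable_indicator)
    qed
    also have "\<dots> < \<infinity>" using fin D(2) by simp
    finally show ?thesis .
  qed
  then show ?thesis using Fm by (simp add: L1_loc_nonneg_def)
qed

end

end

theorem theorem2p1:
  fixes M :: "('a::{t2_space, second_countable_topology}, 'n::finite) riemannian"
    and \<Omega> :: "'a set" and \<rho> :: "'a \<Rightarrow> real" and p :: real
  assumes "p > 1"
    and "riemannian_manifold M" and "riemannian_complete M"
    and "open \<Omega>"
    and "\<rho> \<in> W1p_loc M p \<Omega>"
    and "AE x in vol M. x \<in> \<Omega> \<longrightarrow> 0 \<le> \<rho> x"
    and "weakly_p_superharmonic M p \<Omega> \<rho>"
  shows "L1_loc_nonneg M \<Omega>
      (\<lambda>x. ennreal (gnorm M (weak_grad M \<Omega> \<rho>) x powr p) / ennreal (\<rho> x powr p)) \<and>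
    (\<forall>u\<in>C0_infty M \<Omega>.
      ennreal (((p - 1) / p) powr p) *
        (\<integral>\<^sup>+x\<in>\<Omega>. ennreal (\<bar>u x\<bar> powr p) / ennreal (\<rho> x powr p) *
                 ennreal (gnorm M (weak_grad M \<Omega> \<rho>) x powr p) \<partial>vol M)
      \<le> (\<integral>\<^sup>+x\<in>\<Omega>. ennreal (gnorm M (grad M u) x powr p) \<partial>vol M))"
proof -
  let ?X = "weak_grad M \<Omega> \<rho>"
  have "\<exists>X. is_weak_grad M \<Omega> \<rho> X" and Xp: "Lp_loc M p \<Omega> (gnorm M ?X)"
    using assms(5) by (auto simp: W1p_loc_def)
  then have X: "is_weak_grad M \<Omega> \<rho> ?X" unfolding weak_grad_def by (metis someI_ex)
  have super: "0 \<le> (LINT x:\<Omega>|vol M. gnorm M ?X x powr (p - 2) * gdot M ?X (grad M \<phi>) x)"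
    if "\<phi> \<in> C0k M 1 \<Omega>" "\<And>x. 0 \<le> \<phi> x" for \<phi>
    using assms(7) that unfolding weakly_p_superharmonic_def by blast
  have "u \<in> C0k M 1 \<Omega>" if "u \<in> C0_infty M \<Omega>" for u
    using that unfolding C0_infty_def by blast
  then show ?thesis
    using quotient_L1_loc[OF assms(2,1,4) X Xp assms(6) super]
      Hardy_inequality[OF assms(2,1,4) X Xp assms(6) super] by blast
qed

end
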